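(* Let $\boldsymbol{X_1},\boldsymbol{X_2},\ldots,\boldsymbol{X_n}$ be i.i.d. $\mathbb{R}^t$-valued random vectors with probability density (or mass) function $f(\boldsymbol{x_i}|\boldsymbol{\theta})$, for which the parameter space $\Theta$ is an open subset of $\mathbb{R}^d$; let $\boldsymbol{\theta_0}=(\theta_{0_1},\ldots,\theta_{0_d})\in\Theta$ be the true parameter. Write $\boldsymbol{X}=(\boldsymbol{X_1},\ldots,\boldsymbol{X_n})$ and let $\boldsymbol{Z}\sim \mathrm{N}_d(\boldsymbol{0},I_{d\times d})$. Assume that the maximum likelihood estimator (MLE) $\boldsymbol{\hat{\theta}_n(X)}$ exists and is unique and that the regularity conditions (R.C.1)-(R.C.5) listed in the context are satisfied. Let $q:\Theta\to\mathbb{R}^d$ be twice differentiable, with all entries having continuous partial derivatives with respect to $\boldsymbol{\theta}$, and let $g:\mathbb{R}^t\to\mathbb{R}^d$ be such that $$q(\boldsymbol{\hat{\theta}_n(x)})=\frac1n\sum_{i=1}^n g(\boldsymbol{x_i})=\frac1n\sum_{i=1}^n\big(g_1(\boldsymbol{x_i}),\ldots,g_d(\boldsymbol{x_i})\big)^\intercal .$$ Let $$K=[\nabla q(\boldsymbol{\theta_0})]\,[I(\boldsymbol{\theta_0})]^{-1}\,[\nabla q(\boldsymbol{\theta_0})]^\intercal,\qquad \xi_{ij}=\sum_{l=1}^d\big[K^{-\frac12}\big]_{jl}\big(g_l(\boldsymbol{X_i})-q_l(\boldsymbol{\theta_0})\big).$$ Let $Q_{(m)}=\hat{\theta}_n(\boldsymbol{X})_{(m)}-\theta_{0_{(m)}}$,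 where $(m)\in\{1,\ldots,d\}$ is an index for which $|\hat{\theta}_n(\boldsymbol{X})_{(m)}-\theta_{0_{(m)}}|\ge|\hat{\theta}_n(\boldsymbol{X})_j-\theta_{0_j}|$ for all $j\in\{1,\ldots,d\}$. Let $\epsilon=\epsilon(\boldsymbol{\theta_0})>0$ and $M_{klm}(\boldsymbol{X})$, $k,l,m\in\{1,\ldots,d\}$, be such that $$\left|\frac{\partial^2}{\partial\theta_m\partial\theta_l}q_k(\boldsymbol{\theta})\right|\le M_{klm}(\boldsymbol{X})\quad\text{for all }\boldsymbol{\theta}\in\Theta\text{ with }|\theta_j-\theta_{0_j}|<\epsilon\ \text{ for all } j\in\{1,\ldots,d\}.$$ Then, for all $h\in C_b^2(\mathbb{R}^d)$, $$\begin{aligned} &\left|\mathbb{E}\left[h\left(\sqrt{n}\,[I(\boldsymbol{\theta_0})]^{\frac12}\big(\boldsymbol{\hat{\theta}_n(X)}-\boldsymbol{\theta_0}\big)\right)\right]-\mathbb{E}[h(\boldsymbol{Z})]\right|\\ &\le \frac{\sqrt{\pi}\,|h|_2}{4\sqrt{2}\,n^{3/2}}\sum_{i=1}^n\sum_{j,k,l=1}^d\Big\{\mathbb{E}|\xi_{ij}\xi_{ik}\xi_{il}|+2\,|\mathbb{E}[\xi_{ij}\xi_{ik}]|\,\mathbb{E}|\xi_{il}|\Big\} +2\frac{\|h\|}{\epsilon^2}\,\mathbb{E}\left[\sum_{j=1}^d\big(\hat{\theta}_n(\boldsymbol{X})_j-\theta_{0_j}\big)^2\right]\\ &\quad+\frac{|h|_1}{\sqrt{n}}\sum_{j=1}^d\Big\{\mathbb{E}\big[|A_{1j}(\boldsymbol{\theta_0},\boldsymbol{X})|\,\big|\,|Q_{(m)}|<\epsilon\big]+\mathbb{E}\big[|A_{2j}(\boldsymbol{\theta_0},\boldsymbol{X})|\,\big|\,|Q_{(m)}|<\epsilon\big]\Big\},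 \end{aligned}$$ where $$A_{1j}(\boldsymbol{\theta_0},\boldsymbol{X})=n\sum_{k=1}^d\left\{\Big([I(\boldsymbol{\theta_0})]^{\frac12}[\nabla q(\boldsymbol{\theta_0})]^{-1}-K^{-\frac12}\Big)_{jk}\Big(q_k\big(\boldsymbol{\hat{\theta}_n(X)}\big)-q_k(\boldsymbol{\theta_0})\Big)\right\},$$ $$A_{2j}(\boldsymbol{\theta_0},\boldsymbol{X})=\frac n2\sum_{k=1}^d\left\{\Big([I(\boldsymbol{\theta_0})]^{\frac12}[\nabla q(\boldsymbol{\theta_0})]^{-1}\Big)_{jk}\sum_{m=1}^d\sum_{l=1}^d\big(\hat{\theta}_n(\boldsymbol{X})_m-\theta_{0_m}\big)\big(\hat{\theta}_n(\boldsymbol{X})_l-\theta_{0_l}\big)\,M_{klm}(\boldsymbol{X})\right\}.$$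
   Context: Notation. For $\boldsymbol{x}=(\boldsymbol{x_1},\ldots,\boldsymbol{x_n})$, $\ell(\boldsymbol{\theta};\boldsymbol{x})=\sum_{i=1}^n\log f(\boldsymbol{x_i}|\boldsymbol{\theta})$ is the log-likelihood, and the MLE $\boldsymbol{\hat\theta_n(x)}$ is its maximizer over $\boldsymbol{\theta}\in\Theta$, with components $\hat\theta_n(\boldsymbol{x})_j$. The data are distributed according to the true parameter $\boldsymbol{\theta_0}$, and $\mathbb{E}$ refers to this distribution; $\mathbb{E}_{\boldsymbol{\theta}}$ is expectation under the parameter $\boldsymbol{\theta}$. $\nabla q(\boldsymbol{\theta_0})$ is the $d\times d$ Jacobian matrix of $q$ at $\boldsymbol{\theta_0}$, which is taken to be invertible, as the formulas require. $I(\boldsymbol{\theta})$ is the expected Fisher information matrix for one random vector, $I_{d\times d}$ is the $d\times d$ identity matrix, $[I(\boldsymbol{\theta_0})]^{1/2}$ is the principal square root, and $K^{-1/2}$ is the inverse of the principal square root of $K$. $C_b^2(\mathbb{R}^d)$ is the space of bounded functions on $\mathbb{R}^d$ with bounded $k$-th order derivatives for $k\le2$; $\|\cdot\|$ is the supremum norm, $|h|_1:=\sup_i\|\frac{\partial}{\partial x_i}h\|$ and $|h|_2:=\sup_{i,j}\|\frac{\partial^2}{\partial x_i\partial x_j}h\|$. Regularity conditions: (R.C.1) The densities defined by any two different values of $\boldsymbol{\theta}$ are distinct. (R.C.2) $\ell(\boldsymbol{\theta};\boldsymbol{x})$ is three times differentiable with respect to the unknown vector parameter $\boldsymbol{\theta}$,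 and the third partial derivatives are continuous in $\boldsymbol{\theta}$. (R.C.3) For any $\boldsymbol{\theta_0}\in\Theta$, with $\mathbb{X}$ denoting the support of the data, there exist $\epsilon_0>0$ and functions $\widetilde{M}_{rsu}(\boldsymbol{x})$ (which can depend on $\boldsymbol{\theta_0}$) such that for $r,s,u,j=1,\ldots,d$, $\left|\frac{\partial^3}{\partial\theta_r\partial\theta_s\partial\theta_u}\ell(\boldsymbol{\theta};\boldsymbol{x})\right|\le \widetilde{M}_{rsu}(\boldsymbol{x})$ for all $\boldsymbol{x}\in\mathbb{X}$, $|\theta_j-\theta_{0_j}|<\epsilon_0$, with $\mathbb{E}[\widetilde{M}_{rsu}(\boldsymbol{X})]<\infty$. (R.C.4) For all $\boldsymbol{\theta}\in\Theta$, $\mathbb{E}_{\boldsymbol{\theta}}[\nabla_{\boldsymbol{\theta}}\log f(\boldsymbol{X_i}|\boldsymbol{\theta})]=\boldsymbol{0}$. (R.C.5) The expected Fisher information matrix for one random vector $I(\boldsymbol{\theta})$ is finite, symmetric and positive definite. For $r,s=1,\ldots,d$, its elements satisfy $n[I(\boldsymbol{\theta})]_{rs}=\mathbb{E}_{\boldsymbol{\theta}}\left[\frac{\partial}{\partial\theta_r}\ell(\boldsymbol{\theta};\boldsymbol{X})\frac{\partial}{\partial\theta_s}\ell(\boldsymbol{\theta};\boldsymbol{X})\right]=\mathbb{E}_{\boldsymbol{\theta}}\left[-\frac{\partial^2}{\partial\theta_r\partial\theta_s}\ell(\boldsymbol{\theta};\boldsymbol{X})\right]$. This implies that $nI(\boldsymbol{\theta})$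 is the covariance matrix of $\nabla(\ell(\boldsymbol{\theta};\boldsymbol{X}))$.
   Formalization: Repaired: A_2j has absolute values on each factor; the MLE exists, is unique and satisfies the q–g identity (a.s.) for all sample sizes k≥n; the MLE is consistent; and segments from θ_0 to points of Θ in the ε-cube lie in Θ. As stated the bound fails. *)

theory Defs
  imports "HOL-Probability.Probability"
begin

section \<open>Calculus on Euclidean space\<close>

definition partial_deriv :: "'d::finite \<Rightarrow> (real ^ 'd \<Rightarrow> real) \<Rightarrow> real ^ 'd \<Rightarrow> real" where
  "partial_deriv i F x = deriv (\<lambda>t. F (x + t *\<^sub>R axis i 1)) 0"

text \<open>Membership in the class \<open>C\<^sup>k(S)\<close>, for an open set \<open>S\<close>.\<close>

primrec k_times_cont_diff_on :: "nat \<Rightarrow> (real ^ 'd::finite) set \<Rightarrow> (real ^ 'd \<Rightarrow> real) \<Rightarrow> bool" where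
  "k_times_cont_diff_on 0 S F \<longleftrightarrow> continuous_on S F"
| "k_times_cont_diff_on (Suc k) S F \<longleftrightarrow>
     (\<forall>x\<in>S. F differentiable (at x)) \<and> (\<forall>i. k_times_cont_diff_on k S (partial_deriv i F))"

definition Cb2 :: "(real ^ 'd::finite \<Rightarrow> real) set" where
  "Cb2 = {h. k_times_cont_diff_on 2 UNIV h \<and> bounded (range h)
           \<and> (\<forall>i. bounded (range (partial_deriv i h)))
           \<and> (\<forall>i j. bounded (range (partial_deriv i (partial_deriv j h))))}"

text \<open>The three suprema are real-valued and so only meaningful for \<open>h \<in> Cb2\<close>.\<close>

definition sup_norm :: "(real ^ 'd::finite \<Rightarrow> real) \<Rightarrow> real" where
  "sup_norm h = (SUP x. \<bar>h x\<bar>)"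

definition seminorm1 :: "(real ^ 'd::finite \<Rightarrow> real) \<Rightarrow> real" where
  "seminorm1 h = (SUP i. sup_norm (partial_deriv i h))"

definition seminorm2 :: "(real ^ 'd::finite \<Rightarrow> real) \<Rightarrow> real" where
  "seminorm2 h = (SUP (i, j). sup_norm (partial_deriv i (partial_deriv j h)))"


section \<open>Matrices\<close>

definition pos_semidef :: "real ^ 'd ^ 'd::finite \<Rightarrow> bool" where
  "pos_semidef A \<longleftrightarrow> transpose A = A \<and> (\<forall>v. 0 \<le> v \<bullet> (A *v v))"

definition pos_def :: "real ^ 'd ^ 'd::finite \<Rightarrow> bool" where
  "pos_def A \<longleftrightarrow> transpose A = A \<and> (\<forall>v. v \<noteq> 0 \<longrightarrow> 0 < v \<bullet> (A *v v))"

definition principal_sqrt :: "real ^ 'd ^ 'd::finite \<Rightarrow> real ^ 'd ^ 'd" where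
  "principal_sqrt A = (THE B. pos_semidef B \<and> B ** B = A)"


section \<open>Parametric models\<close>

text \<open>
  \<open>f x \<theta>\<close> is the density of one observation with respect to a reference measure \<open>\<nu>\<close>: Lebesgue
  measure for probability densities, the counting measure of a countable set for mass functions.
  A sample of size \<open>n\<close> is a function on \<open>{..<n}\<close>, extensional as in \<open>Pi\<^sub>M\<close>.
\<close>

definition law :: "(real ^ 't::finite) measure \<Rightarrow> (real ^ 't \<Rightarrow> real ^ 'd::finite \<Rightarrow> real)
    \<Rightarrow> real ^ 'd \<Rightarrow> (real ^ 't) measure" where
  "law \<nu> f \<theta> = density \<nu> (\<lambda>x. ennreal (f x \<theta>))"

definition sample_law :: "(real ^ 't::finite) measure \<Rightarrow> (real ^ 't \<Rightarrow> real ^ 'd::finite \<Rightarrow> real)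
    \<Rightarrow> nat \<Rightarrow> real ^ 'd \<Rightarrow> (nat \<Rightarrow> real ^ 't) measure" where
  "sample_law \<nu> f n \<theta> = Pi\<^sub>M {..<n} (\<lambda>_. law \<nu> f \<theta>)"

text \<open>
  The last conjunct says that the support does not depend on the parameter; without it the
  log-likelihood would not be finite on all of \<open>\<Theta>\<close> for the samples of the support.
\<close>

definition parametric_model :: "(real ^ 't::finite) measure
    \<Rightarrow> (real ^ 't \<Rightarrow> real ^ 'd::finite \<Rightarrow> real) \<Rightarrow> (real ^ 'd) set \<Rightarrow> bool" where
  "parametric_model \<nu> f \<Theta> \<longleftrightarrow>
     sigma_finite_measure \<nu> \<and> sets \<nu> = sets borel \<and> open \<Theta> \<and>
     (\<forall>\<theta>\<in>\<Theta>. (\<lambda>x. f x \<theta>) \<in> borel_measurable \<nu> \<and> (\<forall>x. 0 \<le> f x \<theta>) \<and> prob_space (law \<nu> f \<theta>)) \<and>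
     (\<forall>\<theta>\<in>\<Theta>. \<forall>\<theta>'\<in>\<Theta>. {x. 0 < f x \<theta>} = {x. 0 < f x \<theta>'})"

text \<open>The (parameter-free) support of a sample of size \<open>n\<close>.\<close>

definition sample_support :: "(real ^ 't::finite \<Rightarrow> real ^ 'd::finite \<Rightarrow> real)
    \<Rightarrow> (real ^ 'd) set \<Rightarrow> nat \<Rightarrow> (nat \<Rightarrow> real ^ 't) set" where
  "sample_support f \<Theta> n = ({..<n} \<rightarrow>\<^sub>E {x. \<forall>\<theta>\<in>\<Theta>. 0 < f x \<theta>})"

definition loglik :: "(real ^ 't::finite \<Rightarrow> real ^ 'd::finite \<Rightarrow> real) \<Rightarrow> nat
    \<Rightarrow> (nat \<Rightarrow> real ^ 't) \<Rightarrow> real ^ 'd \<Rightarrow> real" where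
  "loglik f n x \<theta> = (\<Sum>i<n. ln (f (x i) \<theta>))"

definition is_unique_mle :: "(real ^ 't::finite \<Rightarrow> real ^ 'd::finite \<Rightarrow> real) \<Rightarrow> (real ^ 'd) set
    \<Rightarrow> nat \<Rightarrow> (nat \<Rightarrow> real ^ 't) \<Rightarrow> real ^ 'd \<Rightarrow> bool" where
  "is_unique_mle f \<Theta> n x \<theta>' \<longleftrightarrow>
     \<theta>' \<in> \<Theta> \<and> (\<forall>\<theta>\<in>\<Theta>. \<theta> \<noteq> \<theta>' \<longrightarrow> loglik f n x \<theta> < loglik f n x \<theta>')"

definition fisher_info :: "(real ^ 't::finite) measure \<Rightarrow> (real ^ 't \<Rightarrow> real ^ 'd::finite \<Rightarrow> real)
    \<Rightarrow> real ^ 'd \<Rightarrow> real ^ 'd ^ 'd" where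
  "fisher_info \<nu> f \<theta> =
     (\<chi> r s. \<integral>x. partial_deriv r (\<lambda>\<theta>'. ln (f x \<theta>')) \<theta> * partial_deriv s (\<lambda>\<theta>'. ln (f x \<theta>')) \<theta> \<partial>law \<nu> f \<theta>)"


section \<open>Regularity conditions\<close>

definition RC1 :: "(real ^ 't::finite) measure \<Rightarrow> (real ^ 't \<Rightarrow> real ^ 'd::finite \<Rightarrow> real)
    \<Rightarrow> (real ^ 'd) set \<Rightarrow> bool" where
  "RC1 \<nu> f \<Theta> \<longleftrightarrow> (\<forall>\<theta>\<in>\<Theta>. \<forall>\<theta>'\<in>\<Theta>. \<theta> \<noteq> \<theta>' \<longrightarrow> \<not> (AE x in \<nu>. f x \<theta> = f x \<theta>'))"

definition RC2 :: "(real ^ 't::finite \<Rightarrow> real ^ 'd::finite \<Rightarrow> real) \<Rightarrow> (real ^ 'd) set \<Rightarrow> nat \<Rightarrow> bool" where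
  "RC2 f \<Theta> n \<longleftrightarrow> (\<forall>x\<in>sample_support f \<Theta> n. k_times_cont_diff_on 3 \<Theta> (loglik f n x))"

definition RC3 :: "(real ^ 't::finite) measure \<Rightarrow> (real ^ 't \<Rightarrow> real ^ 'd::finite \<Rightarrow> real)
    \<Rightarrow> (real ^ 'd) set \<Rightarrow> nat \<Rightarrow> bool" where
  "RC3 \<nu> f \<Theta> n \<longleftrightarrow>
     (\<forall>\<theta>\<^sub>0\<in>\<Theta>. \<exists>\<epsilon>\<^sub>0>0. \<exists>B :: 'd \<Rightarrow> 'd \<Rightarrow> 'd \<Rightarrow> (nat \<Rightarrow> real ^ 't) \<Rightarrow> real. \<forall>r s u.
        integrable (sample_law \<nu> f n \<theta>\<^sub>0) (B r s u) \<and>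
        (\<forall>x\<in>sample_support f \<Theta> n. \<forall>\<theta>\<in>\<Theta>. (\<forall>j. \<bar>\<theta> $ j - \<theta>\<^sub>0 $ j\<bar> < \<epsilon>\<^sub>0) \<longrightarrow>
           \<bar>partial_deriv r (partial_deriv s (partial_deriv u (loglik f n x))) \<theta>\<bar> \<le> B r s u x))"

definition RC4 :: "(real ^ 't::finite) measure \<Rightarrow> (real ^ 't \<Rightarrow> real ^ 'd::finite \<Rightarrow> real)
    \<Rightarrow> (real ^ 'd) set \<Rightarrow> bool" where
  "RC4 \<nu> f \<Theta> \<longleftrightarrow>
     (\<forall>\<theta>\<in>\<Theta>. \<forall>r. integrable (law \<nu> f \<theta>) (\<lambda>x. partial_deriv r (\<lambda>\<theta>'. ln (f x \<theta>')) \<theta>) \<and>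
        (\<integral>x. partial_deriv r (\<lambda>\<theta>'. ln (f x \<theta>')) \<theta> \<partial>law \<nu> f \<theta>) = 0)"

definition RC5 :: "(real ^ 't::finite) measure \<Rightarrow> (real ^ 't \<Rightarrow> real ^ 'd::finite \<Rightarrow> real)
    \<Rightarrow> (real ^ 'd) set \<Rightarrow> nat \<Rightarrow> bool" where
  "RC5 \<nu> f \<Theta> n \<longleftrightarrow>
     (\<forall>\<theta>\<in>\<Theta>. pos_def (fisher_info \<nu> f \<theta>) \<and>
       (\<forall>r s.
          integrable (law \<nu> f \<theta>)
            (\<lambda>x. partial_deriv r (\<lambda>\<theta>'. ln (f x \<theta>')) \<theta> * partial_deriv s (\<lambda>\<theta>'. ln (f x \<theta>')) \<theta>) \<and>
          integrable (sample_law \<nu> f n \<theta>)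
            (\<lambda>x. partial_deriv r (loglik f n x) \<theta> * partial_deriv s (loglik f n x) \<theta>) \<and>
          integrable (sample_law \<nu> f n \<theta>)
            (\<lambda>x. - partial_deriv r (partial_deriv s (loglik f n x)) \<theta>) \<and>
          real n * fisher_info \<nu> f \<theta> $ r $ s
            = (\<integral>x. partial_deriv r (loglik f n x) \<theta> * partial_deriv s (loglik f n x) \<theta>
                 \<partial>sample_law \<nu> f n \<theta>) \<and>
          real n * fisher_info \<nu> f \<theta> $ r $ s
            = (\<integral>x. - partial_deriv r (partial_deriv s (loglik f n x)) \<theta> \<partial>sample_law \<nu> f n \<theta>)))"

definition regularity_conditions :: "(real ^ 't::finite) measure
    \<Rightarrow> (real ^ 't \<Rightarrow> real ^ 'd::finite \<Rightarrow> real) \<Rightarrow> (real ^ 'd) set \<Rightarrow> nat \<Rightarrow> bool" where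
  "regularity_conditions \<nu> f \<Theta> n \<longleftrightarrow>
     RC1 \<nu> f \<Theta> \<and> RC2 f \<Theta> n \<and> RC3 \<nu> f \<Theta> n \<and> RC4 \<nu> f \<Theta> \<and> RC5 \<nu> f \<Theta> n"

text \<open>
  Convergence in probability of the estimators to \<open>\<theta>\<^sub>0\<close> as the sample size grows, the data being
  distributed according to \<open>\<theta>\<^sub>0\<close>. Conditions (R.C.1)--(R.C.5) do not imply it.
\<close>

definition consistent_at :: "(real ^ 't::finite) measure \<Rightarrow> (real ^ 't \<Rightarrow> real ^ 'd::finite \<Rightarrow> real)
    \<Rightarrow> real ^ 'd \<Rightarrow> (nat \<Rightarrow> (nat \<Rightarrow> real ^ 't) \<Rightarrow> real ^ 'd) \<Rightarrow> bool" where
  "consistent_at \<nu> f \<theta>\<^sub>0 est \<longleftrightarrow>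
     (\<forall>\<delta>>0. (\<lambda>N. measure (sample_law \<nu> f N \<theta>\<^sub>0)
                    {x \<in> space (sample_law \<nu> f N \<theta>\<^sub>0). \<delta> \<le> norm (est N x - \<theta>\<^sub>0)}) \<longlonglongrightarrow> 0)"

end

(* The error splits at W = n^(-1/2) (xi_1 + ... + xi_n), which by the hypothesis on q and g equals
   sqrt n K^(-1/2) (q(mle) - q(theta_0)).

   For W against Z, instead of solving Stein's equation, interpolate V = cos t W + sin t Z.
   Gaussian integration by parts gives
     d/dt E h(V) = - sin t (E W . grad h(V) - cos t E Lap h(V)),
   which a leave-one-out expansion bounds by a multiple of cos^2 t, whose integral over [0, pi/2] is
   pi/4. The third derivatives needed there are replaced by the Lipschitz constant of a
   Gaussian-smoothed second derivative, where the factor E|Z_j| = sqrt (2/pi) enters.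

   This requires E g(X_1) = q(theta_0) and Cov g(X_1) = K. Expanding the score equation around
   theta_0 and using consistency shows that n^(-1/2) times the sum of the variables
   g(X_i) - q(theta_0) - Dq(theta_0) I^(-1) score(X_i) tends to 0 in probability; by the central limit
   theorem these variables vanish almost surely. The second moments used here come from the third
   moments in the bound, which is trivial if one of them is infinite, except that a bounded h with
   vanishing second derivatives is constant.

   For the estimator against W, Chebyshev's inequality handles the event |Q| >= eps, and on its
   complement q is expanded to second order at theta_0. *)

theory Submission
  imports Defs
begin

text \<open>The bound is for one fixed \<open>n\<close>, but the mean and covariance of
  \<open>g\<close> show themselves only as the sample grows. The identity for \<open>q\<close> is
  therefore used at all sizes \<open>k \<ge> n\<close>, while the regularity conditions are given at
  size \<open>n\<close> only. They are first brought down to one observation, by freezing the other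
  \<open>n - 1\<close> at a generic point, and then summed to samples of any size.

  The rotation \<open>(cos t, sin t)\<close> keeps the covariance of \<open>V\<close> equal to the
  identity. The smoothed second derivative has a Lipschitz constant proportional to
  \<open>cos t / sin t\<close>, which is singular at \<open>0\<close>; the factor
  \<open>sin t\<close> in front of the derivative of the interpolation cancels the singularity, and
  the chain rule supplies the second \<open>cos t\<close>.

  The weight \<open>2\<close> inside the braces of the bound has a simple origin: the third moments
  come from a second-order Taylor remainder with its factor \<open>1 / 2\<close>, the products of
  second and first moments from a first-order difference without it.

  Events such as failure of the score equation need not be measurable, so convergence in probability
  is phrased with outer probabilities.\<close>

section \<open>Square roots of positive definite matrices\<close>

lemma transpose_eq_iff_inner:
  fixes A :: "real ^ 'd ^ 'd::finite"
  shows "transpose A = A \<longleftrightarrow> (\<forall>x y. x \<bullet> (A *v y) = (A *v x) \<bullet> y)"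
proof
  assume "transpose A = A"
  then show "\<forall>x y. x \<bullet> (A *v y) = (A *v x) \<bullet> y"
    by (metis dot_lmul_matrix transpose_matrix_vector)
next
  assume *: "\<forall>x y. x \<bullet> (A *v y) = (A *v x) \<bullet> y"
  have "(transpose A *v x) \<bullet> y = (A *v x) \<bullet> y" for x y
    using * by (simp add: transpose_matrix_vector dot_lmul_matrix)
  then have "transpose A *v x = A *v x" for x
    by (metis vector_eq_rdot)
  then show "transpose A = A"
    by (simp add: matrix_eq)
qed

text \<open>A nonzero linear coefficient dominates the quadratic term near \<open>0\<close> and
  changes sign there. This serves as the first-order condition at an extremum of a quadratic
  form.\<close>

lemma quadratic_nonneg_imp_linear_zero:
  fixes b q :: real
  assumes "\<And>t. 0 \<le> 2 * t * b + t\<^sup>2 * q"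
  shows "b = 0"
proof (rule ccontr)
  assume "b \<noteq> 0"
  \<comment> \<open>\<open>r\<close> is positive and exceeds \<open>q / 2\<close> whatever the sign
    of \<open>q\<close>, so the value at \<open>- b / r\<close> is negative.\<close>
  define r where "r = \<bar>q\<bar> + 1"
  have "r > 0" "q < 2 * r" by (auto simp: r_def)
  have "0 \<le> (2 * (- b / r) * b + (- b / r)\<^sup>2 * q) * r\<^sup>2"
    using assms[of "- b / r"] by (intro mult_nonneg_nonneg) auto
  also have "\<dots> = b\<^sup>2 * (q - 2 * r)"
    using \<open>r > 0\<close> by (simp add: field_simps power2_eq_square)
  finally show False
    using \<open>b \<noteq> 0\<close> \<open>q < 2 * r\<close> by (simp add: zero_le_mult_iff)
qed

text \<open>The eigenvector maximizes the Rayleigh quotient on the unit sphere of \<open>S\<close>.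
  There the first variation vanishes in every direction of \<open>S\<close>, in particular along the
  residual \<open>c *\<^sub>R x - A *v x\<close>, which lies in \<open>S\<close> by invariance. The
  subspace is a parameter for the sake of the induction on the dimension.\<close>

lemma symmetric_eigenvector_in_subspace:
  fixes A :: "real ^ 'd ^ 'd::finite"
  assumes sym: "transpose A = A" and S: "subspace S" and inv: "\<And>x. x \<in> S \<Longrightarrow> A *v x \<in> S"
    and ne: "S \<noteq> {0}"
  obtains x c where "x \<in> S" "norm x = 1" "A *v x = c *\<^sub>R x"
proof -
  have adj: "x \<bullet> (A *v y) = (A *v x) \<bullet> y" for x y
    using sym transpose_eq_iff_inner by blast
  obtain y where y: "y \<in> S" "y \<noteq> 0"
    using ne subspace_0[OF S] by blast
  have "compact (sphere 0 1 \<inter> S)"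
    by (intro compact_Int_closed closed_subspace S) auto
  moreover have "(1 / norm y) *\<^sub>R y \<in> sphere 0 1 \<inter> S"
    using y S by (auto intro: subspace_scale)
  then have "sphere 0 1 \<inter> S \<noteq> {}" by blast
  moreover have "continuous_on (sphere 0 1 \<inter> S) (\<lambda>x. x \<bullet> (A *v x))"
    by (intro continuous_intros)
  ultimately obtain x where x: "x \<in> S" "norm x = 1"
      and max: "\<And>y. y \<in> S \<Longrightarrow> norm y = 1 \<Longrightarrow> y \<bullet> (A *v y) \<le> x \<bullet> (A *v x)"
    using continuous_attains_sup[of "sphere 0 1 \<inter> S" "\<lambda>x. x \<bullet> (A *v x)"]
    by (metis IntD1 IntD2 IntI mem_sphere_0)
  define c where "c = x \<bullet> (A *v x)"
  have Q: "y \<bullet> (A *v y) \<le> c * (y \<bullet> y)" if "y \<in> S" for y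
  proof (cases "y = 0")
    case False
    define u where "u = (1 / norm y) *\<^sub>R y"
    have u: "u \<in> S" "norm u = 1" "y = norm y *\<^sub>R u"
      using False that S by (auto simp: u_def intro: subspace_scale)
    have "y \<bullet> (A *v y) = (norm y)\<^sup>2 * (u \<bullet> (A *v u))"
      by (subst (1 2) u(3)) (simp add: matrix_vector_mult_scaleR power2_eq_square)
    also have "\<dots> \<le> (norm y)\<^sup>2 * c"
      using max[OF u(1,2)] by (intro mult_left_mono) (auto simp: c_def)
    finally show ?thesis by (simp add: power2_norm_eq_inner mult.commute)
  qed simp
  define w where "w = c *\<^sub>R x - A *v x"
  have "w \<in> S" using x inv S by (auto simp: w_def intro: subspace_diff subspace_scale)
  \<comment> \<open>The constant terms cancel because \<open>x\<close> attains the maximum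
    \<open>c\<close>, and the linear coefficient is \<open>w \<bullet> w\<close> itself, so the
    first-order condition forces \<open>w = 0\<close>.\<close>
  have "0 \<le> 2 * t * (w \<bullet> w) + t\<^sup>2 * (c * (w \<bullet> w) - w \<bullet> (A *v w))" for t
  proof -
    have "x + t *\<^sub>R w \<in> S" using x \<open>w \<in> S\<close> S by (auto intro: subspace_add subspace_scale)
    note ineq = Q[OF this]
    have xx: "x \<bullet> x = 1" using x by (simp add: dot_square_norm)
    have e1: "(x + t *\<^sub>R w) \<bullet> (x + t *\<^sub>R w) = 1 + 2 * t * (x \<bullet> w) + t\<^sup>2 * (w \<bullet> w)"
      by (simp add: inner_add_left inner_add_right inner_commute algebra_simps power2_eq_square xx)
    have e2: "(x + t *\<^sub>R w) \<bullet> (A *v (x + t *\<^sub>R w))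
        = c + 2 * t * ((A *v x) \<bullet> w) + t\<^sup>2 * (w \<bullet> (A *v w))"
      using adj[of x w] unfolding c_def
      by (simp add: matrix_vector_right_distrib matrix_vector_mult_scaleR inner_add_left
          inner_add_right inner_commute algebra_simps power2_eq_square)
    have "w \<bullet> w = c * (x \<bullet> w) - (A *v x) \<bullet> w"
      using inner_diff_left[of "c *\<^sub>R x" "A *v x" w] by (simp add: w_def[symmetric])
    then have e3: "2 * t * (w \<bullet> w) = 2 * t * (c * (x \<bullet> w)) - 2 * t * ((A *v x) \<bullet> w)"
      by (simp add: right_diff_distrib)
    show ?thesis
      using ineq unfolding e1 e2 e3 by (simp add: algebra_simps)
  qed
  then have "w = 0"
    using quadratic_nonneg_imp_linear_zero by fastforce
  then show ?thesis using that[OF x, of c] by (simp add: w_def)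
qed

text \<open>Induction on the dimension: the part of \<open>S\<close> orthogonal to an eigenvector is
  again invariant, by symmetry of \<open>A\<close>, and its orthonormal eigenbasis is completed by
  that eigenvector.\<close>

lemma symmetric_eigenbasis_of_subspace:
  fixes A :: "real ^ 'd ^ 'd::finite"
  assumes sym: "transpose A = A" and S: "subspace S" and inv: "\<And>x. x \<in> S \<Longrightarrow> A *v x \<in> S"
  shows "\<exists>B. finite B \<and> pairwise orthogonal B \<and> (\<forall>b\<in>B. norm b = 1 \<and> (\<exists>c. A *v b = c *\<^sub>R b))
           \<and> span B = S"
  using S inv
proof (induction "dim S" arbitrary: S rule: less_induct)
  case less
  have adj: "x \<bullet> (A *v y) = (A *v x) \<bullet> y" for x y
    using sym transpose_eq_iff_inner by blast
  show ?case
  proof (cases "S = {0}")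
    case True
    then show ?thesis by (intro exI[of _ "{}"]) auto
  next
    case False
    then obtain x c where x: "x \<in> S" "norm x = 1" "A *v x = c *\<^sub>R x"
      using symmetric_eigenvector_in_subspace[OF sym less.prems] by metis
    have xx: "x \<bullet> x = 1" using x by (simp add: dot_square_norm)
    define T where "T = {y \<in> S. x \<bullet> y = 0}"
    have T: "subspace T"
      using less.prems(1) unfolding T_def subspace_def by (auto simp: inner_add_right)
    have invT: "A *v y \<in> T" if "y \<in> T" for y
      using that less.prems(2) x(3) by (auto simp: T_def adj)
    have "x \<notin> T" using xx by (auto simp: T_def)
    moreover have "T \<subseteq> S" by (auto simp: T_def)
    ultimately have "T \<subset> S" using x(1) by blast
    then have "dim T < dim S"
      using T less.prems(1) by (metis dim_psubset span_eq_iff)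
    from less.hyps[OF this T invT] obtain B where B: "finite B" "pairwise orthogonal B"
        "\<forall>b\<in>B. norm b = 1 \<and> (\<exists>c. A *v b = c *\<^sub>R b)" "span B = T" by blast
    have BT: "B \<subseteq> T" using B(4) span_superset by blast
    have "y \<in> span (insert x B)" if "y \<in> S" for y
    proof -
      have "y - (x \<bullet> y) *\<^sub>R x \<in> T"
        using that x(1) less.prems(1) xx
        by (auto simp: T_def inner_diff_right intro: subspace_diff subspace_scale)
      then show ?thesis using B(4) by (auto simp: span_insert)
    qed
    moreover have "span (insert x B) \<subseteq> S"
      using BT x(1) less.prems(1) by (intro span_minimal) (auto simp: T_def)
    ultimately have "span (insert x B) = S" by blast
    moreover have "pairwise orthogonal (insert x B)"
      using B(2) BT by (auto simp: pairwise_insert orthogonal_def T_def inner_commute)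
    ultimately show ?thesis
      using B x by (intro exI[of _ "insert x B"]) auto
  qed
qed

lemma symmetric_eigenbasis:
  fixes A :: "real ^ 'd ^ 'd::finite"
  assumes "transpose A = A"
  obtains B ev where "finite B" "pairwise orthogonal B" "\<And>b. b \<in> B \<Longrightarrow> norm b = 1"
    "\<And>b. b \<in> B \<Longrightarrow> A *v b = ev b *\<^sub>R b" "span B = UNIV"
  using symmetric_eigenbasis_of_subspace[OF assms, of UNIV] by simp metis

text \<open>The root scales each vector of an orthonormal eigenbasis by the square root of its
  eigenvalue, which is nonnegative by semidefiniteness.\<close>

lemma pos_semidef_sqrt_exists:
  fixes A :: "real ^ 'd ^ 'd::finite"
  assumes "pos_semidef A"
  shows "\<exists>R. pos_semidef R \<and> R ** R = A"
proof -
  obtain B ev where B: "finite B" "pairwise orthogonal B" "\<And>b. b \<in> B \<Longrightarrow> norm b = 1"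
    "\<And>b. b \<in> B \<Longrightarrow> A *v b = ev b *\<^sub>R b" "span B = UNIV"
    using symmetric_eigenbasis assms unfolding pos_semidef_def by metis
  have "0 \<le> ev b" if "b \<in> B" for b
  proof -
    have "0 \<le> b \<bullet> (A *v b)" using assms by (auto simp: pos_semidef_def)
    then show ?thesis using B that by (simp add: dot_square_norm)
  qed
  note pos = this
  define r where "r v = (\<Sum>b\<in>B. (sqrt (ev b) * (b \<bullet> v)) *\<^sub>R b)" for v
  have lin: "linear r"
    unfolding r_def
    by (intro linear_compose_sum ballI linearI) (auto simp: inner_add_right algebra_simps)
  have rb: "r b = sqrt (ev b) *\<^sub>R b" if "b \<in> B" for b
  proof -
    have "r b = (\<Sum>b'\<in>B. if b' = b then sqrt (ev b) *\<^sub>R b else 0)"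
      unfolding r_def using B(2,3) that
      by (intro sum.cong) (auto simp: pairwise_def orthogonal_def dot_square_norm)
    then show ?thesis using B(1) that by (simp add: sum.delta)
  qed
  have rv: "matrix r *v v = r v" for v using lin by (simp add: matrix_works)
  have "r (r v) = A *v v" for v
  proof -
    have "linear (\<lambda>v. r (r v))" using linear_compose[OF lin lin] by (simp add: o_def)
    then show ?thesis
    proof (rule linear_eq_on_span[where B=B])
      show "linear ((*v) A)" by simp
      show "v \<in> span B" using B(5) by simp
      fix b assume "b \<in> B"
      then show "r (r b) = A *v b"
        using rb[of b] B(4)[of b] pos[of b] by (simp add: linear_scale[OF lin] rb)
    qed
  qed
  then have "matrix r ** matrix r = A"
    by (simp add: matrix_eq rv flip: matrix_vector_mul_assoc)
  moreover have "pos_semidef (matrix r)"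
    unfolding pos_semidef_def transpose_eq_iff_inner rv
  proof safe
    fix x y show "x \<bullet> r y = r x \<bullet> y"
      unfolding r_def inner_sum_left inner_sum_right by (intro sum.cong) (auto simp: inner_commute)
  next
    fix v show "0 \<le> v \<bullet> r v"
      unfolding r_def inner_sum_right
      by (intro sum_nonneg) (auto simp: inner_commute pos mult.assoc)
  qed
  ultimately show ?thesis by blast
qed

lemma pos_def_invertible:
  fixes A :: "real ^ 'd ^ 'd::finite"
  assumes "pos_def A" shows "invertible A"
proof -
  have "x = 0" if "A *v x = 0" for x
    using assms that unfolding pos_def_def by (metis inner_zero_right less_irrefl)
  then show ?thesis
    by (metis invertible_left_inverse matrix_left_invertible_ker)
qed

text \<open>If \<open>B\<close>, \<open>C\<close> are roots, then \<open>D = B - C\<close> satisfies \<open>(B + C) D + D (B + C) = 0\<close>, so an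
  eigenvector of \<open>D\<close> for a nonzero eigenvalue would be isotropic for the positive definite \<open>B + C\<close>.\<close>

lemma pos_def_sqrt_unique:
  fixes A :: "real ^ 'd ^ 'd::finite"
  assumes A: "pos_def A" and B: "pos_semidef B" "B ** B = A" and C: "pos_semidef C" "C ** C = A"
  shows "B = C"
proof -
  have Bs: "transpose B = B" and Cs: "transpose C = C" using B C by (auto simp: pos_semidef_def)
  have adjB: "x \<bullet> (B *v y) = (B *v x) \<bullet> y" and adjC: "x \<bullet> (C *v y) = (C *v x) \<bullet> y" for x y
    using Bs Cs transpose_eq_iff_inner by blast+
  \<comment> \<open>A vector isotropic for a semidefinite form lies in its kernel, and a kernel
    vector of \<open>B\<close> is one of \<open>A = B ** B\<close>, which is definite.\<close>
  have pdB: "0 < x \<bullet> (B *v x)" if "x \<noteq> 0" for x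
  proof (rule ccontr)
    assume "\<not> ?thesis"
    then have 0: "x \<bullet> (B *v x) = 0" using B by (force simp: pos_semidef_def not_less intro: antisym)
    have "(B *v x) \<bullet> w = 0" for w
    proof (rule quadratic_nonneg_imp_linear_zero)
      fix t
      have "0 \<le> (x + t *\<^sub>R w) \<bullet> (B *v (x + t *\<^sub>R w))" using B by (auto simp: pos_semidef_def)
      then show "0 \<le> 2 * t * ((B *v x) \<bullet> w) + t\<^sup>2 * (w \<bullet> (B *v w))"
        using 0 adjB[of x w]
        by (simp add: matrix_vector_right_distrib matrix_vector_mult_scaleR inner_add_left
            inner_add_right inner_commute algebra_simps power2_eq_square)
    qed
    then have "B *v x = 0" by (metis inner_eq_zero_iff)
    then have "A *v x = 0" using B(2) by (metis matrix_vector_mul_assoc matrix_vector_mult_0_right)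
    then show False using A that by (metis inner_zero_right less_irrefl pos_def_def)
  qed
  have "transpose (B - C) = B - C"
    using Bs Cs by (simp add: transpose_def vec_eq_iff)
  then obtain E \<mu> where E: "finite E" "\<And>b. b \<in> E \<Longrightarrow> norm b = 1"
    "\<And>b. b \<in> E \<Longrightarrow> (B - C) *v b = \<mu> b *\<^sub>R b" "span E = UNIV"
    using symmetric_eigenbasis by metis
  have "(B - C) *v b = 0" if "b \<in> E" for b
  proof -
    have b: "B *v b - C *v b = \<mu> b *\<^sub>R b"
      using E(3)[OF that] by (simp add: matrix_vector_mult_diff_rdistrib)
    \<comment> \<open>Since \<open>B\<close> and \<open>C\<close> are symmetric with equal squares,
      \<open>B *v b\<close> and \<open>C *v b\<close> have the same length, so their difference is
      orthogonal to their sum.\<close>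
    have "(B *v b) \<bullet> (B *v b) = (C *v b) \<bullet> (C *v b)"
      using B(2) C(2) adjB[of b "B *v b"] adjC[of b "C *v b"] by (simp add: matrix_vector_mul_assoc)
    then have "(B *v b - C *v b) \<bullet> (B *v b + C *v b) = 0"
      by (simp add: inner_diff_left inner_add_right inner_commute[of "C *v b" "B *v b"])
    then have "\<mu> b * (b \<bullet> (B *v b) + b \<bullet> (C *v b)) = 0"
      unfolding b by (simp add: inner_add_right distrib_left)
    moreover have "0 < b \<bullet> (B *v b)" using pdB[of b] E(2)[OF that] by (cases "b = 0") auto
    moreover have "0 \<le> b \<bullet> (C *v b)" using C by (auto simp: pos_semidef_def)
    ultimately have "\<mu> b = 0" by auto
    then show ?thesis using E(3)[OF that] by simp
  qed
  then have "(B - C) *v v = 0 *v v" for v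
    using linear_eq_on_span[of "(*v) (B - C)" "(*v) 0" E v] E(4) by simp
  then have "B - C = 0" by (simp add: matrix_eq)
  then show ?thesis by simp
qed

lemma pos_def_imp_pos_semidef: "pos_def A \<Longrightarrow> pos_semidef A"
  unfolding pos_def_def pos_semidef_def by (metis inner_zero_left less_eq_real_def)

lemma principal_sqrt_pos_def:
  fixes A :: "real ^ 'd ^ 'd::finite"
  assumes "pos_def A"
  shows "pos_semidef (principal_sqrt A)" "principal_sqrt A ** principal_sqrt A = A"
proof -
  have "\<exists>!R. pos_semidef R \<and> R ** R = A"
    using pos_semidef_sqrt_exists[OF pos_def_imp_pos_semidef[OF assms]]
      pos_def_sqrt_unique[OF assms] by blast
  then have "pos_semidef (principal_sqrt A) \<and> principal_sqrt A ** principal_sqrt A = A"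
    unfolding principal_sqrt_def by (rule theI')
  then show "pos_semidef (principal_sqrt A)" "principal_sqrt A ** principal_sqrt A = A" by auto
qed

lemma matrix_inv_mult:
  fixes A :: "real ^ 'd ^ 'd::finite"
  assumes "invertible A"
  shows "matrix_inv A ** A = mat 1" "A ** matrix_inv A = mat 1"
proof -
  have "\<exists>A'. A ** A' = mat 1 \<and> A' ** A = mat 1" using assms by (simp add: invertible_def)
  then have "A ** matrix_inv A = mat 1 \<and> matrix_inv A ** A = mat 1"
    unfolding matrix_inv_def by (rule someI_ex)
  then show "matrix_inv A ** A = mat 1" "A ** matrix_inv A = mat 1" by auto
qed

text \<open>With \<open>A = K\<close> this turns vectors of covariance \<open>K\<close> into vectors
  of identity covariance; invertibility of the root allows the way back from the whitened vectors to
  \<open>g\<close>.\<close>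

lemma whitening_principal_sqrt:
  fixes A :: "real ^ 'd ^ 'd::finite"
  assumes "pos_def A"
  shows "invertible (principal_sqrt A)"
    "matrix_inv (principal_sqrt A) ** A ** transpose (matrix_inv (principal_sqrt A)) = mat 1"
proof -
  define R where "R = principal_sqrt A"
  note R = principal_sqrt_pos_def[OF assms, folded R_def]
  have RR: "R ** (R ** matrix_inv A) = mat 1"
    using R(2) matrix_inv_mult[OF pos_def_invertible[OF assms]] by (simp add: matrix_mul_assoc)
  then have inv: "invertible R" using invertible_right_inverse by blast
  then show "invertible (principal_sqrt A)" by (simp add: R_def)
  have Rs: "transpose R = R" using R(1) by (auto simp: pos_semidef_def)
  have "R ** transpose (matrix_inv R) = mat 1"
    by (metis Rs inv matrix_inv_mult(1) matrix_transpose_mul transpose_mat)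
  then have "matrix_inv R ** (R ** R) ** transpose (matrix_inv R) = mat 1"
    by (metis inv matrix_inv_mult(1) matrix_mul_assoc matrix_mul_lid)
  then show "matrix_inv (principal_sqrt A) ** A ** transpose (matrix_inv (principal_sqrt A)) = mat 1"
    using R(2) by (simp add: R_def)
qed

lemma pos_def_matrix_inv:
  fixes A :: "real ^ 'd ^ 'd::finite"
  assumes "pos_def A"
  shows "pos_def (matrix_inv A)"
proof -
  note inv = matrix_inv_mult[OF pos_def_invertible[OF assms]]
  have sym: "transpose A = A" using assms by (simp add: pos_def_def)
  have "matrix_inv A = transpose (matrix_inv A)"
    by (metis inv matrix_mul_assoc matrix_mul_lid matrix_mul_rid matrix_transpose_mul sym transpose_mat)
  moreover have "0 < v \<bullet> (matrix_inv A *v v)" if "v \<noteq> 0" for v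
  proof -
    define w where "w = matrix_inv A *v v"
    have v: "v = A *v w" by (simp add: w_def matrix_vector_mul_assoc inv)
    have "w \<noteq> 0" using that v by auto
    then have "0 < w \<bullet> (A *v w)" using assms by (auto simp: pos_def_def)
    then show ?thesis unfolding w_def[symmetric] using v by (simp add: inner_commute)
  qed
  ultimately show ?thesis by (auto simp: pos_def_def)
qed

lemma pos_def_congruence:
  fixes A J :: "real ^ 'd ^ 'd::finite"
  assumes "pos_def A" "invertible J"
  shows "pos_def (J ** A ** transpose J)"
proof -
  have "transpose (J ** A ** transpose J) = J ** A ** transpose J"
    using assms(1) by (simp add: matrix_transpose_mul pos_def_def matrix_mul_assoc)
  moreover have "0 < v \<bullet> ((J ** A ** transpose J) *v v)" if "v \<noteq> 0" for v
  proof -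
    define w where "w = transpose J *v v"
    have "transpose (matrix_inv J) *v w = v"
      unfolding w_def matrix_vector_mul_assoc
      by (metis assms(2) matrix_inv_mult(2) matrix_transpose_mul matrix_vector_mul_lid transpose_mat)
    then have "w \<noteq> 0" using that by auto
    then have "0 < w \<bullet> (A *v w)" using assms by (auto simp: pos_def_def)
    also have "w \<bullet> (A *v w) = v \<bullet> ((J ** A ** transpose J) *v v)"
      unfolding w_def by (simp add: transpose_matrix_vector dot_lmul_matrix flip: matrix_vector_mul_assoc)
    finally show ?thesis .
  qed
  ultimately show ?thesis by (auto simp: pos_def_def)
qed

section \<open>Gaussian shifts and integration by parts\<close>

text \<open>Dominated convergence for difference quotients along sequences, the mean value
  inequality bounding them by \<open>w\<close>. Domination is asked only within distance
  \<open>r\<close> of \<open>t0\<close>, because the exponential weights met below are dominated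
  only locally in the parameter.\<close>

lemma has_real_derivative_lebesgue_integral:
  fixes f f' :: "real \<Rightarrow> 'a \<Rightarrow> real"
  assumes r: "r > 0"
    and int: "\<And>t. \<bar>t - t0\<bar> < r \<Longrightarrow> integrable M (f t)"
    and der: "\<And>t x. \<bar>t - t0\<bar> < r \<Longrightarrow> x \<in> space M \<Longrightarrow> ((\<lambda>t. f t x) has_real_derivative f' t x) (at t)"
    and bound: "\<And>t x. \<bar>t - t0\<bar> < r \<Longrightarrow> x \<in> space M \<Longrightarrow> \<bar>f' t x\<bar> \<le> w x"
    and w: "integrable M w"
    and meas: "f' t0 \<in> borel_measurable M"
  shows "((\<lambda>t. \<integral>x. f t x \<partial>M) has_real_derivative (\<integral>x. f' t0 x \<partial>M)) (at t0)"
  unfolding has_field_derivative_iff tendsto_at_iff_sequentially comp_def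
proof safe
  fix X :: "nat \<Rightarrow> real"
  assume ne: "\<forall>i. X i \<in> UNIV - {t0}" and lim: "X \<longlonglongrightarrow> t0"
  from r lim obtain k where k: "\<And>n. n \<ge> k \<Longrightarrow> \<bar>X n - t0\<bar> < r"
    by (metis LIMSEQ_iff real_norm_def)
  \<comment> \<open>Dropping finitely many terms keeps the whole sequence in the interval where the
    bounds hold; \<open>LIMSEQ_offset\<close> undoes this at the end.\<close>
  define Y where "Y n = X (n + k)" for n
  have Y: "\<bar>Y n - t0\<bar> < r" "Y n \<noteq> t0" for n using k ne by (auto simp: Y_def)
  have limY: "Y \<longlonglongrightarrow> t0" unfolding Y_def using lim by (rule LIMSEQ_ignore_initial_segment)
  have "(\<lambda>n. \<integral>x. (f (Y n) x - f t0 x) / (Y n - t0) \<partial>M) \<longlonglongrightarrow> (\<integral>x. f' t0 x \<partial>M)"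
  proof (rule integral_dominated_convergence[where w=w])
    show "(\<lambda>x. (f (Y n) x - f t0 x) / (Y n - t0)) \<in> borel_measurable M" for n
      using int[of "Y n"] int[of t0] Y r by (intro borel_measurable_divide borel_measurable_diff) auto
    show "AE x in M. (\<lambda>n. (f (Y n) x - f t0 x) / (Y n - t0)) \<longlonglongrightarrow> f' t0 x"
    proof (rule AE_I2)
      fix x assume "x \<in> space M"
      then have "((\<lambda>y. (f y x - f t0 x) / (y - t0)) \<longlongrightarrow> f' t0 x) (at t0)"
        using der[of t0 x] r by (simp add: has_field_derivative_iff)
      then show "(\<lambda>n. (f (Y n) x - f t0 x) / (Y n - t0)) \<longlonglongrightarrow> f' t0 x"
        using limY Y(2) by (simp add: tendsto_at_iff_sequentially comp_def)
    qed
    show "AE x in M. norm ((f (Y n) x - f t0 x) / (Y n - t0)) \<le> w x" for n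
    proof (rule AE_I2)
      fix x assume x: "x \<in> space M"
      have "norm (f (Y n) x - f t0 x) \<le> w x * norm (Y n - t0)"
      proof (rule field_differentiable_bound[where S="ball t0 r" and f="\<lambda>t. f t x" and f'="\<lambda>t. f' t x"])
        fix t assume "t \<in> ball t0 r"
        then have t: "\<bar>t - t0\<bar> < r" by (simp add: dist_real_def abs_minus_commute)
        show "((\<lambda>t. f t x) has_field_derivative f' t x) (at t within ball t0 r)"
          using der[OF t x] by (rule has_field_derivative_at_within)
        show "norm (f' t x) \<le> w x" using bound[OF t x] by simp
      qed (use Y(1)[of n] r in \<open>auto simp: dist_real_def abs_minus_commute\<close>)
      then show "norm ((f (Y n) x - f t0 x) / (Y n - t0)) \<le> w x"
        using Y(2)[of n] by (simp add: divide_le_eq)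
    qed
  qed (use w meas in auto)
  moreover have "(\<integral>x. (f (Y n) x - f t0 x) / (Y n - t0) \<partial>M)
      = ((\<integral>x. f (Y n) x \<partial>M) - (\<integral>x. f t0 x \<partial>M)) / (Y n - t0)" for n
    using int[of "Y n"] int[of t0] Y[of n] r by simp
  ultimately have "(\<lambda>n. ((\<integral>x. f (X (n + k)) x \<partial>M) - (\<integral>x. f t0 x \<partial>M)) / (X (n + k) - t0))
      \<longlonglongrightarrow> (\<integral>x. f' t0 x \<partial>M)"
    by (simp only: Y_def)
  then show "(\<lambda>n. ((\<integral>x. f (X n) x \<partial>M) - (\<integral>x. f t0 x \<partial>M)) / (X n - t0)) \<longlonglongrightarrow> (\<integral>x. f' t0 x \<partial>M)"
    by (rule LIMSEQ_offset)
qed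

text \<open>\<open>lborel\<close> is the image of a product measure indexed by \<open>Basis\<close>.
  Reindexing \<open>Basis\<close> by the coordinates through \<open>axis\<close> reduces the claim
  to Fubini for products of one-variable functions.\<close>

lemma has_bochner_integral_lborel_prod_vec:
  fixes w :: "'d::finite \<Rightarrow> real \<Rightarrow> real"
  assumes w: "\<And>j. integrable lborel (w j)"
  shows "has_bochner_integral lborel (\<lambda>z :: real ^ 'd. \<Prod>j\<in>UNIV. w j (z $ j))
           (\<Prod>j\<in>UNIV. \<integral>x. w j x \<partial>lborel)"
proof -
  interpret product_sigma_finite "\<lambda>_ :: real ^ 'd. lborel :: real measure" ..
  define ax :: "'d \<Rightarrow> real ^ 'd" where "ax j = axis j 1" for j
  have bij: "bij_betw ax UNIV Basis"
    unfolding bij_betw_def ax_def Basis_vec_def by (auto intro!: injI simp: axis_eq_axis)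
  define w' where "w' b = w (the_inv_into UNIV ax b)" for b
  have w'_ax: "w' (ax j) = w j" for j
    using bij by (simp add: w'_def the_inv_into_f_f bij_betw_imp_inj_on)
  have sum_nth: "(\<Sum>b\<in>Basis. f b *\<^sub>R b) $ j = f (ax j)" for f :: "real ^ 'd \<Rightarrow> real" and j
  proof -
    have "(\<Sum>b\<in>Basis. f b *\<^sub>R b) $ j = (\<Sum>b\<in>Basis. f b *\<^sub>R b) \<bullet> ax j"
      by (simp add: ax_def inner_axis)
    also have "\<dots> = f (ax j)"
      using bij by (subst inner_sum_left_Basis) (auto simp: bij_betw_def)
    finally show ?thesis .
  qed
  have prod_eq: "(\<Prod>j\<in>UNIV. w j ((\<Sum>b\<in>Basis. f b *\<^sub>R b) $ j)) = (\<Prod>b\<in>Basis. w' b (f b))"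
    for f :: "real ^ 'd \<Rightarrow> real"
    unfolding sum_nth using prod.reindex_bij_betw[OF bij, of "\<lambda>b. w' b (f b)"] by (simp add: w'_ax)
  have int_w': "integrable lborel (w' b)" for b using w by (simp add: w'_def)
  have meas: "(\<lambda>z :: real ^ 'd. \<Prod>j\<in>UNIV. w j (z $ j)) \<in> borel_measurable borel"
  proof -
    have [measurable]: "w j \<in> borel_measurable borel" for j
      using borel_measurable_integrable[OF w[of j]] by simp
    show ?thesis by measurable
  qed
  have 1: "integrable (Pi\<^sub>M Basis (\<lambda>_. lborel)) (\<lambda>f. \<Prod>b\<in>(Basis :: (real ^ 'd) set). w' b (f b))"
    using int_w' by (intro product_integrable_prod) auto
  have 2: "(\<integral>f. (\<Prod>b\<in>(Basis :: (real ^ 'd) set). w' b (f b)) \<partial>Pi\<^sub>M Basis (\<lambda>_. lborel))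
      = (\<Prod>b\<in>(Basis :: (real ^ 'd) set). \<integral>x. w' b x \<partial>lborel)"
    using int_w' by (intro product_integral_prod) auto
  also have "\<dots> = (\<Prod>j\<in>UNIV. \<integral>x. w j x \<partial>lborel)"
    using prod.reindex_bij_betw[OF bij, of "\<lambda>b. \<integral>x. w' b x \<partial>lborel"] by (simp add: w'_ax)
  finally have eq: "(\<integral>f. (\<Prod>b\<in>(Basis :: (real ^ 'd) set). w' b (f b)) \<partial>Pi\<^sub>M Basis (\<lambda>_. lborel))
      = (\<Prod>j\<in>UNIV. \<integral>x. w j x \<partial>lborel)" .
  show ?thesis
    unfolding has_bochner_integral_iff
  proof -
    have T: "(\<lambda>f. \<Sum>b\<in>Basis. f b *\<^sub>R b :: real ^ 'd) \<in> measurable (Pi\<^sub>M Basis (\<lambda>_. lborel)) borel"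
      by measurable
    show "integrable lborel (\<lambda>z :: real ^ 'd. \<Prod>j\<in>UNIV. w j (z $ j)) \<and>
        (\<integral>z. (\<Prod>j\<in>UNIV. w j ((z :: real ^ 'd) $ j)) \<partial>lborel) = (\<Prod>j\<in>UNIV. \<integral>x. w j x \<partial>lborel)"
      unfolding lborel_eq[where 'a="real ^ 'd"] integrable_distr_eq[OF T meas] integral_distr[OF T meas] prod_eq
      using 1 eq by simp
  qed
qed

text \<open>Encoded by its Lebesgue density, the form in which the theorem prescribes the law of
  \<open>Z\<close>; translation invariance of \<open>lborel\<close> then yields the shift
  formula.\<close>

definition std_gaussian :: "(real ^ 'd::finite) measure" where
  "std_gaussian = density lborel (\<lambda>z. ennreal (\<Prod>j\<in>UNIV. std_normal_density (z $ j)))"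

lemma gauss_density_measurable [measurable]:
  "(\<lambda>z :: real ^ 'd::finite. \<Prod>j\<in>UNIV. std_normal_density (z $ j)) \<in> borel_measurable borel"
  by measurable

lemma sets_std_gaussian [measurable_cong, simp]: "sets std_gaussian = sets borel"
  and space_std_gaussian [simp]: "space std_gaussian = UNIV"
  by (auto simp: std_gaussian_def)

lemma gauss_density_nonneg: "0 \<le> (\<Prod>j\<in>UNIV. std_normal_density (z $ j))"
  by (intro prod_nonneg) auto

text \<open>With \<open>u\<close> placed in the factor for \<open>j\<close> only, the integral
  factorizes and all other factors integrate to \<open>1\<close>.\<close>

lemma std_gaussian_component:
  fixes u :: "real \<Rightarrow> real" and j :: "'d::finite"
  assumes [measurable]: "u \<in> borel_measurable borel"
    and int: "integrable lborel (\<lambda>x. std_normal_density x * u x)"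
  shows "integrable std_gaussian (\<lambda>z :: real ^ 'd. u (z $ j))"
    and "(\<integral>z. u (z $ j) \<partial>(std_gaussian :: (real ^ 'd) measure)) = (\<integral>x. std_normal_density x * u x \<partial>lborel)"
proof -
  define w where "w i x = (if i = j then std_normal_density x * u x else std_normal_density x)" for i x
  have "has_bochner_integral lborel (\<lambda>z :: real ^ 'd. \<Prod>i\<in>UNIV. w i (z $ i))
           (\<Prod>i\<in>UNIV. \<integral>x. w i x \<partial>lborel)"
  proof (rule has_bochner_integral_lborel_prod_vec)
    show "integrable lborel (w i)" for i
      using int integrable_normal_density[of 1 0] by (cases "i = j") (auto simp: w_def[abs_def])
  qed
  moreover have "(\<Prod>i\<in>UNIV. w i (z $ i)) = (\<Prod>i\<in>UNIV. std_normal_density (z $ i)) * u (z $ j)"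
    for z :: "real ^ 'd"
    by (subst (1 2) prod.remove[of UNIV j]) (auto simp: w_def)
  moreover have "(\<Prod>i\<in>UNIV. \<integral>x. w i x \<partial>lborel) = (\<integral>x. std_normal_density x * u x \<partial>lborel)"
    by (subst prod.remove[of UNIV j]) (auto simp: w_def[abs_def])
  ultimately have *: "has_bochner_integral lborel
      (\<lambda>z :: real ^ 'd. (\<Prod>i\<in>UNIV. std_normal_density (z $ i)) * u (z $ j))
      (\<integral>x. std_normal_density x * u x \<partial>lborel)"
    by simp
  show "integrable std_gaussian (\<lambda>z :: real ^ 'd. u (z $ j))"
    using * gauss_density_nonneg unfolding std_gaussian_def has_bochner_integral_iff
    by (subst integrable_real_density) auto
  show "(\<integral>z. u (z $ j) \<partial>(std_gaussian :: (real ^ 'd) measure)) = (\<integral>x. std_normal_density x * u x \<partial>lborel)"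
    using * gauss_density_nonneg unfolding std_gaussian_def has_bochner_integral_iff
    by (subst integral_real_density) auto
qed

lemma prob_space_std_gaussian: "prob_space (std_gaussian :: (real ^ 'd::finite) measure)"
proof
  have "integrable (std_gaussian :: (real ^ 'd) measure) (\<lambda>z. 1::real)"
    "(\<integral>z. 1 \<partial>(std_gaussian :: (real ^ 'd) measure)) = (1::real)"
    using std_gaussian_component[of "\<lambda>_. 1" "undefined :: 'd"] by auto
  then have "(\<integral>\<^sup>+z. ennreal 1 \<partial>(std_gaussian :: (real ^ 'd) measure)) = ennreal 1"
    using nn_integral_eq_integral[of "std_gaussian :: (real ^ 'd) measure" "\<lambda>_. 1"] by simp
  then show "emeasure (std_gaussian :: (real ^ 'd) measure) (space std_gaussian) = 1"
    by simp
qed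

lemma std_gaussian_abs_component:
  fixes j :: "'d::finite"
  shows "integrable std_gaussian (\<lambda>z :: real ^ 'd. \<bar>z $ j\<bar>)"
    and "(\<integral>z. \<bar>z $ j\<bar> \<partial>(std_gaussian :: (real ^ 'd) measure)) = sqrt (2 / pi)"
  using std_gaussian_component[of "\<lambda>x. \<bar>x\<bar>" j] std_normal_moment_abs_odd[of 0]
  by (auto simp: has_bochner_integral_iff)

lemma std_gaussian_exp_abs_component:
  fixes j :: "'d::finite"
  shows "integrable std_gaussian (\<lambda>z :: real ^ 'd. exp (b * \<bar>z $ j\<bar>))"
proof (rule std_gaussian_component)
  \<comment> \<open>Completing the square: tilting the normal density exponentially gives a multiple
    of the density with mean \<open>c\<close>.\<close>
  have e: "std_normal_density x * exp (c * x) = exp (c\<^sup>2 / 2) * normal_density c 1 x" for c x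
    by (simp add: normal_density_def exp_add[symmetric] field_simps power2_eq_square)
  have i: "integrable lborel (\<lambda>x. std_normal_density x * exp (c * x))" for c
    unfolding e by (intro integrable_mult_right integrable_normal_density) simp
  have "std_normal_density x * exp (b * \<bar>x\<bar>)
      \<le> std_normal_density x * exp (b * x) + std_normal_density x * exp (- b * x)" for x
    by (cases "x \<ge> 0") (auto intro!: add_increasing add_increasing2)
  then show "integrable lborel (\<lambda>x. std_normal_density x * exp (b * \<bar>x\<bar>))"
    using i[of b] i[of "-b"]
    by (intro Bochner_Integration.integrable_bound[OF Bochner_Integration.integrable_add[OF i[of b] i[of "-b"]]]) auto
qed auto

text \<open>Translation invariance of Lebesgue measure moves the shift from \<open>p\<close> to the
  density, and the exponential is the ratio of the shifted density to the original one. The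
  dependence on \<open>a\<close> thereby becomes smooth for a merely measurable
  \<open>p\<close>.\<close>

lemma std_gaussian_cameron_martin:
  fixes p :: "real ^ 'd::finite \<Rightarrow> real"
  assumes [measurable]: "p \<in> borel_measurable borel"
  shows "(\<integral>z. p (z + a *\<^sub>R axis j 1) \<partial>std_gaussian)
      = (\<integral>z. p z * exp (a * z $ j - a\<^sup>2 / 2) \<partial>std_gaussian)"
proof -
  let ?\<phi> = "\<lambda>z :: real ^ 'd. \<Prod>i\<in>UNIV. std_normal_density (z $ i)"
  let ?e = "axis j 1 :: real ^ 'd"
  have \<phi>: "?\<phi> (z - a *\<^sub>R ?e) = ?\<phi> z * exp (a * z $ j - a\<^sup>2 / 2)" for z
  proof -
    have 1: "std_normal_density (z $ j - a) = std_normal_density (z $ j) * exp (a * z $ j - a\<^sup>2 / 2)"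
      by (simp add: std_normal_density_def exp_add[symmetric] field_simps power2_eq_square)
    show ?thesis
      by (subst (1 2) prod.remove[of UNIV j]) (auto simp: 1 axis_def)
  qed
  have "(\<integral>z. p (z + a *\<^sub>R ?e) \<partial>std_gaussian) = (\<integral>z. ?\<phi> z * p (z + a *\<^sub>R ?e) \<partial>lborel)"
    unfolding std_gaussian_def by (subst integral_real_density) (auto simp: gauss_density_nonneg)
  also have "\<dots> = (\<integral>z. ?\<phi> z * p (z + a *\<^sub>R ?e) \<partial>distr lborel borel ((+) (- a *\<^sub>R ?e)))"
    by (subst lborel_distr_plus) simp
  also have "\<dots> = (\<integral>z. ?\<phi> (z - a *\<^sub>R ?e) * p z \<partial>lborel)"
    by (subst integral_distr) auto
  also have "\<dots> = (\<integral>z. ?\<phi> z * (p z * exp (a * z $ j - a\<^sup>2 / 2)) \<partial>lborel)"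
    unfolding \<phi> by (simp add: mult_ac)
  also have "\<dots> = (\<integral>z. p z * exp (a * z $ j - a\<^sup>2 / 2) \<partial>std_gaussian)"
    unfolding std_gaussian_def by (subst integral_real_density) (auto simp: gauss_density_nonneg)
  finally show ?thesis .
qed

lemma integrable_std_gaussian_bounded:
  fixes p :: "real ^ 'd::finite \<Rightarrow> real"
  assumes "p \<in> borel_measurable borel" "\<And>z. \<bar>p z\<bar> \<le> C"
  shows "integrable std_gaussian p"
proof -
  interpret prob_space "std_gaussian :: (real ^ 'd) measure" by (rule prob_space_std_gaussian)
  show ?thesis
    using assms by (intro integrable_const_bound[of _ C]) auto
qed

text \<open>After the shift formula \<open>a\<close> occurs only in the exponential weight, so the
  derivative falls on the weight and never on \<open>p\<close>. This is what stands in for a third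
  derivative of \<open>h\<close>.\<close>

lemma std_gaussian_shift_derivative:
  fixes p :: "real ^ 'd::finite \<Rightarrow> real"
  assumes [measurable]: "p \<in> borel_measurable borel" and C: "\<And>z. \<bar>p z\<bar> \<le> C"
  shows "((\<lambda>a. \<integral>z. p (z + a *\<^sub>R axis j 1) \<partial>std_gaussian) has_real_derivative
           (\<integral>z. p (z + a *\<^sub>R axis j 1) * z $ j \<partial>std_gaussian)) (at a)"
proof -
  have C0: "0 \<le> C" using C[of 0] by linarith
  \<comment> \<open>\<open>b\<close> bounds all parameters within distance \<open>1\<close> of
    \<open>a\<close>, so the weights there have a common envelope that is exponential in
    \<open>\<bar>z $ j\<bar>\<close>.\<close>
  define b where "b = \<bar>a\<bar> + 1"
  have "((\<lambda>a. \<integral>z. p z * exp (a * z $ j - a\<^sup>2 / 2) \<partial>std_gaussian) has_real_derivative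
      (\<integral>z. p z * ((z $ j - a) * exp (a * z $ j - a\<^sup>2 / 2)) \<partial>std_gaussian)) (at a)"
  proof (rule has_real_derivative_lebesgue_integral[where r=1 and
        w="\<lambda>z. C * (exp b * exp ((1 + b) * \<bar>z $ j\<bar>))"])
    have ab: "\<bar>t\<bar> \<le> b" if "\<bar>t - a\<bar> < 1" for t using that by (auto simp: b_def)
    have exp_le: "exp (t * z $ j - t\<^sup>2 / 2) \<le> exp (b * \<bar>z $ j\<bar>)" if "\<bar>t - a\<bar> < 1" for t and z :: "real ^ 'd"
    proof -
      have "t * z $ j \<le> \<bar>t\<bar> * \<bar>z $ j\<bar>" by (metis abs_ge_self abs_mult)
      also have "\<dots> \<le> b * \<bar>z $ j\<bar>" using ab[OF that] by (intro mult_right_mono) auto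
      finally have "t * z $ j - t\<^sup>2 / 2 \<le> b * \<bar>z $ j\<bar>"
        using zero_le_power2[of t] by linarith
      then show ?thesis by simp
    qed
    show "integrable std_gaussian (\<lambda>z. C * (exp b * exp ((1 + b) * \<bar>z $ j\<bar>)))"
      by (intro integrable_mult_right std_gaussian_exp_abs_component)
    show "integrable std_gaussian (\<lambda>z. p z * exp (t * z $ j - t\<^sup>2 / 2))" if "\<bar>t - a\<bar> < 1" for t
    proof (rule Bochner_Integration.integrable_bound)
      show "integrable std_gaussian (\<lambda>z :: real ^ 'd. C * exp (b * \<bar>z $ j\<bar>))"
        by (intro integrable_mult_right std_gaussian_exp_abs_component)
      show "AE z in std_gaussian. norm (p z * exp (t * z $ j - t\<^sup>2 / 2)) \<le> norm (C * exp (b * \<bar>z $ j\<bar>))"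
        using exp_le[OF that] C C0 by (auto simp: abs_mult intro!: mult_mono)
    qed measurable
    show "((\<lambda>a. p z * exp (a * z $ j - a\<^sup>2 / 2)) has_real_derivative
         p z * ((z $ j - t) * exp (t * z $ j - t\<^sup>2 / 2))) (at t)" for t z
      by (auto intro!: derivative_eq_intros)
    show "\<bar>p z * ((z $ j - t) * exp (t * z $ j - t\<^sup>2 / 2))\<bar> \<le> C * (exp b * exp ((1 + b) * \<bar>z $ j\<bar>))"
      if t: "\<bar>t - a\<bar> < 1" for t z
    proof -
      have "\<bar>z $ j - t\<bar> \<le> \<bar>z $ j\<bar> + b" using ab[OF t] by linarith
      also have "\<dots> \<le> exp (\<bar>z $ j\<bar> + b)" using exp_ge_add_one_self[of "\<bar>z $ j\<bar> + b"] by linarith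
      finally have "\<bar>(z $ j - t) * exp (t * z $ j - t\<^sup>2 / 2)\<bar> \<le> exp (\<bar>z $ j\<bar> + b) * exp (b * \<bar>z $ j\<bar>)"
        using exp_le[OF t, of z] by (auto simp: abs_mult intro!: mult_mono)
      also have "\<dots> = exp b * exp ((1 + b) * \<bar>z $ j\<bar>)"
        by (simp add: exp_add[symmetric] algebra_simps)
      finally show ?thesis using C[of z] C0 by (subst abs_mult) (intro mult_mono, auto)
    qed
  qed auto
  \<comment> \<open>The factor \<open>z $ j - a\<close> refers to the shifted variable: undoing the
    shift turns it into \<open>z $ j\<close>.\<close>
  moreover have "(\<integral>z. p z * ((z $ j - a) * exp (a * z $ j - a\<^sup>2 / 2)) \<partial>std_gaussian)
      = (\<integral>z. p (z + a *\<^sub>R axis j 1) * z $ j \<partial>std_gaussian)"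
    using std_gaussian_cameron_martin[of "\<lambda>z. p z * (z $ j - a)" a j] by (simp add: mult.assoc axis_def)
  ultimately show ?thesis by (simp add: std_gaussian_cameron_martin)
qed

lemma std_gaussian_mult_component_bound:
  fixes p :: "real ^ 'd::finite \<Rightarrow> real"
  assumes [measurable]: "p \<in> borel_measurable borel" and C: "\<And>z. \<bar>p z\<bar> \<le> C"
  shows "integrable std_gaussian (\<lambda>z. p z * z $ j)"
    and "\<bar>\<integral>z. p z * z $ j \<partial>std_gaussian\<bar> \<le> C * sqrt (2 / pi)"
proof -
  have C0: "0 \<le> C" using C[of 0] by linarith
  have le: "\<bar>p z * z $ j\<bar> \<le> C * \<bar>z $ j\<bar>" for z
    using C by (simp add: abs_mult mult_right_mono)
  have i: "integrable std_gaussian (\<lambda>z :: real ^ 'd. C * \<bar>z $ j\<bar>)"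
    by (intro integrable_mult_right std_gaussian_abs_component)
  show "integrable std_gaussian (\<lambda>z. p z * z $ j)"
    using le C0 by (intro Bochner_Integration.integrable_bound[OF i]) (auto simp: abs_mult)
  have "\<bar>\<integral>z. p z * z $ j \<partial>std_gaussian\<bar> \<le> (\<integral>z. \<bar>p z * z $ j\<bar> \<partial>std_gaussian)"
    by (rule integral_abs_bound)
  also have "\<dots> \<le> (\<integral>z. C * \<bar>z $ j\<bar> \<partial>(std_gaussian :: (real ^ 'd) measure))"
    using le i \<open>integrable std_gaussian (\<lambda>z. p z * z $ j)\<close> by (intro integral_mono integrable_abs) auto
  finally have "\<bar>\<integral>z. p z * z $ j \<partial>std_gaussian\<bar> \<le> (\<integral>z. C * \<bar>z $ j\<bar> \<partial>(std_gaussian :: (real ^ 'd) measure))" .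
  then show "\<bar>\<integral>z. p z * z $ j \<partial>std_gaussian\<bar> \<le> C * sqrt (2 / pi)"
    by (simp add: std_gaussian_abs_component)
qed

lemma std_gaussian_shift_lipschitz_axis:
  fixes p :: "real ^ 'd::finite \<Rightarrow> real"
  assumes [measurable]: "p \<in> borel_measurable borel" and C: "\<And>z. \<bar>p z\<bar> \<le> C"
  shows "\<bar>(\<integral>z. p (z + a *\<^sub>R axis j 1) \<partial>std_gaussian) - (\<integral>z. p z \<partial>std_gaussian)\<bar>
      \<le> C * sqrt (2 / pi) * \<bar>a\<bar>"
proof -
  have "norm ((\<integral>z. p (z + a *\<^sub>R axis j 1) \<partial>std_gaussian) - (\<integral>z. p (z + 0 *\<^sub>R axis j 1) \<partial>std_gaussian))
      \<le> C * sqrt (2 / pi) * norm (a - 0)"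
  proof (rule field_differentiable_bound[where S=UNIV and
        f'="\<lambda>a. \<integral>z. p (z + a *\<^sub>R axis j 1) * z $ j \<partial>std_gaussian"])
    fix b :: real
    show "((\<lambda>a. \<integral>z. p (z + a *\<^sub>R axis j 1) \<partial>std_gaussian) has_field_derivative
           (\<integral>z. p (z + b *\<^sub>R axis j 1) * z $ j \<partial>std_gaussian)) (at b within UNIV)"
      using std_gaussian_shift_derivative[OF assms, of j b] by simp
    show "norm (\<integral>z. p (z + b *\<^sub>R axis j 1) * z $ j \<partial>std_gaussian) \<le> C * sqrt (2 / pi)"
      using std_gaussian_mult_component_bound(2)[of "\<lambda>z. p (z + b *\<^sub>R axis j 1)" C j] C by simp
  qed auto
  then show ?thesis by simp
qed

text \<open>The shift is carried out along one axis after the other, so the constant multiplies the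
  sum of the absolute coordinates. This is the source of the sum over \<open>l\<close> in the final
  bound.\<close>

lemma std_gaussian_shift_lipschitz:
  fixes p :: "real ^ 'd::finite \<Rightarrow> real"
  assumes [measurable]: "p \<in> borel_measurable borel" and C: "\<And>z. \<bar>p z\<bar> \<le> C"
  shows "\<bar>(\<integral>z. p (z + y) \<partial>std_gaussian) - (\<integral>z. p z \<partial>std_gaussian)\<bar>
      \<le> C * sqrt (2 / pi) * (\<Sum>l\<in>UNIV. \<bar>y $ l\<bar>)"
proof -
  have "\<bar>(\<integral>z. p (z + (\<Sum>l\<in>S. y $ l *\<^sub>R axis l 1)) \<partial>std_gaussian) - (\<integral>z. p z \<partial>std_gaussian)\<bar>
      \<le> C * sqrt (2 / pi) * (\<Sum>l\<in>S. \<bar>y $ l\<bar>)" if "finite S" for S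
    using that
  proof induction
    case (insert l S)
    let ?s = "\<Sum>l\<in>S. y $ l *\<^sub>R axis l (1::real) :: real ^ 'd"
    have "\<bar>(\<integral>z. p (z + y $ l *\<^sub>R axis l 1 + ?s) \<partial>std_gaussian) - (\<integral>z. p (z + ?s) \<partial>std_gaussian)\<bar>
        \<le> C * sqrt (2 / pi) * \<bar>y $ l\<bar>"
      using C by (intro std_gaussian_shift_lipschitz_axis[of "\<lambda>z. p (z + ?s)"]) auto
    then show ?case using insert by (simp add: algebra_simps)
  qed simp
  from this[of UNIV] show ?thesis
    using basis_expansion[of y] by (simp add: scalar_mult_eq_scaleR)
qed

text \<open>Both sides are the derivative at \<open>0\<close> of the
  expectation of \<open>p\<close> shifted along the axis.\<close>

lemma std_gaussian_integration_by_parts: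
  fixes p p' :: "real ^ 'd::finite \<Rightarrow> real"
  assumes [measurable]: "p \<in> borel_measurable borel" "p' \<in> borel_measurable borel"
    and C: "\<And>z. \<bar>p z\<bar> \<le> C" and C': "\<And>z. \<bar>p' z\<bar> \<le> C'"
    and der: "\<And>z t. ((\<lambda>t. p (z + t *\<^sub>R axis j 1)) has_real_derivative p' (z + t *\<^sub>R axis j 1)) (at t)"
  shows "(\<integral>z. p' z \<partial>std_gaussian) = (\<integral>z. p z * z $ j \<partial>std_gaussian)"
proof -
  interpret prob_space "std_gaussian :: (real ^ 'd) measure" by (rule prob_space_std_gaussian)
  have "((\<lambda>a. \<integral>z. p (z + a *\<^sub>R axis j 1) \<partial>std_gaussian) has_real_derivative
      (\<integral>z. p' (z + 0 *\<^sub>R axis j 1) \<partial>std_gaussian)) (at 0)"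
  proof (rule has_real_derivative_lebesgue_integral[where r=1 and w="\<lambda>_. C'" and
        f="\<lambda>a z. p (z + a *\<^sub>R axis j 1)" and f'="\<lambda>a z. p' (z + a *\<^sub>R axis j 1)"])
    show "integrable std_gaussian (\<lambda>z. p (z + t *\<^sub>R axis j 1))" for t
      using C by (intro integrable_std_gaussian_bounded[where C=C]) auto
  qed (use der C' in auto)
  moreover have "((\<lambda>a. \<integral>z. p (z + a *\<^sub>R axis j 1) \<partial>std_gaussian) has_real_derivative
      (\<integral>z. p (z + 0 *\<^sub>R axis j 1) * z $ j \<partial>std_gaussian)) (at 0)"
    using C by (intro std_gaussian_shift_derivative) auto
  ultimately show ?thesis using DERIV_unique by fastforce
qed

section \<open>Gaussian smoothing of smooth functions\<close>

lemma borel_measurable_vec_component [measurable (raw)]: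
  fixes f :: "'a \<Rightarrow> real ^ 'd::finite"
  assumes "f \<in> borel_measurable M"
  shows "(\<lambda>x. f x $ i) \<in> borel_measurable M"
  by (rule measurable_compose[OF assms borel_measurable_continuous_onI]) (intro continuous_intros)

lemma partial_deriv_has_derivative:
  fixes F :: "real ^ 'd::finite \<Rightarrow> real"
  assumes "(F has_derivative L) (at x)"
  shows "partial_deriv i F x = L (axis i 1)"
proof -
  have F: "(F has_derivative L) (at (x + 0 *\<^sub>R axis i 1))"
    using assms by simp
  have "((\<lambda>t. F (x + t *\<^sub>R axis i 1)) has_derivative (\<lambda>t. L (t *\<^sub>R axis i 1))) (at 0)"
    by (rule has_derivative_compose[where f="\<lambda>t. x + t *\<^sub>R axis i 1", OF _ F]) (auto intro!: derivative_eq_intros)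
  moreover have "L (t *\<^sub>R axis i 1) = L (axis i 1) * t" for t
    using linear_scale[OF has_derivative_linear[OF assms]] by (simp add: mult.commute)
  ultimately show ?thesis
    unfolding partial_deriv_def by (intro DERIV_imp_deriv) (simp add: has_field_derivative_def)
qed

lemma has_derivative_partial_deriv:
  fixes F :: "real ^ 'd::finite \<Rightarrow> real"
  assumes "F differentiable (at x)"
  shows "(F has_derivative (\<lambda>v. \<Sum>i\<in>UNIV. v $ i * partial_deriv i F x)) (at x)"
proof -
  obtain L where L: "(F has_derivative L) (at x)"
    using assms by (auto simp: differentiable_def)
  interpret L: linear L using L by (rule has_derivative_linear)
  have "L v = (\<Sum>i\<in>UNIV. v $ i * partial_deriv i F x)" for v
  proof -
    have "L v = L (\<Sum>i\<in>UNIV. v $ i *\<^sub>R axis i 1)"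
      using basis_expansion[of v] by (simp add: scalar_mult_eq_scaleR)
    also have "\<dots> = (\<Sum>i\<in>UNIV. v $ i * partial_deriv i F x)"
      by (simp add: L.sum L.scaleR partial_deriv_has_derivative[OF L])
    finally show ?thesis .
  qed
  then have "L = (\<lambda>v. \<Sum>i\<in>UNIV. v $ i * partial_deriv i F x)" by (rule ext)
  with L show ?thesis by simp
qed

lemma has_real_derivative_along_curve:
  fixes F :: "real ^ 'd::finite \<Rightarrow> real"
  assumes F: "F differentiable (at (\<gamma> t))" and \<gamma>: "(\<gamma> has_vector_derivative v) (at t)"
  shows "((\<lambda>s. F (\<gamma> s)) has_real_derivative (\<Sum>i\<in>UNIV. v $ i * partial_deriv i F (\<gamma> t))) (at t)"
proof -
  have "((\<lambda>s. F (\<gamma> s)) has_derivative (\<lambda>s. \<Sum>i\<in>UNIV. (s *\<^sub>R v) $ i * partial_deriv i F (\<gamma> t))) (at t)"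
    using has_derivative_compose[where f=\<gamma>, OF _ has_derivative_partial_deriv[OF F]] \<gamma>
    unfolding has_vector_derivative_def by blast
  then show ?thesis
    by (rule has_derivative_imp_has_field_derivative) (simp add: sum_distrib_left mult_ac)
qed

lemma has_real_derivative_along_line:
  fixes F :: "real ^ 'd::finite \<Rightarrow> real"
  assumes F: "F differentiable (at (x + t *\<^sub>R v))"
  shows "((\<lambda>s. F (x + s *\<^sub>R v)) has_real_derivative
           (\<Sum>i\<in>UNIV. v $ i * partial_deriv i F (x + t *\<^sub>R v))) (at t)"
  by (rule has_real_derivative_along_curve[where \<gamma>="\<lambda>s. x + s *\<^sub>R v", OF F])
    (auto simp: has_vector_derivative_def intro!: derivative_eq_intros)

lemma abs_le_sup_norm:
  assumes "bounded (range F)"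
  shows "\<bar>F x\<bar> \<le> sup_norm F"
proof -
  have "bdd_above (range (\<lambda>x. \<bar>F x\<bar>))"
    using assms by (force simp: bounded_iff bdd_above_def)
  then show ?thesis unfolding sup_norm_def by (intro cSUP_upper) auto
qed

context
  fixes h :: "real ^ 'd::finite \<Rightarrow> real"
  assumes h: "h \<in> Cb2"
begin

lemma Cb2_differentiable: "h differentiable (at x)"
  and Cb2_differentiable_partial: "partial_deriv i h differentiable (at x)"
  and Cb2_continuous_partial2: "continuous_on UNIV (partial_deriv i (partial_deriv j h))"
  using h by (auto simp: Cb2_def numeral_2_eq_2)

lemma Cb2_continuous: "continuous_on UNIV h"
  and Cb2_continuous_partial: "continuous_on UNIV (partial_deriv i h)"
  using Cb2_differentiable Cb2_differentiable_partial
  by (auto intro!: differentiable_imp_continuous_on simp: differentiable_on_def)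

lemma Cb2_measurable: "h \<in> borel_measurable borel"
  "partial_deriv i h \<in> borel_measurable borel"
  "partial_deriv i (partial_deriv j h) \<in> borel_measurable borel"
  using Cb2_continuous Cb2_continuous_partial Cb2_continuous_partial2
  by (auto intro: borel_measurable_continuous_onI)

lemma Cb2_bound: "\<bar>h x\<bar> \<le> sup_norm h"
  using h by (intro abs_le_sup_norm) (auto simp: Cb2_def)

lemma Cb2_bound1: "\<bar>partial_deriv i h x\<bar> \<le> seminorm1 h"
proof -
  have "\<bar>partial_deriv i h x\<bar> \<le> sup_norm (partial_deriv i h)"
    using h by (intro abs_le_sup_norm) (auto simp: Cb2_def)
  also have "\<dots> \<le> seminorm1 h"
    unfolding seminorm1_def by (intro cSUP_upper) auto
  finally show ?thesis .
qed

lemma Cb2_bound2: "\<bar>partial_deriv i (partial_deriv j h) x\<bar> \<le> seminorm2 h"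
proof -
  have "\<bar>partial_deriv i (partial_deriv j h) x\<bar> \<le> sup_norm (partial_deriv i (partial_deriv j h))"
    using h by (intro abs_le_sup_norm) (auto simp: Cb2_def)
  also have "\<dots> \<le> seminorm2 h"
    unfolding seminorm2_def
    using cSUP_upper[of "(i, j)" UNIV "\<lambda>(i, j). sup_norm (partial_deriv i (partial_deriv j h))"]
    by auto
  finally show ?thesis .
qed

lemma sup_norm_nonneg: "0 \<le> sup_norm h"
  and seminorm1_nonneg: "0 \<le> seminorm1 h"
  and seminorm2_nonneg: "0 \<le> seminorm2 h"
  using Cb2_bound[of 0] Cb2_bound1[of undefined 0] Cb2_bound2[of undefined undefined 0] by linarith+

lemma Cb2_lipschitz: "\<bar>h x - h y\<bar> \<le> seminorm1 h * (\<Sum>j\<in>UNIV. \<bar>x $ j - y $ j\<bar>)"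
proof -
  have "norm (h (y + 1 *\<^sub>R (x - y)) - h (y + 0 *\<^sub>R (x - y)))
      \<le> (seminorm1 h * (\<Sum>j\<in>UNIV. \<bar>x $ j - y $ j\<bar>)) * norm (1 - 0 :: real)"
  proof (rule field_differentiable_bound[where S=UNIV and
        f="\<lambda>t. h (y + t *\<^sub>R (x - y))" and
        f'="\<lambda>t. \<Sum>i\<in>UNIV. (x - y) $ i * partial_deriv i h (y + t *\<^sub>R (x - y))"])
    fix t :: real
    show "((\<lambda>t. h (y + t *\<^sub>R (x - y))) has_field_derivative
        (\<Sum>i\<in>UNIV. (x - y) $ i * partial_deriv i h (y + t *\<^sub>R (x - y)))) (at t within UNIV)"
      by (rule has_real_derivative_along_line[OF Cb2_differentiable])
    have "norm (\<Sum>i\<in>UNIV. (x - y) $ i * partial_deriv i h (y + t *\<^sub>R (x - y)))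
        \<le> (\<Sum>i\<in>UNIV. seminorm1 h * \<bar>x $ i - y $ i\<bar>)"
    proof (rule sum_norm_le)
      fix i :: 'd
      have "\<bar>x $ i - y $ i\<bar> * \<bar>partial_deriv i h (y + t *\<^sub>R (x - y))\<bar> \<le> \<bar>x $ i - y $ i\<bar> * seminorm1 h"
        by (intro mult_left_mono Cb2_bound1) auto
      then show "norm ((x - y) $ i * partial_deriv i h (y + t *\<^sub>R (x - y))) \<le> seminorm1 h * \<bar>x $ i - y $ i\<bar>"
        by (simp add: abs_mult mult.commute)
    qed
    then show "norm (\<Sum>i\<in>UNIV. (x - y) $ i * partial_deriv i h (y + t *\<^sub>R (x - y)))
        \<le> seminorm1 h * (\<Sum>j\<in>UNIV. \<bar>x $ j - y $ j\<bar>)"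
      by (simp add: sum_distrib_left)
  qed auto
  then show ?thesis by simp
qed

text \<open>Along each line such a function is affine, and bounded.\<close>

lemma Cb2_seminorm2_eq_0_imp_constant:
  assumes "seminorm2 h = 0"
  shows "h x = h y"
proof -
  have zero: "partial_deriv i (partial_deriv j h) z = 0" for i j z
    using Cb2_bound2[of i j z] assms by simp
  have const: "partial_deriv j h z = partial_deriv j h y" for j z
  proof -
    have "partial_deriv j h (y + 1 *\<^sub>R (z - y)) = partial_deriv j h (y + 0 *\<^sub>R (z - y))"
    proof (rule DERIV_isconst_all[where f="\<lambda>t. partial_deriv j h (y + t *\<^sub>R (z - y))"], rule allI)
      fix t :: real
      show "((\<lambda>t. partial_deriv j h (y + t *\<^sub>R (z - y))) has_real_derivative 0) (at t)"
        using has_real_derivative_along_line[OF Cb2_differentiable_partial[of j "y + t *\<^sub>R (z - y)"]]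
        by (simp add: zero)
    qed
    then show ?thesis by simp
  qed
  define c where "c = (\<Sum>i\<in>UNIV. (x - y) $ i * partial_deriv i h y)"
  have const_diff: "h (y + t *\<^sub>R (x - y)) - c * t = h (y + 0 *\<^sub>R (x - y)) - c * 0" for t
  proof (rule DERIV_isconst_all[where f="\<lambda>t. h (y + t *\<^sub>R (x - y)) - c * t"], rule allI)
    fix t :: real
    have "((\<lambda>t. h (y + t *\<^sub>R (x - y))) has_field_derivative c) (at t)"
      unfolding c_def
      using has_real_derivative_along_line[OF Cb2_differentiable[of "y + t *\<^sub>R (x - y)"]]
        const[of _ "y + t *\<^sub>R (x - y)"] by simp
    then show "((\<lambda>t. h (y + t *\<^sub>R (x - y)) - c * t) has_field_derivative 0) (at t)"
      by (auto intro!: derivative_eq_intros)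
  qed
  have affine: "h (y + t *\<^sub>R (x - y)) = h y + c * t" for t
    using const_diff[of t] by simp
  have "c = 0"
  proof (rule ccontr)
    assume "c \<noteq> 0"
    \<comment> \<open>At this \<open>t\<close> the affine function has moved by
      \<open>2 * sup_norm h + 1\<close>, more than a function with values bounded by
      \<open>sup_norm h\<close> can.\<close>
    define t where "t = (2 * sup_norm h + 1) / c"
    have "c * t = 2 * sup_norm h + 1" using \<open>c \<noteq> 0\<close> by (simp add: t_def)
    then show False
      using affine[of t] Cb2_bound[of y] Cb2_bound[of "y + t *\<^sub>R (x - y)"] by linarith
  qed
  then show ?thesis using affine[of 1] by simp
qed

end

text \<open>For \<open>c = cos t\<close> and \<open>s = sin t\<close>, the only values used in the
  end, this is Mehler's formula for the Ornstein-Uhlenbeck semigroup.\<close>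

definition gauss_smooth :: "real \<Rightarrow> real \<Rightarrow> (real ^ 'd::finite \<Rightarrow> real) \<Rightarrow> real ^ 'd \<Rightarrow> real" where
  "gauss_smooth c s p w = (\<integral>z. p (c *\<^sub>R w + s *\<^sub>R z) \<partial>std_gaussian)"

lemma gauss_smooth_measurable [measurable]:
  fixes p :: "real ^ 'd::finite \<Rightarrow> real"
  assumes [measurable]: "p \<in> borel_measurable borel"
  shows "gauss_smooth c s p \<in> borel_measurable borel"
proof -
  interpret prob_space "std_gaussian :: (real ^ 'd) measure" by (rule prob_space_std_gaussian)
  show ?thesis unfolding gauss_smooth_def[abs_def]
    by (rule borel_measurable_lebesgue_integral) measurable
qed

lemma gauss_smooth_bound:
  fixes p :: "real ^ 'd::finite \<Rightarrow> real"
  assumes [measurable]: "p \<in> borel_measurable borel" and C: "\<And>z. \<bar>p z\<bar> \<le> C"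
  shows "\<bar>gauss_smooth c s p w\<bar> \<le> C"
proof -
  interpret prob_space "std_gaussian :: (real ^ 'd) measure" by (rule prob_space_std_gaussian)
  have i: "integrable std_gaussian (\<lambda>z. p (c *\<^sub>R w + s *\<^sub>R z))"
    using C by (intro integrable_std_gaussian_bounded) auto
  have "\<bar>gauss_smooth c s p w\<bar> \<le> (\<integral>z. \<bar>p (c *\<^sub>R w + s *\<^sub>R z)\<bar> \<partial>std_gaussian)"
    unfolding gauss_smooth_def by (rule integral_abs_bound)
  also have "\<dots> \<le> (\<integral>z. C \<partial>(std_gaussian :: (real ^ 'd) measure))"
    using C integrable_abs[OF i] by (intro integral_mono) simp_all
  finally show ?thesis using prob_space by simp
qed

text \<open>Moving \<open>w\<close> by \<open>y\<close> has the same effect as moving the Gaussian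
  variable by \<open>(c / s) *\<^sub>R y\<close>, and shifts of a Gaussian integral are Lipschitz
  for any bounded \<open>p\<close>. Applied to second derivatives of \<open>h\<close>, this needs no
  third one.\<close>

lemma gauss_smooth_lipschitz:
  fixes p :: "real ^ 'd::finite \<Rightarrow> real"
  assumes [measurable]: "p \<in> borel_measurable borel" and C: "\<And>z. \<bar>p z\<bar> \<le> C" and "0 \<le> c" "0 < s"
  shows "\<bar>gauss_smooth c s p (w + y) - gauss_smooth c s p w\<bar>
      \<le> C * sqrt (2 / pi) * (c / s) * (\<Sum>l\<in>UNIV. \<bar>y $ l\<bar>)"
proof -
  have "\<bar>(\<integral>z. p (c *\<^sub>R w + s *\<^sub>R (z + (c / s) *\<^sub>R y)) \<partial>std_gaussian)
      - (\<integral>z. p (c *\<^sub>R w + s *\<^sub>R z) \<partial>std_gaussian)\<bar>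
      \<le> C * sqrt (2 / pi) * (\<Sum>l\<in>UNIV. \<bar>((c / s) *\<^sub>R y) $ l\<bar>)"
    using C by (intro std_gaussian_shift_lipschitz[of "\<lambda>z. p (c *\<^sub>R w + s *\<^sub>R z)"]) auto
  moreover have "c *\<^sub>R w + s *\<^sub>R (z + (c / s) *\<^sub>R y) = c *\<^sub>R (w + y) + s *\<^sub>R z" for z
    using \<open>0 < s\<close> by (simp add: scaleR_right_distrib)
  moreover have "(\<Sum>l\<in>UNIV. \<bar>((c / s) *\<^sub>R y) $ l\<bar>) = (c / s) * (\<Sum>l\<in>UNIV. \<bar>y $ l\<bar>)"
    using assms(3,4) by (simp add: abs_mult sum_distrib_left)
  ultimately show ?thesis by (simp add: gauss_smooth_def mult.assoc)
qed

lemma gauss_smooth_derivative_along_line: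
  fixes p :: "real ^ 'd::finite \<Rightarrow> real"
  assumes [measurable]: "p \<in> borel_measurable borel" "\<And>k. partial_deriv k p \<in> borel_measurable borel"
    and B: "\<And>z. \<bar>p z\<bar> \<le> B" and C: "\<And>k z. \<bar>partial_deriv k p z\<bar> \<le> C"
    and diff: "\<And>z. p differentiable (at z)"
  shows "((\<lambda>t. gauss_smooth c s p (w + t *\<^sub>R y)) has_real_derivative
           c * (\<Sum>k\<in>UNIV. y $ k * gauss_smooth c s (partial_deriv k p) (w + t *\<^sub>R y))) (at t)"
proof -
  interpret prob_space "std_gaussian :: (real ^ 'd) measure" by (rule prob_space_std_gaussian)
  have C0: "0 \<le> C" using C[of undefined 0] by linarith
  have "((\<lambda>t. \<integral>z. p (c *\<^sub>R (w + t *\<^sub>R y) + s *\<^sub>R z) \<partial>std_gaussian) has_real_derivative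
      (\<integral>z. (\<Sum>k\<in>UNIV. (c *\<^sub>R y) $ k * partial_deriv k p (c *\<^sub>R (w + t *\<^sub>R y) + s *\<^sub>R z)) \<partial>std_gaussian)) (at t)"
  proof (rule has_real_derivative_lebesgue_integral[where r=1 and
        w="\<lambda>_. \<Sum>k\<in>UNIV. \<bar>(c *\<^sub>R y) $ k\<bar> * C"])
    show "integrable std_gaussian (\<lambda>z. p (c *\<^sub>R (w + t *\<^sub>R y) + s *\<^sub>R z))" for t
      using B by (intro integrable_std_gaussian_bounded) auto
    show "((\<lambda>t. p (c *\<^sub>R (w + t *\<^sub>R y) + s *\<^sub>R z)) has_real_derivative
        (\<Sum>k\<in>UNIV. (c *\<^sub>R y) $ k * partial_deriv k p (c *\<^sub>R (w + t *\<^sub>R y) + s *\<^sub>R z))) (at t)" for t z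
      by (rule has_real_derivative_along_curve[OF diff])
        (auto simp: has_vector_derivative_def intro!: derivative_eq_intros)
    show "\<bar>\<Sum>k\<in>UNIV. (c *\<^sub>R y) $ k * partial_deriv k p (c *\<^sub>R (w + t *\<^sub>R y) + s *\<^sub>R z)\<bar>
        \<le> (\<Sum>k\<in>UNIV. \<bar>(c *\<^sub>R y) $ k\<bar> * C)" for t z
      using C C0 by (intro order_trans[OF sum_abs] sum_mono) (simp add: abs_mult mult_left_mono)
  qed auto
  moreover have "(\<integral>z. (\<Sum>k\<in>UNIV. (c *\<^sub>R y) $ k * partial_deriv k p (c *\<^sub>R (w + t *\<^sub>R y) + s *\<^sub>R z)) \<partial>std_gaussian)
      = c * (\<Sum>k\<in>UNIV. y $ k * gauss_smooth c s (partial_deriv k p) (w + t *\<^sub>R y))"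
  proof -
    have "integrable std_gaussian (\<lambda>z. partial_deriv k p (c *\<^sub>R (w + t *\<^sub>R y) + s *\<^sub>R z))" for k
      using C by (intro integrable_std_gaussian_bounded) auto
    then show ?thesis
      by (subst Bochner_Integration.integral_sum) (auto simp: gauss_smooth_def sum_distrib_left mult.assoc)
  qed
  ultimately show ?thesis by (simp add: gauss_smooth_def)
qed

text \<open>The bound on the increments of \<open>\<psi>'\<close> makes
  \<open>\<psi> t - t * \<psi>' 0 + B * t\<^sup>2 / 2\<close> nondecreasing and, with the opposite
  sign of \<open>B\<close>, nonincreasing. No second derivative of \<open>\<psi>\<close>
  enters.\<close>

lemma taylor_remainder_lipschitz_derivative:
  fixes \<psi> \<psi>' :: "real \<Rightarrow> real"
  assumes der: "\<And>t. 0 \<le> t \<Longrightarrow> t \<le> 1 \<Longrightarrow> (\<psi> has_real_derivative \<psi>' t) (at t)"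
    and B: "\<And>t. 0 \<le> t \<Longrightarrow> t \<le> 1 \<Longrightarrow> \<bar>\<psi>' t - \<psi>' 0\<bar> \<le> B * t"
  shows "\<bar>\<psi> 1 - \<psi> 0 - \<psi>' 0\<bar> \<le> B / 2"
proof -
  have "\<psi> 0 - 0 * \<psi>' 0 + B * 0\<^sup>2 / 2 \<le> \<psi> 1 - 1 * \<psi>' 0 + B * 1\<^sup>2 / 2"
  proof (rule DERIV_nonneg_imp_nondecreasing[where f="\<lambda>t. \<psi> t - t * \<psi>' 0 + B * t\<^sup>2 / 2"])
    fix t :: real assume t: "0 \<le> t" "t \<le> 1"
    have "((\<lambda>t. \<psi> t - t * \<psi>' 0 + B * t\<^sup>2 / 2) has_real_derivative \<psi>' t - \<psi>' 0 + B * t) (at t)"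
      by (auto intro!: derivative_eq_intros der t)
    then show "\<exists>y. ((\<lambda>t. \<psi> t - t * \<psi>' 0 + B * t\<^sup>2 / 2) has_real_derivative y) (at t) \<and> y \<ge> 0"
      using B[OF t] by (intro exI conjI) auto
  qed auto
  moreover have "- (\<psi> 0 - 0 * \<psi>' 0 - B * 0\<^sup>2 / 2) \<le> - (\<psi> 1 - 1 * \<psi>' 0 - B * 1\<^sup>2 / 2)"
  proof (rule DERIV_nonneg_imp_nondecreasing[where f="\<lambda>t. - (\<psi> t - t * \<psi>' 0 - B * t\<^sup>2 / 2)"])
    fix t :: real assume t: "0 \<le> t" "t \<le> 1"
    have "((\<lambda>t. - (\<psi> t - t * \<psi>' 0 - B * t\<^sup>2 / 2)) has_real_derivative - (\<psi>' t - \<psi>' 0 - B * t)) (at t)"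
      by (auto intro!: derivative_eq_intros der t)
    then show "\<exists>y. ((\<lambda>t. - (\<psi> t - t * \<psi>' 0 - B * t\<^sup>2 / 2)) has_real_derivative y) (at t) \<and> y \<ge> 0"
      using B[OF t] by (intro exI conjI) auto
  qed auto
  ultimately have "\<psi> 0 \<le> \<psi> 1 - \<psi>' 0 + B / 2" "- \<psi> 0 \<le> B / 2 - (\<psi> 1 - \<psi>' 0)"
    by simp_all
  then show ?thesis by linarith
qed

text \<open>A quadratic remainder from a single derivative of \<open>p\<close>: the first
  \<open>c\<close> comes from the chain rule, the factor \<open>c / s\<close> from the Lipschitz
  bound for the smoothed derivative.\<close>

lemma gauss_smooth_taylor:
  fixes p :: "real ^ 'd::finite \<Rightarrow> real"
  assumes [measurable]: "p \<in> borel_measurable borel" "\<And>k. partial_deriv k p \<in> borel_measurable borel"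
    and B: "\<And>z. \<bar>p z\<bar> \<le> B" and C: "\<And>k z. \<bar>partial_deriv k p z\<bar> \<le> C"
    and diff: "\<And>z. p differentiable (at z)" and c: "0 \<le> c" and s: "0 < s"
  shows "\<bar>gauss_smooth c s p (w + y) - gauss_smooth c s p w
      - c * (\<Sum>k\<in>UNIV. y $ k * gauss_smooth c s (partial_deriv k p) w)\<bar>
      \<le> (C * sqrt (2 / pi) * (c\<^sup>2 / s)) / 2 * (\<Sum>k\<in>UNIV. \<Sum>l\<in>UNIV. \<bar>y $ k\<bar> * \<bar>y $ l\<bar>)"
proof -
  define \<psi>' where "\<psi>' t = c * (\<Sum>k\<in>UNIV. y $ k * gauss_smooth c s (partial_deriv k p) (w + t *\<^sub>R y))" for t
  define A where "A = C * sqrt (2 / pi) * (c\<^sup>2 / s) * (\<Sum>k\<in>UNIV. \<Sum>l\<in>UNIV. \<bar>y $ k\<bar> * \<bar>y $ l\<bar>)"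
  have "\<bar>gauss_smooth c s p (w + 1 *\<^sub>R y) - gauss_smooth c s p (w + 0 *\<^sub>R y) - \<psi>' 0\<bar> \<le> A / 2"
  proof (rule taylor_remainder_lipschitz_derivative)
    show "((\<lambda>t. gauss_smooth c s p (w + t *\<^sub>R y)) has_real_derivative \<psi>' t) (at t)" for t
      unfolding \<psi>'_def using assms by (intro gauss_smooth_derivative_along_line) auto
    fix t :: real assume t: "0 \<le> t"
    have diff_eq: "\<psi>' t - \<psi>' 0 = c * (\<Sum>k\<in>UNIV. y $ k * (gauss_smooth c s (partial_deriv k p) (w + t *\<^sub>R y)
        - gauss_smooth c s (partial_deriv k p) w))"
      by (simp add: \<psi>'_def right_diff_distrib sum_subtractf)
    have "\<bar>\<psi>' t - \<psi>' 0\<bar> \<le> c * (\<Sum>k\<in>UNIV. \<bar>y $ k\<bar> * (C * sqrt (2 / pi) * (c / s) * (\<Sum>l\<in>UNIV. \<bar>(t *\<^sub>R y) $ l\<bar>)))"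
      unfolding diff_eq abs_mult abs_of_nonneg[OF c]
    proof (intro mult_left_mono[OF _ c] order_trans[OF sum_abs] sum_mono)
      fix k
      show "\<bar>y $ k * (gauss_smooth c s (partial_deriv k p) (w + t *\<^sub>R y) - gauss_smooth c s (partial_deriv k p) w)\<bar>
          \<le> \<bar>y $ k\<bar> * (C * sqrt (2 / pi) * (c / s) * (\<Sum>l\<in>UNIV. \<bar>(t *\<^sub>R y) $ l\<bar>))"
        unfolding abs_mult
        by (rule mult_left_mono[OF gauss_smooth_lipschitz[OF assms(2) C c s]]) simp
    qed
    also have "\<dots> = A * t"
    proof -
      define S where "S = (\<Sum>l\<in>UNIV. \<bar>y $ l\<bar>)"
      have 1: "(\<Sum>l\<in>UNIV. \<bar>(t *\<^sub>R y) $ l\<bar>) = t * S"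
        using t by (simp add: abs_mult sum_distrib_left S_def)
      have 2: "(\<Sum>k\<in>UNIV. \<bar>y $ k\<bar> * b) = S * b" for b
        by (simp add: S_def sum_distrib_right)
      have 3: "A = C * sqrt (2 / pi) * (c\<^sup>2 / s) * (S * S)"
        by (simp add: A_def S_def sum_product)
      show ?thesis unfolding 1 2 3 by (simp add: power2_eq_square)
    qed
    finally show "\<bar>\<psi>' t - \<psi>' 0\<bar> \<le> A * t" .
  qed
  then show ?thesis by (simp add: \<psi>'_def A_def)
qed

section \<open>Normal approximation of sums of independent vectors\<close>

text \<open>Bounding each factor by the largest of the three is crude, but the estimate only serves
  to deduce integrability of mixed products from the third absolute moments of the
  components.\<close>

lemma abs_mult3_le: "\<bar>x * y * z\<bar> \<le> \<bar>x\<bar> ^ 3 + \<bar>y\<bar> ^ 3 + \<bar>z\<bar> ^ 3" for x y z :: real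
proof -
  define m where "m = max \<bar>x\<bar> (max \<bar>y\<bar> \<bar>z\<bar>)"
  have "\<bar>x\<bar> \<le> m" "\<bar>y\<bar> \<le> m" "\<bar>z\<bar> \<le> m" "0 \<le> m" by (auto simp: m_def)
  then have "\<bar>x * y * z\<bar> \<le> m ^ 3"
    unfolding abs_mult power3_eq_cube by (intro mult_mono) auto
  also have "\<dots> \<le> \<bar>x\<bar> ^ 3 + \<bar>y\<bar> ^ 3 + \<bar>z\<bar> ^ 3"
  proof -
    have "0 \<le> \<bar>x\<bar> ^ 3" "0 \<le> \<bar>y\<bar> ^ 3" "0 \<le> \<bar>z\<bar> ^ 3" by auto
    moreover have "m = \<bar>x\<bar> \<or> m = \<bar>y\<bar> \<or> m = \<bar>z\<bar>" by (auto simp: m_def max_def)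
    ultimately show ?thesis by (elim disjE) simp_all
  qed
  finally show ?thesis .
qed

lemma (in prob_space) integrable_mult3_of_cubes:
  fixes X Y Z :: "'a \<Rightarrow> real"
  assumes [measurable]: "X \<in> borel_measurable M" "Y \<in> borel_measurable M" "Z \<in> borel_measurable M"
    and "integrable M (\<lambda>\<omega>. \<bar>X \<omega>\<bar> ^ 3)" "integrable M (\<lambda>\<omega>. \<bar>Y \<omega>\<bar> ^ 3)" "integrable M (\<lambda>\<omega>. \<bar>Z \<omega>\<bar> ^ 3)"
  shows "integrable M (\<lambda>\<omega>. X \<omega> * Y \<omega> * Z \<omega>)"
proof (rule Bochner_Integration.integrable_bound)
  show "integrable M (\<lambda>\<omega>. \<bar>X \<omega>\<bar> ^ 3 + \<bar>Y \<omega>\<bar> ^ 3 + \<bar>Z \<omega>\<bar> ^ 3)"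
    using assms by auto
  show "AE \<omega> in M. norm (X \<omega> * Y \<omega> * Z \<omega>) \<le> norm (\<bar>X \<omega>\<bar> ^ 3 + \<bar>Y \<omega>\<bar> ^ 3 + \<bar>Z \<omega>\<bar> ^ 3)"
    using abs_mult3_le by (intro AE_I2) (simp add: abs_mult)
qed auto

lemma (in prob_space) integrable_mult2_of_cubes:
  fixes X Y :: "'a \<Rightarrow> real"
  assumes "X \<in> borel_measurable M" "Y \<in> borel_measurable M"
    and "integrable M (\<lambda>\<omega>. \<bar>X \<omega>\<bar> ^ 3)" "integrable M (\<lambda>\<omega>. \<bar>Y \<omega>\<bar> ^ 3)"
  shows "integrable M (\<lambda>\<omega>. X \<omega> * Y \<omega>)"
  using integrable_mult3_of_cubes[of X Y "\<lambda>_. 1"] assms by simp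

lemma (in prob_space) integrable_of_cube:
  fixes X :: "'a \<Rightarrow> real"
  assumes "X \<in> borel_measurable M" "integrable M (\<lambda>\<omega>. \<bar>X \<omega>\<bar> ^ 3)"
  shows "integrable M X"
  using integrable_mult3_of_cubes[of X "\<lambda>_. 1" "\<lambda>_. 1"] assms by simp

lemma (in prob_space) indep_var_sum_vec:
  fixes Y :: "'i \<Rightarrow> 'a \<Rightarrow> real ^ 'd::finite"
  assumes I: "finite I" "i \<notin> I" and indep: "indep_vars (\<lambda>_. borel) Y (insert i I)"
  shows "indep_var borel (Y i) borel (\<lambda>\<omega>. \<Sum>i\<in>I. Y i \<omega>)"
proof -
  have "indep_var
    borel ((\<lambda>f. f i) \<circ> (\<lambda>\<omega>. restrict (\<lambda>i. Y i \<omega>) {i}))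
    borel ((\<lambda>f. \<Sum>i\<in>I. f i) \<circ> (\<lambda>\<omega>. restrict (\<lambda>i. Y i \<omega>) I))"
    using I by (intro indep_var_compose[OF indep_var_restrict[OF indep]] ) auto
  also have "((\<lambda>f. f i) \<circ> (\<lambda>\<omega>. restrict (\<lambda>i. Y i \<omega>) {i})) = Y i"
    by auto
  also have "((\<lambda>f. \<Sum>i\<in>I. f i) \<circ> (\<lambda>\<omega>. restrict (\<lambda>i. Y i \<omega>) I)) = (\<lambda>\<omega>. \<Sum>i\<in>I. Y i \<omega>)"
    by (auto cong: rev_conj_cong)
  finally show ?thesis .
qed

text \<open>The covariances are normalized in their sum, which is the form in which the
  leave-one-out expansion meets them. Third moments are finite here; the infinite case is settled
  where the locale is applied.\<close>

locale clt_setup = prob_space M for M :: "'w measure" +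
  fixes Y :: "nat \<Rightarrow> 'w \<Rightarrow> real ^ 'd::finite" and n :: nat and h :: "real ^ 'd \<Rightarrow> real"
  assumes indep: "indep_vars (\<lambda>_. borel) Y {..<n}" and n: "n \<ge> 1"
    and cubes: "\<And>i j. i < n \<Longrightarrow> integrable M (\<lambda>\<omega>. \<bar>Y i \<omega> $ j\<bar> ^ 3)"
    and mean: "\<And>i j. i < n \<Longrightarrow> expectation (\<lambda>\<omega>. Y i \<omega> $ j) = 0"
    and cov: "\<And>j k. (\<Sum>i<n. expectation (\<lambda>\<omega>. Y i \<omega> $ j * Y i \<omega> $ k)) = (if j = k then real n else 0)"
    and h: "h \<in> Cb2"
begin

definition a :: real where "a = 1 / sqrt (real n)"

definition W :: "'w \<Rightarrow> real ^ 'd" where "W \<omega> = a *\<^sub>R (\<Sum>i<n. Y i \<omega>)"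

definition third_moments :: real where
  "third_moments = (\<Sum>i<n. \<Sum>j\<in>UNIV. \<Sum>k\<in>UNIV. \<Sum>l\<in>UNIV.
     expectation (\<lambda>\<omega>. \<bar>Y i \<omega> $ j * Y i \<omega> $ k * Y i \<omega> $ l\<bar>)
     + 2 * \<bar>expectation (\<lambda>\<omega>. Y i \<omega> $ j * Y i \<omega> $ k)\<bar> * expectation (\<lambda>\<omega>. \<bar>Y i \<omega> $ l\<bar>))"

lemma a_pos: "a > 0" and a_sq: "a\<^sup>2 * real n = 1"
  using n by (auto simp: a_def power_divide)

lemma Y_meas [measurable]: "i < n \<Longrightarrow> Y i \<in> borel_measurable M"
  using indep by (auto simp: indep_vars_def)

lemma Y_int [simp]:
  assumes "i < n"
  shows "integrable M (\<lambda>\<omega>. Y i \<omega> $ j)" "integrable M (\<lambda>\<omega>. Y i \<omega> $ j * Y i \<omega> $ k)"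
    "integrable M (\<lambda>\<omega>. Y i \<omega> $ j * Y i \<omega> $ k * Y i \<omega> $ l)"
proof -
  note [measurable] = Y_meas[OF assms]
  show "integrable M (\<lambda>\<omega>. Y i \<omega> $ j)"
    by (rule integrable_of_cube[OF _ cubes[OF assms]]) measurable
  show "integrable M (\<lambda>\<omega>. Y i \<omega> $ j * Y i \<omega> $ k)"
    by (rule integrable_mult2_of_cubes[OF _ _ cubes[OF assms] cubes[OF assms]]) measurable
  show "integrable M (\<lambda>\<omega>. Y i \<omega> $ j * Y i \<omega> $ k * Y i \<omega> $ l)"
    by (rule integrable_mult3_of_cubes[OF _ _ _ cubes[OF assms] cubes[OF assms] cubes[OF assms]]) measurable
qed

lemma W_meas [measurable]: "W \<in> borel_measurable M"
  unfolding W_def[abs_def] by measurable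

lemma W_int: "integrable M (\<lambda>\<omega>. W \<omega> $ j)"
proof -
  have "integrable M (\<lambda>\<omega>. a * (\<Sum>i<n. Y i \<omega> $ j))"
    by (intro integrable_mult_right Bochner_Integration.integrable_sum) simp
  then show ?thesis by (simp add: W_def)
qed

text \<open>Omitting the \<open>i\<close>-th summand, with the scale \<open>a\<close> unchanged,
  gives a vector independent of \<open>Y i\<close> at distance of order \<open>a\<close> from
  \<open>W\<close>.\<close>

definition W' :: "nat \<Rightarrow> 'w \<Rightarrow> real ^ 'd" where "W' i \<omega> = a *\<^sub>R (\<Sum>i'\<in>{..<n} - {i}. Y i' \<omega>)"

lemma W'_meas [measurable]: "W' i \<in> borel_measurable M"
  unfolding W'_def[abs_def] by measurable

lemma W_split: "i < n \<Longrightarrow> W \<omega> = W' i \<omega> + a *\<^sub>R Y i \<omega>"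
  unfolding W_def W'_def
  by (subst sum.remove[of "{..<n}" i]) (auto simp: scaleR_right_distrib)

lemma integral_indep_W':
  fixes u p :: "real ^ 'd \<Rightarrow> real"
  assumes i: "i < n" and [measurable]: "u \<in> borel_measurable borel" "p \<in> borel_measurable borel"
    and int: "integrable M (\<lambda>\<omega>. u (Y i \<omega>))" and p: "\<And>w. \<bar>p w\<bar> \<le> C"
  shows "expectation (\<lambda>\<omega>. u (Y i \<omega>) * p (W' i \<omega>))
      = expectation (\<lambda>\<omega>. u (Y i \<omega>)) * expectation (\<lambda>\<omega>. p (W' i \<omega>))"
proof (rule indep_var_lebesgue_integral)
  have "insert i ({..<n} - {i}) = {..<n}" using i by auto
  then have "indep_var borel (Y i) borel (\<lambda>\<omega>. \<Sum>i'\<in>{..<n} - {i}. Y i' \<omega>)"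
    using indep by (intro indep_var_sum_vec) auto
  then have "indep_var borel (u \<circ> Y i) borel ((\<lambda>s. p (a *\<^sub>R s)) \<circ> (\<lambda>\<omega>. \<Sum>i'\<in>{..<n} - {i}. Y i' \<omega>))"
    by (rule indep_var_compose) measurable
  then show "indep_var borel (\<lambda>\<omega>. u (Y i \<omega>)) borel (\<lambda>\<omega>. p (W' i \<omega>))"
    by (simp add: comp_def W'_def)
  show "integrable M (\<lambda>\<omega>. p (W' i \<omega>))"
    using p by (intro integrable_const_bound[of _ C]) auto
qed (rule int)

text \<open>For a standard Gaussian \<open>W\<close> the two sums agree, by integration by parts. In
  general each \<open>P j (W \<omega>)\<close> is expanded around \<open>W' i \<omega>\<close>: the
  zeroth-order term vanishes by independence and centering, and the first-order term gives
  covariances times expectations of \<open>G j k\<close> at \<open>W' i\<close>. Once these are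
  moved to \<open>W\<close>, the normalization of the covariances cancels them against the second
  sum.\<close>

lemma stein_discrepancy_bound:
  assumes c: "0 \<le> c" and s: "0 < s"
  defines "P \<equiv> \<lambda>j. gauss_smooth c s (partial_deriv j h)"
    and "G \<equiv> \<lambda>j k. gauss_smooth c s (partial_deriv k (partial_deriv j h))"
  shows "\<bar>(\<Sum>j\<in>UNIV. expectation (\<lambda>\<omega>. W \<omega> $ j * P j (W \<omega>)))
      - c * (\<Sum>j\<in>UNIV. expectation (\<lambda>\<omega>. G j j (W \<omega>)))\<bar>
    \<le> seminorm2 h * sqrt (2 / pi) * (c\<^sup>2 / s) * (a ^ 3 / 2) * third_moments"
proof -
  define C where "C = seminorm2 h * sqrt (2 / pi)"
  have C0: "0 \<le> C" using seminorm2_nonneg[OF h] by (simp add: C_def)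
  note [measurable] = Cb2_measurable[OF h]
  have P_meas [measurable]: "P j \<in> borel_measurable borel" for j unfolding P_def by measurable
  have G_meas [measurable]: "G j k \<in> borel_measurable borel" for j k unfolding G_def by measurable
  have P_bd: "\<bar>P j w\<bar> \<le> seminorm1 h" for j w
    unfolding P_def by (intro gauss_smooth_bound Cb2_bound1[OF h]) measurable
  have G_bd: "\<bar>G j k w\<bar> \<le> seminorm2 h" for j k w
    unfolding G_def by (intro gauss_smooth_bound Cb2_bound2[OF h]) measurable
  have G_int: "integrable M (\<lambda>\<omega>. G j k (V \<omega>))" if [measurable]: "V \<in> borel_measurable M" for j k V
    using G_bd by (intro integrable_const_bound[of _ "seminorm2 h"]) auto
  have YP_int: "integrable M (\<lambda>\<omega>. Y i \<omega> $ j * P j (V \<omega>))"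
    if i: "i < n" and [measurable]: "V \<in> borel_measurable M" for i j V
  proof (rule Bochner_Integration.integrable_bound)
    show "integrable M (\<lambda>\<omega>. Y i \<omega> $ j * seminorm1 h)" using i by simp
    show "AE \<omega> in M. norm (Y i \<omega> $ j * P j (V \<omega>)) \<le> norm (Y i \<omega> $ j * seminorm1 h)"
      using order_trans[OF P_bd abs_ge_self] by (auto simp: abs_mult intro!: mult_left_mono)
    show "(\<lambda>\<omega>. Y i \<omega> $ j * P j (V \<omega>)) \<in> borel_measurable M" using i by measurable
  qed
  have YYG_int: "integrable M (\<lambda>\<omega>. Y i \<omega> $ j * Y i \<omega> $ k * G j k (V \<omega>))"
    if i: "i < n" and [measurable]: "V \<in> borel_measurable M" for i j k V
  proof (rule Bochner_Integration.integrable_bound)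
    show "integrable M (\<lambda>\<omega>. Y i \<omega> $ j * Y i \<omega> $ k * seminorm2 h)" using i by simp
    show "AE \<omega> in M. norm (Y i \<omega> $ j * Y i \<omega> $ k * G j k (V \<omega>)) \<le> norm (Y i \<omega> $ j * Y i \<omega> $ k * seminorm2 h)"
      using order_trans[OF G_bd abs_ge_self] by (auto simp: abs_mult intro!: mult_left_mono)
    show "(\<lambda>\<omega>. Y i \<omega> $ j * Y i \<omega> $ k * G j k (V \<omega>)) \<in> borel_measurable M" using i by measurable
  qed
  \<comment> \<open>The remainder of the first-order expansion is quadratic in
    \<open>Y i \<omega>\<close>; multiplied by \<open>Y i \<omega> $ j\<close> it turns into the
    third moments of the bound.\<close>
  define rem where "rem i j \<omega> = P j (W \<omega>) - P j (W' i \<omega>) - c * (\<Sum>k\<in>UNIV. (a *\<^sub>R Y i \<omega>) $ k * G j k (W' i \<omega>))"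
    for i j \<omega>
  have rem_bd: "\<bar>rem i j \<omega>\<bar> \<le> (C * (c\<^sup>2 / s)) / 2 * (a\<^sup>2 * (\<Sum>k\<in>UNIV. \<Sum>l\<in>UNIV. \<bar>Y i \<omega> $ k\<bar> * \<bar>Y i \<omega> $ l\<bar>))"
    if "i < n" for i j \<omega>
  proof -
    have "\<bar>rem i j \<omega>\<bar> \<le> (seminorm2 h * sqrt (2 / pi) * (c\<^sup>2 / s)) / 2
        * (\<Sum>k\<in>UNIV. \<Sum>l\<in>UNIV. \<bar>(a *\<^sub>R Y i \<omega>) $ k\<bar> * \<bar>(a *\<^sub>R Y i \<omega>) $ l\<bar>)"
      unfolding rem_def P_def G_def W_split[OF that]
      by (intro gauss_smooth_taylor[where B="seminorm1 h"] Cb2_bound1[OF h] Cb2_bound2[OF h] c s Cb2_differentiable_partial[OF h])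
        measurable
    also have "(\<Sum>k\<in>UNIV. \<Sum>l\<in>UNIV. \<bar>(a *\<^sub>R Y i \<omega>) $ k\<bar> * \<bar>(a *\<^sub>R Y i \<omega>) $ l\<bar>)
        = a\<^sup>2 * (\<Sum>k\<in>UNIV. \<Sum>l\<in>UNIV. \<bar>Y i \<omega> $ k\<bar> * \<bar>Y i \<omega> $ l\<bar>)"
      using a_pos by (simp add: abs_mult sum_distrib_left power2_eq_square mult_ac)
    finally show ?thesis by (simp add: C_def)
  qed
  have expand: "expectation (\<lambda>\<omega>. Y i \<omega> $ j * P j (W \<omega>))
      = expectation (\<lambda>\<omega>. Y i \<omega> $ j * rem i j \<omega>)
        + c * a * (\<Sum>k\<in>UNIV. expectation (\<lambda>\<omega>. Y i \<omega> $ j * Y i \<omega> $ k) * expectation (\<lambda>\<omega>. G j k (W' i \<omega>)))"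
    and rem_int: "integrable M (\<lambda>\<omega>. Y i \<omega> $ j * rem i j \<omega>)" if i: "i < n" for i j
  proof -
    have eq: "Y i \<omega> $ j * rem i j \<omega> = Y i \<omega> $ j * P j (W \<omega>) - Y i \<omega> $ j * P j (W' i \<omega>)
        - c * a * (\<Sum>k\<in>UNIV. Y i \<omega> $ j * Y i \<omega> $ k * G j k (W' i \<omega>))" for \<omega>
      unfolding rem_def by (simp add: right_diff_distrib sum_distrib_left mult_ac)
    have i1: "integrable M (\<lambda>\<omega>. Y i \<omega> $ j * P j (W \<omega>))" "integrable M (\<lambda>\<omega>. Y i \<omega> $ j * P j (W' i \<omega>))"
      using i by (auto intro!: YP_int)
    have i2: "integrable M (\<lambda>\<omega>. Y i \<omega> $ j * Y i \<omega> $ k * G j k (W' i \<omega>))" for k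
      using i by (auto intro!: YYG_int)
    show "integrable M (\<lambda>\<omega>. Y i \<omega> $ j * rem i j \<omega>)"
      unfolding eq using i1 i2 by simp
    have "expectation (\<lambda>\<omega>. Y i \<omega> $ j * P j (W' i \<omega>)) = expectation (\<lambda>\<omega>. Y i \<omega> $ j) * expectation (\<lambda>\<omega>. P j (W' i \<omega>))"
      using integral_indep_W'[of i "\<lambda>y. y $ j" "P j" "seminorm1 h"] i P_bd by simp
    moreover have "expectation (\<lambda>\<omega>. Y i \<omega> $ j * Y i \<omega> $ k * G j k (W' i \<omega>))
        = expectation (\<lambda>\<omega>. Y i \<omega> $ j * Y i \<omega> $ k) * expectation (\<lambda>\<omega>. G j k (W' i \<omega>))" for k
      using integral_indep_W'[of i "\<lambda>y. y $ j * y $ k" "G j k" "seminorm2 h"] i G_bd by simp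
    ultimately show "expectation (\<lambda>\<omega>. Y i \<omega> $ j * P j (W \<omega>))
      = expectation (\<lambda>\<omega>. Y i \<omega> $ j * rem i j \<omega>)
        + c * a * (\<Sum>k\<in>UNIV. expectation (\<lambda>\<omega>. Y i \<omega> $ j * Y i \<omega> $ k) * expectation (\<lambda>\<omega>. G j k (W' i \<omega>)))"
      unfolding eq using i1 i2 mean[OF i] by (simp add: Bochner_Integration.integral_sum)
  qed
  define R1 where "R1 i j = expectation (\<lambda>\<omega>. Y i \<omega> $ j * rem i j \<omega>)" for i j
  define e2 where "e2 i j k = expectation (\<lambda>\<omega>. Y i \<omega> $ j * Y i \<omega> $ k)" for i j k
  \<comment> \<open>The cost of passing from \<open>W' i\<close> to \<open>W\<close> inside
    \<open>G j k\<close>. It is of first order in \<open>Y i\<close>, hence the products of second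
    and first moments.\<close>
  define D where "D i j k = expectation (\<lambda>\<omega>. G j k (W' i \<omega>)) - expectation (\<lambda>\<omega>. G j k (W \<omega>))" for i j k
  have lhs: "(\<Sum>j\<in>UNIV. expectation (\<lambda>\<omega>. W \<omega> $ j * P j (W \<omega>)))
      - c * (\<Sum>j\<in>UNIV. expectation (\<lambda>\<omega>. G j j (W \<omega>)))
      = (\<Sum>i<n. \<Sum>j\<in>UNIV. a * R1 i j + c * a\<^sup>2 * (\<Sum>k\<in>UNIV. e2 i j k * D i j k))"
  proof -
    have "expectation (\<lambda>\<omega>. W \<omega> $ j * P j (W \<omega>)) = (\<Sum>i<n. a * expectation (\<lambda>\<omega>. Y i \<omega> $ j * P j (W \<omega>)))" for j
    proof -
      have "W \<omega> $ j * P j (W \<omega>) = (\<Sum>i<n. a * (Y i \<omega> $ j * P j (W \<omega>)))" for \<omega>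
        by (subst (1) W_def) (simp add: sum_distrib_left sum_distrib_right mult_ac)
      then show ?thesis using YP_int[of _ W j] by (simp add: Bochner_Integration.integral_sum)
    qed
    then have 1: "(\<Sum>j\<in>UNIV. expectation (\<lambda>\<omega>. W \<omega> $ j * P j (W \<omega>)))
        = (\<Sum>i<n. \<Sum>j\<in>UNIV. a * R1 i j + c * a\<^sup>2 * (\<Sum>k\<in>UNIV. e2 i j k * expectation (\<lambda>\<omega>. G j k (W' i \<omega>))))"
      by (subst sum.swap) (simp add: expand R1_def e2_def distrib_left power2_eq_square mult_ac)
    have "expectation (\<lambda>\<omega>. G j j (W \<omega>)) = (\<Sum>i<n. a\<^sup>2 * (\<Sum>k\<in>UNIV. e2 i j k * expectation (\<lambda>\<omega>. G j k (W \<omega>))))" for j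
    proof -
      have "(\<Sum>i<n. a\<^sup>2 * (\<Sum>k\<in>UNIV. e2 i j k * expectation (\<lambda>\<omega>. G j k (W \<omega>))))
          = (\<Sum>k\<in>UNIV. a\<^sup>2 * ((\<Sum>i<n. e2 i j k) * expectation (\<lambda>\<omega>. G j k (W \<omega>))))"
        unfolding sum_distrib_left sum_distrib_right by (rule sum.swap)
      \<comment> \<open>Summed over \<open>i\<close>, the second moments are \<open>real n\<close>
        on the diagonal and \<open>0\<close> off it, and \<open>a\<^sup>2\<close> removes the
        \<open>real n\<close>.\<close>
      also have "\<dots> = (\<Sum>k\<in>UNIV. if j = k then expectation (\<lambda>\<omega>. G j k (W \<omega>)) else 0)"
        using a_sq cov[of j] by (intro sum.cong) (auto simp: e2_def mult.assoc[symmetric])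
      finally show ?thesis by simp
    qed
    then have 2: "(\<Sum>j\<in>UNIV. expectation (\<lambda>\<omega>. G j j (W \<omega>)))
        = (\<Sum>i<n. \<Sum>j\<in>UNIV. a\<^sup>2 * (\<Sum>k\<in>UNIV. e2 i j k * expectation (\<lambda>\<omega>. G j k (W \<omega>))))"
      by (subst sum.swap) simp
    show ?thesis unfolding 1 2 D_def
      by (simp add: sum_distrib_left sum_subtractf sum.distrib right_diff_distrib mult.assoc)
  qed
  define m3 where "m3 i j k l = expectation (\<lambda>\<omega>. \<bar>Y i \<omega> $ j * Y i \<omega> $ k * Y i \<omega> $ l\<bar>)" for i j k l
  define m1 where "m1 i l = expectation (\<lambda>\<omega>. \<bar>Y i \<omega> $ l\<bar>)" for i l
  define B where "B = C * (c\<^sup>2 / s)"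
  have B0: "0 \<le> B" using C0 s by (simp add: B_def)
  have R1_bd: "\<bar>R1 i j\<bar> \<le> B / 2 * a\<^sup>2 * (\<Sum>k\<in>UNIV. \<Sum>l\<in>UNIV. m3 i j k l)" if i: "i < n" for i j
  proof -
    have "\<bar>R1 i j\<bar> \<le> expectation (\<lambda>\<omega>. \<bar>Y i \<omega> $ j * rem i j \<omega>\<bar>)"
      unfolding R1_def by (rule integral_abs_bound)
    also have "\<dots> \<le> expectation (\<lambda>\<omega>. B / 2 * a\<^sup>2 * (\<Sum>k\<in>UNIV. \<Sum>l\<in>UNIV. \<bar>Y i \<omega> $ j * Y i \<omega> $ k * Y i \<omega> $ l\<bar>))"
    proof (rule integral_mono)
      show "integrable M (\<lambda>\<omega>. \<bar>Y i \<omega> $ j * rem i j \<omega>\<bar>)" using rem_int[OF i] by (rule integrable_abs)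
      show "integrable M (\<lambda>\<omega>. B / 2 * a\<^sup>2 * (\<Sum>k\<in>UNIV. \<Sum>l\<in>UNIV. \<bar>Y i \<omega> $ j * Y i \<omega> $ k * Y i \<omega> $ l\<bar>))"
        using i by (intro integrable_mult_right Bochner_Integration.integrable_sum integrable_abs) simp
      fix \<omega>
      have "\<bar>Y i \<omega> $ j * rem i j \<omega>\<bar> \<le> \<bar>Y i \<omega> $ j\<bar> * ((C * (c\<^sup>2 / s)) / 2 * (a\<^sup>2 * (\<Sum>k\<in>UNIV. \<Sum>l\<in>UNIV. \<bar>Y i \<omega> $ k\<bar> * \<bar>Y i \<omega> $ l\<bar>)))"
        unfolding abs_mult using rem_bd[OF i] by (intro mult_left_mono) auto
      then show "\<bar>Y i \<omega> $ j * rem i j \<omega>\<bar> \<le> B / 2 * a\<^sup>2 * (\<Sum>k\<in>UNIV. \<Sum>l\<in>UNIV. \<bar>Y i \<omega> $ j * Y i \<omega> $ k * Y i \<omega> $ l\<bar>)"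
        by (simp add: B_def abs_mult sum_distrib_left mult_ac)
    qed
    also have "\<dots> = B / 2 * a\<^sup>2 * (\<Sum>k\<in>UNIV. \<Sum>l\<in>UNIV. m3 i j k l)"
      using i by (simp add: m3_def Bochner_Integration.integral_sum)
    finally show ?thesis .
  qed
  have D_bd: "c * \<bar>D i j k\<bar> \<le> B * a * (\<Sum>l\<in>UNIV. m1 i l)" if i: "i < n" for i j k
  proof -
    have "\<bar>D i j k\<bar> = \<bar>expectation (\<lambda>\<omega>. G j k (W' i \<omega>) - G j k (W \<omega>))\<bar>"
      unfolding D_def using G_int by simp
    also have "\<dots> \<le> expectation (\<lambda>\<omega>. \<bar>G j k (W' i \<omega>) - G j k (W \<omega>)\<bar>)"
      by (rule integral_abs_bound)
    also have "\<dots> \<le> expectation (\<lambda>\<omega>. C * (c / s) * a * (\<Sum>l\<in>UNIV. \<bar>Y i \<omega> $ l\<bar>))"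
    proof (rule integral_mono)
      show "integrable M (\<lambda>\<omega>. \<bar>G j k (W' i \<omega>) - G j k (W \<omega>)\<bar>)"
        using G_int by (intro integrable_abs) auto
      show "integrable M (\<lambda>\<omega>. C * (c / s) * a * (\<Sum>l\<in>UNIV. \<bar>Y i \<omega> $ l\<bar>))"
        using i by (intro integrable_mult_right Bochner_Integration.integrable_sum integrable_abs) simp
      fix \<omega>
      have "\<bar>G j k (W \<omega>) - G j k (W' i \<omega>)\<bar> \<le> C * (c / s) * (\<Sum>l\<in>UNIV. \<bar>(a *\<^sub>R Y i \<omega>) $ l\<bar>)"
        unfolding G_def W_split[OF i] C_def
        by (intro gauss_smooth_lipschitz Cb2_bound2[OF h] c s) measurable
      then show "\<bar>G j k (W' i \<omega>) - G j k (W \<omega>)\<bar> \<le> C * (c / s) * a * (\<Sum>l\<in>UNIV. \<bar>Y i \<omega> $ l\<bar>)"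
        using a_pos by (simp add: abs_mult sum_distrib_left abs_minus_commute mult.assoc)
    qed
    also have "\<dots> = C * (c / s) * a * (\<Sum>l\<in>UNIV. m1 i l)"
      using i by (simp add: m1_def Bochner_Integration.integral_sum)
    finally have "c * \<bar>D i j k\<bar> \<le> c * (C * (c / s) * a * (\<Sum>l\<in>UNIV. m1 i l))"
      using c by (rule mult_left_mono)
    then show ?thesis by (simp add: B_def power2_eq_square mult_ac)
  qed
  \<comment> \<open>The part with \<open>R1\<close> carries the factor \<open>1 / 2\<close> of the
    Taylor estimate, the part with \<open>D\<close> does not; taking out \<open>a ^ 3 / 2\<close>
    leaves the weight \<open>2\<close> on the latter.\<close>
  have "\<bar>\<Sum>i<n. \<Sum>j\<in>UNIV. a * R1 i j + c * a\<^sup>2 * (\<Sum>k\<in>UNIV. e2 i j k * D i j k)\<bar>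
      \<le> (\<Sum>i<n. \<Sum>j\<in>UNIV. B * a ^ 3 / 2 * (\<Sum>k\<in>UNIV. \<Sum>l\<in>UNIV. m3 i j k l + 2 * \<bar>e2 i j k\<bar> * m1 i l))"
  proof (intro order_trans[OF sum_abs] sum_mono)
    fix i j assume "i \<in> {..<n}"
    then have i: "i < n" by simp
    have "\<bar>a * R1 i j\<bar> \<le> a * (B / 2 * a\<^sup>2 * (\<Sum>k\<in>UNIV. \<Sum>l\<in>UNIV. m3 i j k l))"
      using a_pos R1_bd[OF i, of j] by (simp add: abs_mult)
    moreover have "\<bar>c * a\<^sup>2 * (\<Sum>k\<in>UNIV. e2 i j k * D i j k)\<bar>
        \<le> a\<^sup>2 * (\<Sum>k\<in>UNIV. \<bar>e2 i j k\<bar> * (B * a * (\<Sum>l\<in>UNIV. m1 i l)))"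
    proof -
      have "\<bar>c * a\<^sup>2 * (\<Sum>k\<in>UNIV. e2 i j k * D i j k)\<bar> = a\<^sup>2 * (c * \<bar>\<Sum>k\<in>UNIV. e2 i j k * D i j k\<bar>)"
        using c by (simp add: abs_mult)
      also have "\<dots> \<le> a\<^sup>2 * (c * (\<Sum>k\<in>UNIV. \<bar>e2 i j k * D i j k\<bar>))"
        using c by (intro mult_left_mono sum_abs) auto
      also have "\<dots> = a\<^sup>2 * (\<Sum>k\<in>UNIV. \<bar>e2 i j k\<bar> * (c * \<bar>D i j k\<bar>))"
        by (simp add: sum_distrib_left abs_mult mult_ac)
      also have "\<dots> \<le> a\<^sup>2 * (\<Sum>k\<in>UNIV. \<bar>e2 i j k\<bar> * (B * a * (\<Sum>l\<in>UNIV. m1 i l)))"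
        using D_bd[OF i] by (intro mult_left_mono sum_mono) auto
      finally show ?thesis .
    qed
    ultimately have "\<bar>a * R1 i j + c * a\<^sup>2 * (\<Sum>k\<in>UNIV. e2 i j k * D i j k)\<bar>
        \<le> a * (B / 2 * a\<^sup>2 * (\<Sum>k\<in>UNIV. \<Sum>l\<in>UNIV. m3 i j k l))
          + a\<^sup>2 * (\<Sum>k\<in>UNIV. \<bar>e2 i j k\<bar> * (B * a * (\<Sum>l\<in>UNIV. m1 i l)))"
      by (intro order_trans[OF abs_triangle_ineq] add_mono)
    also have "\<dots> = B * a ^ 3 / 2 * (\<Sum>k\<in>UNIV. \<Sum>l\<in>UNIV. m3 i j k l + 2 * \<bar>e2 i j k\<bar> * m1 i l)"
      by (simp add: sum.distrib distrib_left sum_distrib_left power2_eq_square power3_eq_cube mult_ac)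
    finally show "\<bar>a * R1 i j + c * a\<^sup>2 * (\<Sum>k\<in>UNIV. e2 i j k * D i j k)\<bar>
        \<le> B * a ^ 3 / 2 * (\<Sum>k\<in>UNIV. \<Sum>l\<in>UNIV. m3 i j k l + 2 * \<bar>e2 i j k\<bar> * m1 i l)" .
  qed
  also have "\<dots> = B * (a ^ 3 / 2) * third_moments"
    unfolding third_moments_def m3_def e2_def m1_def by (simp add: sum_distrib_left)
  finally show ?thesis unfolding lhs by (simp add: B_def C_def)
qed

section \<open>Interpolation between the sum and an independent Gaussian vector\<close>

lemma integrable_pair_fst:
  fixes f :: "'w \<Rightarrow> real"
  assumes "integrable M f" "prob_space N"
  shows "integrable (M \<Otimes>\<^sub>M N) (\<lambda>x. f (fst x))"
    and "(\<integral>x. f (fst x) \<partial>(M \<Otimes>\<^sub>M N)) = expectation f"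
proof -
  interpret N: prob_space N by fact
  have "distr (M \<Otimes>\<^sub>M N) M fst = M" by (rule N.distr_pair_fst)
  then show "integrable (M \<Otimes>\<^sub>M N) (\<lambda>x. f (fst x))" "(\<integral>x. f (fst x) \<partial>(M \<Otimes>\<^sub>M N)) = expectation f"
    using assms(1) integrable_distr_eq[of fst "M \<Otimes>\<^sub>M N" M f] integral_distr[of fst "M \<Otimes>\<^sub>M N" M f]
    by auto
qed

lemma integrable_pair_snd:
  fixes f :: "'b \<Rightarrow> real"
  assumes f: "integrable N f" and N: "prob_space N"
  shows "integrable (M \<Otimes>\<^sub>M N) (\<lambda>x. f (snd x))"
    and "(\<integral>x. f (snd x) \<partial>(M \<Otimes>\<^sub>M N)) = (\<integral>z. f z \<partial>N)"
proof -
  interpret N: prob_space N by fact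
  interpret pair_sigma_finite M N ..
  have [measurable]: "f \<in> borel_measurable N" using f by simp
  have i: "integrable (N \<Otimes>\<^sub>M M) (\<lambda>x. f (fst x))" "(\<integral>x. f (fst x) \<partial>(N \<Otimes>\<^sub>M M)) = (\<integral>z. f z \<partial>N)"
  proof -
    have "distr (N \<Otimes>\<^sub>M M) N fst = N" by (rule distr_pair_fst)
    then show "integrable (N \<Otimes>\<^sub>M M) (\<lambda>x. f (fst x))" "(\<integral>x. f (fst x) \<partial>(N \<Otimes>\<^sub>M M)) = (\<integral>z. f z \<partial>N)"
      using f integrable_distr_eq[of fst "N \<Otimes>\<^sub>M M" N f] integral_distr[of fst "N \<Otimes>\<^sub>M M" N f]
      by auto
  qed
  show "integrable (M \<Otimes>\<^sub>M N) (\<lambda>x. f (snd x))"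
    using i(1) integrable_product_swap_iff[of "\<lambda>x. f (snd x)"] by (simp add: case_prod_unfold)
  show "(\<integral>x. f (snd x) \<partial>(M \<Otimes>\<^sub>M N)) = (\<integral>z. f z \<partial>N)"
    using i(2) integral_product_swap[of "\<lambda>x. f (snd x)"] by (simp add: case_prod_unfold)
qed

text \<open>Only the law of the Gaussian vector matters, so the product space may supply a copy
  independent of \<open>W\<close>. The path runs from \<open>W\<close> at \<open>0\<close> to the
  Gaussian at \<open>pi / 2\<close>.\<close>

definition interp :: "real \<Rightarrow> real" where
  "interp t = (\<integral>x. h (cos t *\<^sub>R W (fst x) + sin t *\<^sub>R snd x) \<partial>(M \<Otimes>\<^sub>M std_gaussian))"

lemma gauss_smooth_by_parts:
  "(\<integral>z. partial_deriv j h (c *\<^sub>R w + s *\<^sub>R z) * z $ j \<partial>std_gaussian)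
    = s * gauss_smooth c s (partial_deriv j (partial_deriv j h)) w"
proof -
  note [measurable] = Cb2_measurable[OF h]
  have "(\<integral>z. s * partial_deriv j (partial_deriv j h) (c *\<^sub>R w + s *\<^sub>R z) \<partial>std_gaussian)
      = (\<integral>z. partial_deriv j h (c *\<^sub>R w + s *\<^sub>R z) * z $ j \<partial>std_gaussian)"
  proof (rule std_gaussian_integration_by_parts[where C="seminorm1 h" and C'="\<bar>s\<bar> * seminorm2 h"])
    show "\<bar>partial_deriv j h (c *\<^sub>R w + s *\<^sub>R z)\<bar> \<le> seminorm1 h" for z by (rule Cb2_bound1[OF h])
    show "\<bar>s * partial_deriv j (partial_deriv j h) (c *\<^sub>R w + s *\<^sub>R z)\<bar> \<le> \<bar>s\<bar> * seminorm2 h" for z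
      unfolding abs_mult by (intro mult_left_mono Cb2_bound2[OF h]) auto
    fix z t
    let ?\<gamma> = "\<lambda>t. c *\<^sub>R w + s *\<^sub>R (z + t *\<^sub>R axis j 1)"
    have "((\<lambda>t. partial_deriv j h (?\<gamma> t)) has_real_derivative
        (\<Sum>i\<in>UNIV. (s *\<^sub>R axis j 1) $ i * partial_deriv i (partial_deriv j h) (?\<gamma> t))) (at t)"
      by (rule has_real_derivative_along_curve[where \<gamma>="?\<gamma>", OF Cb2_differentiable_partial[OF h]])
        (auto simp: has_vector_derivative_def intro!: derivative_eq_intros)
    moreover have "(\<Sum>i\<in>UNIV. (s *\<^sub>R axis j 1) $ i * partial_deriv i (partial_deriv j h) (?\<gamma> t))
        = s * partial_deriv j (partial_deriv j h) (?\<gamma> t)"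
      by (subst sum.remove[of UNIV j]) (auto simp: axis_def)
    ultimately show "((\<lambda>t. partial_deriv j h (?\<gamma> t)) has_real_derivative
        s * partial_deriv j (partial_deriv j h) (?\<gamma> t)) (at t)" by simp
  qed measurable
  then show ?thesis by (simp add: gauss_smooth_def)
qed

text \<open>The velocity of the path is \<open>- sin t *\<^sub>R W + cos t *\<^sub>R Z\<close>.
  Integration by parts in the Gaussian variable brings a factor \<open>sin t\<close> into the second
  part, so \<open>sin t\<close> can be taken out of the whole and what remains is the discrepancy
  estimated above.\<close>

lemma interp_derivative:
  "(interp has_real_derivative
     - sin t * ((\<Sum>j\<in>UNIV. expectation (\<lambda>\<omega>. W \<omega> $ j * gauss_smooth (cos t) (sin t) (partial_deriv j h) (W \<omega>)))
       - cos t * (\<Sum>j\<in>UNIV. expectation (\<lambda>\<omega>.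
           gauss_smooth (cos t) (sin t) (partial_deriv j (partial_deriv j h)) (W \<omega>))))) (at t)"
proof -
  note [measurable] = Cb2_measurable[OF h]
  interpret N: prob_space "std_gaussian :: (real ^ 'd) measure" by (rule prob_space_std_gaussian)
  interpret pair_sigma_finite M "std_gaussian :: (real ^ 'd) measure" ..
  interpret PP: pair_prob_space M "std_gaussian :: (real ^ 'd) measure" ..
  let ?V = "\<lambda>t x. cos t *\<^sub>R W (fst x) + sin t *\<^sub>R snd x"
  define f' where "f' t x = (\<Sum>j\<in>UNIV. (- sin t * W (fst x) $ j + cos t * snd x $ j) * partial_deriv j h (?V t x))" for t x
  define w where "w x = (\<Sum>j\<in>UNIV. (\<bar>W (fst x) $ j\<bar> + \<bar>snd x $ j\<bar>) * seminorm1 h)"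
    for x :: "'w \<times> (real ^ 'd)"
  have w: "integrable (M \<Otimes>\<^sub>M std_gaussian) w"
    unfolding w_def[abs_def]
    by (intro Bochner_Integration.integrable_sum integrable_mult_left Bochner_Integration.integrable_add
        integrable_abs integrable_pair_fst integrable_pair_snd W_int N.prob_space_axioms std_gaussian_abs_component)
  have f'_meas [measurable]: "f' t \<in> borel_measurable (M \<Otimes>\<^sub>M std_gaussian)" for t
    unfolding f'_def[abs_def] by measurable
  have bd: "\<bar>f' t x\<bar> \<le> w x" for t x
    unfolding f'_def w_def
  proof (intro order_trans[OF sum_abs] sum_mono)
    fix j
    have "\<bar>- sin t * W (fst x) $ j + cos t * snd x $ j\<bar> \<le> \<bar>sin t\<bar> * \<bar>W (fst x) $ j\<bar> + \<bar>cos t\<bar> * \<bar>snd x $ j\<bar>"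
      by (rule order_trans[OF abs_triangle_ineq]) (simp add: abs_mult)
    also have "\<dots> \<le> \<bar>W (fst x) $ j\<bar> + \<bar>snd x $ j\<bar>"
      by (intro add_mono mult_left_le_one_le) auto
    finally show "\<bar>(- sin t * W (fst x) $ j + cos t * snd x $ j) * partial_deriv j h (?V t x)\<bar>
        \<le> (\<bar>W (fst x) $ j\<bar> + \<bar>snd x $ j\<bar>) * seminorm1 h"
      unfolding abs_mult by (intro mult_mono Cb2_bound1[OF h]) auto
  qed
  have f'_int: "integrable (M \<Otimes>\<^sub>M std_gaussian) (f' t)" for t
    using bd order_trans[OF bd abs_ge_self] by (intro Bochner_Integration.integrable_bound[OF w]) auto
  have "(interp has_real_derivative (\<integral>x. f' t x \<partial>(M \<Otimes>\<^sub>M std_gaussian))) (at t)"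
    unfolding interp_def[abs_def]
  proof (rule has_real_derivative_lebesgue_integral[where r=1 and w=w])
    show "integrable (M \<Otimes>\<^sub>M std_gaussian) (\<lambda>x. h (?V t x))" for t
      using Cb2_bound[OF h] by (intro PP.integrable_const_bound[of _ "sup_norm h"]) auto
    show "((\<lambda>t. h (?V t x)) has_real_derivative f' t x) (at t)" for t x
    proof -
      have "((\<lambda>t. h (?V t x)) has_real_derivative
          (\<Sum>j\<in>UNIV. (- sin t *\<^sub>R W (fst x) + cos t *\<^sub>R snd x) $ j * partial_deriv j h (?V t x))) (at t)"
      proof (rule has_real_derivative_along_curve[where \<gamma>="\<lambda>t. ?V t x", OF Cb2_differentiable[OF h]])
        show "((\<lambda>t. ?V t x) has_vector_derivative - sin t *\<^sub>R W (fst x) + cos t *\<^sub>R snd x) (at t)"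
          by (intro has_vector_derivative_add has_vector_derivative_scaleR[where g'=0, simplified]
              has_vector_derivative_const DERIV_sin DERIV_cos)
      qed
      then show ?thesis by (simp add: f'_def)
    qed
  qed (use w bd in auto)
  moreover have "(\<integral>x. f' t x \<partial>(M \<Otimes>\<^sub>M std_gaussian))
      = - sin t * ((\<Sum>j\<in>UNIV. expectation (\<lambda>\<omega>. W \<omega> $ j * gauss_smooth (cos t) (sin t) (partial_deriv j h) (W \<omega>)))
       - cos t * (\<Sum>j\<in>UNIV. expectation (\<lambda>\<omega>.
           gauss_smooth (cos t) (sin t) (partial_deriv j (partial_deriv j h)) (W \<omega>))))"
  proof -
    let ?P = "\<lambda>j. gauss_smooth (cos t) (sin t) (partial_deriv j h)"
    let ?G = "\<lambda>j. gauss_smooth (cos t) (sin t) (partial_deriv j (partial_deriv j h))"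
    have inner: "(\<integral>z. f' t (\<omega>, z) \<partial>std_gaussian) = (\<Sum>j\<in>UNIV. - sin t * (W \<omega> $ j * ?P j (W \<omega>)) + cos t * (sin t * ?G j (W \<omega>)))" for \<omega>
    proof -
      have eq: "f' t (\<omega>, z) = (\<Sum>j\<in>UNIV. - sin t * W \<omega> $ j * partial_deriv j h (cos t *\<^sub>R W \<omega> + sin t *\<^sub>R z)
          + cos t * (partial_deriv j h (cos t *\<^sub>R W \<omega> + sin t *\<^sub>R z) * z $ j))" for z
        unfolding f'_def by (intro sum.cong) (auto simp: algebra_simps)
      have i1: "integrable std_gaussian (\<lambda>z. partial_deriv j h (cos t *\<^sub>R W \<omega> + sin t *\<^sub>R z))" for j
        using Cb2_bound1[OF h] by (intro integrable_std_gaussian_bounded[of _ "seminorm1 h"]) auto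
      have i2: "integrable std_gaussian (\<lambda>z. partial_deriv j h (cos t *\<^sub>R W \<omega> + sin t *\<^sub>R z) * z $ j)" for j
        using Cb2_bound1[OF h] by (intro std_gaussian_mult_component_bound[of _ "seminorm1 h"]) auto
      show ?thesis unfolding eq
        using i1 i2
        by (simp add: Bochner_Integration.integral_sum gauss_smooth_by_parts gauss_smooth_def[symmetric] mult.assoc)
    qed
    have PW_int: "integrable M (\<lambda>\<omega>. W \<omega> $ j * ?P j (W \<omega>))" for j
    proof (rule Bochner_Integration.integrable_bound)
      show "integrable M (\<lambda>\<omega>. W \<omega> $ j * seminorm1 h)" using W_int by simp
      have "\<bar>?P j x\<bar> \<le> seminorm1 h" for x
        by (intro gauss_smooth_bound Cb2_bound1[OF h]) measurable
      from order_trans[OF this abs_ge_self]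
      show "AE \<omega> in M. norm (W \<omega> $ j * ?P j (W \<omega>)) \<le> norm (W \<omega> $ j * seminorm1 h)"
        by (auto simp: abs_mult intro!: mult_left_mono)
    qed measurable
    have G_int: "integrable M (\<lambda>\<omega>. ?G j (W \<omega>))" for j
      using gauss_smooth_bound[of "partial_deriv j (partial_deriv j h)" "seminorm2 h"] Cb2_bound2[OF h]
      by (intro integrable_const_bound[of _ "seminorm2 h"]) auto
    have "(\<integral>x. f' t x \<partial>(M \<Otimes>\<^sub>M std_gaussian)) = expectation (\<lambda>\<omega>. \<integral>z. f' t (\<omega>, z) \<partial>std_gaussian)"
      using integral_fst'[OF f'_int] by simp
    also have "\<dots> = (\<Sum>j\<in>UNIV. - sin t * expectation (\<lambda>\<omega>. W \<omega> $ j * ?P j (W \<omega>)) + cos t * (sin t * expectation (\<lambda>\<omega>. ?G j (W \<omega>))))"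
      unfolding inner using PW_int G_int by (simp add: Bochner_Integration.integral_sum)
    also have "\<dots> = - sin t * ((\<Sum>j\<in>UNIV. expectation (\<lambda>\<omega>. W \<omega> $ j * ?P j (W \<omega>)))
       - cos t * (\<Sum>j\<in>UNIV. expectation (\<lambda>\<omega>. ?G j (W \<omega>))))"
      by (simp add: sum.distrib sum_subtractf sum_distrib_left sum_negf right_diff_distrib mult_ac)
    finally show ?thesis .
  qed
  ultimately show ?thesis by simp
qed

theorem normal_approximation:
  "\<bar>expectation (\<lambda>\<omega>. h (W \<omega>)) - (\<integral>z. h z \<partial>std_gaussian)\<bar>
    \<le> sqrt pi * seminorm2 h / (4 * sqrt 2 * real n powr (3/2)) * third_moments"
proof -
  note [measurable] = Cb2_measurable[OF h]
  define B where "B = seminorm2 h * sqrt (2 / pi) * (a ^ 3 / 2) * third_moments"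
  \<comment> \<open>\<open>A\<close> is a primitive of \<open>B * (cos t)\<^sup>2\<close> vanishing
    at \<open>0\<close>; comparing \<open>interp\<close> with \<open>A\<close> from both sides
    avoids integrating the derivative of \<open>interp\<close>.\<close>
  define A where "A t = B * ((t + sin t * cos t) / 2)" for t
  have A: "(A has_real_derivative B * (cos t)\<^sup>2) (at t)" for t
  proof -
    have "(A has_real_derivative B * ((1 + (cos t * cos t - sin t * sin t)) / 2)) (at t)"
      unfolding A_def[abs_def] by (auto intro!: derivative_eq_intros)
    moreover have "(1 + (cos t * cos t - sin t * sin t)) / 2 = (cos t)\<^sup>2"
      using sin_cos_squared_add[of t] by (simp add: power2_eq_square)
    ultimately show ?thesis by simp
  qed
  \<comment> \<open>The discrepancy bound requires \<open>0 < sin t\<close>, so the estimate is made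
    in the open interval and the endpoints are reached by continuity.\<close>
  have "\<exists>D. (interp has_real_derivative D) (at t) \<and> \<bar>D\<bar> \<le> B * (cos t)\<^sup>2" if t: "0 < t" "t < pi / 2" for t
  proof (intro exI conjI, rule interp_derivative)
    have s: "0 < sin t" using t by (intro sin_gt_zero) auto
    have c: "0 \<le> cos t" using t by (intro cos_ge_zero) auto
    let ?T = "(\<Sum>j\<in>UNIV. expectation (\<lambda>\<omega>. W \<omega> $ j * gauss_smooth (cos t) (sin t) (partial_deriv j h) (W \<omega>)))
       - cos t * (\<Sum>j\<in>UNIV. expectation (\<lambda>\<omega>.
           gauss_smooth (cos t) (sin t) (partial_deriv j (partial_deriv j h)) (W \<omega>)))"
    have "\<bar>- sin t * ?T\<bar> = sin t * \<bar>?T\<bar>" using s by (simp add: abs_mult)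
    also have "\<dots> \<le> sin t * (seminorm2 h * sqrt (2 / pi) * ((cos t)\<^sup>2 / sin t) * (a ^ 3 / 2) * third_moments)"
      by (rule mult_left_mono[OF stein_discrepancy_bound[OF c s]]) (use s in simp)
    also have "\<dots> = B * (cos t)\<^sup>2"
      using s by (simp add: B_def)
    finally show "\<bar>- sin t * ?T\<bar> \<le> B * (cos t)\<^sup>2" .
  qed
  note D = this
  have cont: "continuous_on {0..pi/2} interp" "continuous_on {0..pi/2} A"
    by (intro continuous_at_imp_continuous_on ballI DERIV_isCont[OF interp_derivative] DERIV_isCont[OF A])+
  have "interp 0 + A 0 \<le> interp (pi / 2) + A (pi / 2)"
  proof (rule DERIV_nonneg_imp_increasing_open[where f="\<lambda>t. interp t + A t"])
    fix t assume "0 < t" "t < pi / 2"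
    then obtain d where "(interp has_real_derivative d) (at t)" "\<bar>d\<bar> \<le> B * (cos t)\<^sup>2" using D by blast
    with A[of t] show "\<exists>y. ((\<lambda>t. interp t + A t) has_real_derivative y) (at t) \<and> y \<ge> 0"
      by (intro exI[of _ "d + B * (cos t)\<^sup>2"] conjI DERIV_add) auto
  qed (auto intro!: continuous_on_add cont)
  moreover have "A 0 - interp 0 \<le> A (pi / 2) - interp (pi / 2)"
  proof (rule DERIV_nonneg_imp_increasing_open[where f="\<lambda>t. A t - interp t"])
    fix t assume "0 < t" "t < pi / 2"
    then obtain d where "(interp has_real_derivative d) (at t)" "\<bar>d\<bar> \<le> B * (cos t)\<^sup>2" using D by blast
    with A[of t] show "\<exists>y. ((\<lambda>t. A t - interp t) has_real_derivative y) (at t) \<and> y \<ge> 0"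
      by (intro exI[of _ "B * (cos t)\<^sup>2 - d"] conjI DERIV_diff) auto
  qed (auto intro!: continuous_on_diff cont)
  moreover have "A 0 = 0" "A (pi / 2) = B * (pi / 4)" by (auto simp: A_def)
  ultimately have "\<bar>interp 0 - interp (pi / 2)\<bar> \<le> B * (pi / 4)" by linarith
  moreover have "interp 0 = expectation (\<lambda>\<omega>. h (W \<omega>))"
  proof -
    have "integrable M (\<lambda>\<omega>. h (W \<omega>))"
      by (rule integrable_const_bound[of _ "sup_norm h"]) (simp add: Cb2_bound[OF h], measurable)
    from integrable_pair_fst(2)[OF this prob_space_std_gaussian] show ?thesis
      by (simp add: interp_def)
  qed
  moreover have "interp (pi / 2) = (\<integral>z. h z \<partial>std_gaussian)"
  proof -
    have "integrable std_gaussian h"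
      by (rule integrable_std_gaussian_bounded[OF Cb2_measurable(1)[OF h] Cb2_bound[OF h]])
    from integrable_pair_snd(2)[OF this prob_space_std_gaussian] show ?thesis
      by (simp add: interp_def)
  qed
  moreover have "B * (pi / 4) = sqrt pi * seminorm2 h / (4 * sqrt 2 * real n powr (3/2)) * third_moments"
  proof -
    have "a ^ 3 = 1 / real n powr (3/2)"
    proof -
      have "real n powr (3/2) = (real n powr (1/2)) ^ 3"
        using n by (subst powr_power) auto
      then show ?thesis using n by (simp add: a_def powr_half_sqrt power_divide)
    qed
    then have "B * (pi / 4) = seminorm2 h * (sqrt (2 / pi) * (pi / 4) / 2) / real n powr (3/2) * third_moments"
      by (simp add: B_def)
    \<comment> \<open>The three sources of the constant: the mean of
      \<open>\<bar>z $ j\<bar>\<close>, the integral of \<open>(cos t)\<^sup>2\<close>, and the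
      halving in the Taylor remainder.\<close>
    also have "sqrt (2 / pi) * (pi / 4) / 2 = sqrt pi / (4 * sqrt 2)"
    proof -
      have "sqrt (2 / pi) * pi = sqrt 2 * (pi / sqrt pi)"
        by (simp add: real_sqrt_divide)
      also have "\<dots> = 2 / sqrt 2 * sqrt pi"
        by (simp only: real_div_sqrt[of pi] real_div_sqrt[of 2] pi_ge_zero zero_le_numeral)
      finally show ?thesis by simp
    qed
    finally show ?thesis by (simp add: mult_ac)
  qed
  ultimately show ?thesis by simp
qed

end

section \<open>Limit theorems for i.i.d. sequences\<close>

text \<open>The events \<open>B k\<close> have outer probability tending to \<open>0\<close>. Passing to measurable
  supersets avoids all measurability side conditions on the events themselves.\<close>

definition vanishing :: "'a measure \<Rightarrow> (nat \<Rightarrow> 'a set) \<Rightarrow> bool" where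
  "vanishing P B \<longleftrightarrow> (\<forall>\<eta>>0. \<forall>\<^sub>F k in sequentially. \<exists>B'\<in>sets P. B k \<inter> space P \<subseteq> B' \<and> measure P B' \<le> \<eta>)"

lemma vanishingD:
  "vanishing P B \<Longrightarrow> 0 < \<eta> \<Longrightarrow>
    \<forall>\<^sub>F k in sequentially. \<exists>B'\<in>sets P. B k \<inter> space P \<subseteq> B' \<and> measure P B' \<le> \<eta>"
  by (auto simp: vanishing_def)

lemma vanishing_mono:
  assumes "vanishing P B" "\<forall>\<^sub>F k in sequentially. B' k \<inter> space P \<subseteq> B k"
  shows "vanishing P B'"
  unfolding vanishing_def
proof (intro allI impI)
  fix \<eta> :: real assume "\<eta> > 0"
  with assms(1) have "\<forall>\<^sub>F k in sequentially. \<exists>B'\<in>sets P. B k \<inter> space P \<subseteq> B' \<and> measure P B' \<le> \<eta>"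
    by (auto simp: vanishing_def)
  with assms(2) show "\<forall>\<^sub>F k in sequentially. \<exists>C\<in>sets P. B' k \<inter> space P \<subseteq> C \<and> measure P C \<le> \<eta>"
    by eventually_elim blast
qed

lemma (in prob_space) vanishing_Un:
  assumes "vanishing M A" "vanishing M B"
  shows "vanishing M (\<lambda>k. A k \<union> B k)"
  unfolding vanishing_def
proof (intro allI impI)
  fix \<eta> :: real assume "\<eta> > 0"
  then have "\<eta> / 2 > 0" by simp
  have "\<forall>\<^sub>F k in sequentially. \<exists>B'\<in>sets M. A k \<inter> space M \<subseteq> B' \<and> measure M B' \<le> \<eta> / 2"
      "\<forall>\<^sub>F k in sequentially. \<exists>B'\<in>sets M. B k \<inter> space M \<subseteq> B' \<and> measure M B' \<le> \<eta> / 2"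
    using assms[THEN vanishingD, OF \<open>\<eta> / 2 > 0\<close>] by blast+
  then show "\<forall>\<^sub>F k in sequentially. \<exists>C\<in>sets M. (A k \<union> B k) \<inter> space M \<subseteq> C \<and> measure M C \<le> \<eta>"
  proof eventually_elim
    case (elim k)
    then obtain A' B' where AB: "A' \<in> sets M" "A k \<inter> space M \<subseteq> A'" "measure M A' \<le> \<eta> / 2"
        "B' \<in> sets M" "B k \<inter> space M \<subseteq> B'" "measure M B' \<le> \<eta> / 2" by blast
    moreover have "measure M (A' \<union> B') \<le> measure M A' + measure M B'"
      using AB by (intro measure_Un_le) auto
    ultimately show ?case by (intro bexI[of _ "A' \<union> B'"]) auto
  qed
qed

lemma (in prob_space) vanishing_UN:
  assumes "finite S" "\<And>s. s \<in> S \<Longrightarrow> vanishing M (B s)"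
  shows "vanishing M (\<lambda>k. \<Union>s\<in>S. B s k)"
  using assms
proof induction
  case empty
  then show ?case by (auto simp: vanishing_def intro!: always_eventually bexI[of _ "{}"])
next
  case (insert s S)
  then show ?case using vanishing_Un[of "B s" "\<lambda>k. \<Union>s\<in>S. B s k"] by simp
qed

lemma (in prob_space) vanishing_AE:
  assumes "\<And>k. k \<ge> n \<Longrightarrow> AE x in M. x \<notin> B k"
  shows "vanishing M B"
  unfolding vanishing_def
proof (intro allI impI)
  fix \<eta> :: real assume "\<eta> > 0"
  show "\<forall>\<^sub>F k in sequentially. \<exists>B'\<in>sets M. B k \<inter> space M \<subseteq> B' \<and> measure M B' \<le> \<eta>"
    using eventually_ge_at_top[of n]
  proof eventually_elim
    case (elim k)
    then obtain N where "{x \<in> space M. \<not> x \<notin> B k} \<subseteq> N" "emeasure M N = 0" "N \<in> sets M"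
      using assms[of k] by (auto elim: AE_E)
    then show ?case using \<open>\<eta> > 0\<close> by (intro bexI[of _ N]) (auto simp: measure_def)
  qed
qed

lemma vanishing_of_tendsto:
  assumes "\<And>k. k \<ge> n \<Longrightarrow> B k \<in> sets P" "(\<lambda>k. measure P (B k)) \<longlonglongrightarrow> 0"
  shows "vanishing P B"
  unfolding vanishing_def
proof (intro allI impI)
  fix \<eta> :: real assume "\<eta> > 0"
  then have "\<forall>\<^sub>F k in sequentially. measure P (B k) < \<eta>"
    using assms(2) by (rule order_tendstoD(2)[rotated])
  then show "\<forall>\<^sub>F k in sequentially. \<exists>B'\<in>sets P. B k \<inter> space P \<subseteq> B' \<and> measure P B' \<le> \<eta>"
    using eventually_ge_at_top[of n] by eventually_elim (use assms(1) in \<open>force intro: less_imp_le\<close>)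
qed

text \<open>This produces a sample point avoiding finitely many unlikely events at once: their union
  is still vanishing and so cannot exhaust the space.\<close>

lemma (in prob_space) vanishing_not_covering:
  assumes "vanishing M B" shows "\<forall>\<^sub>F k in sequentially. \<not> space M \<subseteq> B k"
proof -
  have "\<forall>\<^sub>F k in sequentially. \<exists>B'\<in>sets M. B k \<inter> space M \<subseteq> B' \<and> measure M B' \<le> 1 / 2"
    using vanishingD[OF assms, of "1 / 2"] by simp
  then show ?thesis
  proof eventually_elim
    case (elim k)
    then obtain B' where B': "B' \<in> sets M" "B k \<inter> space M \<subseteq> B'" "measure M B' \<le> 1 / 2" by blast
    show ?case
    proof
      assume "space M \<subseteq> B k"
      then have "B' = space M" using B' sets.sets_into_space by blast
      then show False using B'(3) prob_space by simp
    qed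
  qed
qed

lemma vanishing_tendsto:
  assumes "prob_space P" and v: "vanishing P B" and meas: "\<And>k. B k \<in> sets P"
  shows "(\<lambda>k. measure P (B k)) \<longlonglongrightarrow> 0"
proof (rule LIMSEQ_I)
  interpret prob_space P by fact
  fix r :: real assume "r > 0"
  then have "\<forall>\<^sub>F k in sequentially. \<exists>B'\<in>sets P. B k \<inter> space P \<subseteq> B' \<and> measure P B' \<le> r / 2"
    using vanishingD[OF v, of "r / 2"] by simp
  then have "\<forall>\<^sub>F k in sequentially. norm (measure P (B k) - 0) < r"
  proof eventually_elim
    case (elim k)
    then obtain B' where B': "B' \<in> sets P" "B k \<inter> space P \<subseteq> B'" "measure P B' \<le> r / 2" by blast
    then have "B k \<subseteq> B'" using meas[of k] sets.sets_into_space by blast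
    then have "measure P (B k) \<le> measure P B'" using B' by (intro finite_measure_mono)
    then show ?case using B' \<open>r > 0\<close> by simp
  qed
  then show "\<exists>no. \<forall>k\<ge>no. norm (measure P (B k) - 0) < r"
    by (simp add: eventually_sequentially)
qed

text \<open>Infinite sequences carry the samples of all sizes on one probability space, which the
  asymptotic argument requires; the data of the theorem are only \<open>n\<close> observations on
  another space.\<close>

locale iid_sequence = L: prob_space L for L :: "'b measure"
begin

definition PP :: "(nat \<Rightarrow> 'b) measure" where "PP = Pi\<^sub>M UNIV (\<lambda>_. L)"

sublocale PP: prob_space PP
  unfolding PP_def by (intro prob_space_PiM L.prob_space_axioms)

lemma component_meas [measurable]: "(\<lambda>\<omega>. \<omega> i) \<in> measurable PP L"
  unfolding PP_def by measurable

lemma distr_component: "distr PP L (\<lambda>\<omega>. \<omega> i) = L"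
  unfolding PP_def by (rule distr_PiM_component) (auto intro: L.prob_space_axioms)

lemma integral_component:
  fixes u :: "'b \<Rightarrow> real"
  assumes "u \<in> borel_measurable L"
  shows "(\<integral>\<omega>. u (\<omega> i) \<partial>PP) = (\<integral>x. u x \<partial>L)"
  using integral_distr[OF component_meas[of i] assms] by (simp add: distr_component)

lemma integrable_component:
  fixes u :: "'b \<Rightarrow> real"
  assumes "integrable L u"
  shows "integrable PP (\<lambda>\<omega>. u (\<omega> i))"
  using assms integrable_distr_eq[OF component_meas[of i], of u] by (simp add: distr_component)

lemma AE_component:
  assumes "AE x in L. Q x" shows "AE \<omega> in PP. Q (\<omega> i)"
  unfolding PP_def using assms by (intro AE_PiM_component) (auto intro: L.prob_space_axioms)

lemma indep_components: "PP.indep_vars (\<lambda>_. L) (\<lambda>i \<omega>. \<omega> i) UNIV"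
proof (subst PP.indep_vars_iff_distr_eq_PiM)
  have "distr PP (Pi\<^sub>M UNIV (\<lambda>_. L)) (\<lambda>x. \<lambda>i\<in>UNIV. x i) = PP"
  proof -
    have "(\<lambda>x :: nat \<Rightarrow> 'b. \<lambda>i\<in>UNIV. x i) = (\<lambda>x. x)" by (auto simp: restrict_def)
    then show ?thesis by (simp add: PP_def)
  qed
  then show "distr PP (Pi\<^sub>M UNIV (\<lambda>_. L)) (\<lambda>x. \<lambda>i\<in>UNIV. x i) = (\<Pi>\<^sub>M i\<in>UNIV. distr PP L (\<lambda>\<omega>. \<omega> i))"
    by (simp only: distr_component PP_def[symmetric])
qed auto

lemma indep_components_compose:
  fixes u :: "'b \<Rightarrow> real"
  assumes "u \<in> borel_measurable L"
  shows "PP.indep_vars (\<lambda>_. borel) (\<lambda>i \<omega>. u (\<omega> i)) UNIV"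
  by (rule PP.indep_vars_compose2[OF indep_components]) (rule assms)

lemma square_integrable_integrable:
  fixes u :: "'b \<Rightarrow> real"
  assumes [measurable]: "u \<in> borel_measurable L" and "integrable L (\<lambda>x. (u x)\<^sup>2)"
  shows "integrable L u"
  using L.square_integrable_imp_integrable assms by blast

lemma sum_second_moment:
  fixes v :: "'b \<Rightarrow> real"
  assumes [measurable]: "v \<in> borel_measurable L" and sq: "integrable L (\<lambda>x. (v x)\<^sup>2)" and mean: "(\<integral>x. v x \<partial>L) = 0"
  shows "integrable PP (\<lambda>\<omega>. (\<Sum>i<k. v (\<omega> i))\<^sup>2) \<and> (\<integral>\<omega>. (\<Sum>i<k. v (\<omega> i))\<^sup>2 \<partial>PP) = real k * (\<integral>x. (v x)\<^sup>2 \<partial>L)"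
proof (induction k)
  case (Suc k)
  let ?S = "\<lambda>\<omega>. \<Sum>i<k. v (\<omega> i)"
  have int_v: "integrable PP (\<lambda>\<omega>. v (\<omega> i))" for i
    using square_integrable_integrable[OF assms(1,2)] by (rule integrable_component)
  have "PP.indep_var borel (\<lambda>\<omega>. v (\<omega> k)) borel ?S"
    using PP.indep_vars_subset[OF indep_components_compose[OF assms(1)]]
    by (intro PP.indep_vars_sum) auto
  then have ind: "(\<integral>\<omega>. v (\<omega> k) * ?S \<omega> \<partial>PP) = 0" "integrable PP (\<lambda>\<omega>. v (\<omega> k) * ?S \<omega>)"
    using int_v mean by (simp_all add: PP.indep_var_lebesgue_integral PP.indep_var_integrable integral_component)
  have eq: "(\<Sum>i<Suc k. v (\<omega> i))\<^sup>2 = (?S \<omega>)\<^sup>2 + 2 * (v (\<omega> k) * ?S \<omega>) + (v (\<omega> k))\<^sup>2" for \<omega>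
    by (simp add: power2_sum algebra_simps)
  have "integrable PP (\<lambda>\<omega>. (v (\<omega> k))\<^sup>2)" using sq by (rule integrable_component)
  then show ?case
    unfolding eq using Suc ind integral_component[of "\<lambda>x. (v x)\<^sup>2" k] by (simp add: distrib_right)
qed simp

lemma chebyshev_sum:
  fixes v :: "'b \<Rightarrow> real"
  assumes [measurable]: "v \<in> borel_measurable L" and sq: "integrable L (\<lambda>x. (v x)\<^sup>2)" and mean: "(\<integral>x. v x \<partial>L) = 0"
    and "0 < c"
  shows "measure PP {\<omega>\<in>space PP. c \<le> \<bar>\<Sum>i<k. v (\<omega> i)\<bar>} \<le> real k * (\<integral>x. (v x)\<^sup>2 \<partial>L) / c\<^sup>2"
proof -
  note S = sum_second_moment[OF assms(1-3), of k]
  have "{\<omega>\<in>space PP. c \<le> \<bar>\<Sum>i<k. v (\<omega> i)\<bar>} = {\<omega>\<in>space PP. c\<^sup>2 \<le> (\<Sum>i<k. v (\<omega> i))\<^sup>2}"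
    using \<open>0 < c\<close> abs_le_square_iff[of c] by simp
  also have "measure PP \<dots> \<le> (\<integral>\<omega>. (\<Sum>i<k. v (\<omega> i))\<^sup>2 \<partial>PP) / c\<^sup>2"
    using S \<open>0 < c\<close> by (intro integral_Markov_inequality_measure[where A="{}"]) auto
  finally show ?thesis using S by simp
qed

lemma measure_abs_average_le:
  fixes w :: "'b \<Rightarrow> real"
  assumes w: "integrable L w" and "0 < c" "0 < k"
  shows "measure PP {\<omega>\<in>space PP. c \<le> (\<Sum>i<k. \<bar>w (\<omega> i)\<bar>) / real k} \<le> (\<integral>x. \<bar>w x\<bar> \<partial>L) / c"
proof -
  have [measurable]: "w \<in> borel_measurable L" using w by simp
  have i: "integrable PP (\<lambda>\<omega>. \<bar>w (\<omega> i)\<bar>)" for i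
    using integrable_component[OF integrable_abs[OF w]] .
  have "measure PP {\<omega>\<in>space PP. c \<le> (\<Sum>i<k. \<bar>w (\<omega> i)\<bar>) / real k}
      \<le> (\<integral>\<omega>. (\<Sum>i<k. \<bar>w (\<omega> i)\<bar>) / real k \<partial>PP) / c"
    using i \<open>0 < c\<close> by (intro integral_Markov_inequality_measure[where A="{}"]) (auto intro!: divide_nonneg_nonneg sum_nonneg)
  also have "(\<integral>\<omega>. (\<Sum>i<k. \<bar>w (\<omega> i)\<bar>) / real k \<partial>PP) = (\<integral>x. \<bar>w x\<bar> \<partial>L)"
    using i \<open>0 < k\<close> integral_component[of "\<lambda>x. \<bar>w x\<bar>"] by (simp add: Bochner_Integration.integral_sum)
  finally show ?thesis .
qed

text \<open>At each point the truncation is exact as soon as \<open>c\<close> exceeds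
  \<open>\<bar>u x\<bar>\<close>, and \<open>\<bar>u\<bar>\<close> dominates the error.\<close>

lemma truncation_error_small:
  fixes u :: "'b \<Rightarrow> real"
  assumes u: "integrable L u" and "0 < \<rho>"
  obtains c where "0 \<le> c" "(\<integral>x. \<bar>u x - (if \<bar>u x\<bar> \<le> c then u x else 0)\<bar> \<partial>L) < \<rho>"
proof -
  have [measurable]: "u \<in> borel_measurable L" using u by simp
  let ?w = "\<lambda>c x. \<bar>u x - (if \<bar>u x\<bar> \<le> real c then u x else 0)\<bar>"
  have "(\<lambda>c. \<integral>x. ?w c x \<partial>L) \<longlonglongrightarrow> (\<integral>x. 0 \<partial>L)"
  proof (rule integral_dominated_convergence[where w="\<lambda>x. \<bar>u x\<bar>"])
    show "AE x in L. (\<lambda>c. ?w c x) \<longlonglongrightarrow> 0"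
    proof (rule AE_I2)
      fix x
      obtain N where N: "\<bar>u x\<bar> \<le> real N" using real_arch_simple by blast
      show "(\<lambda>c. ?w c x) \<longlonglongrightarrow> 0"
        by (rule tendsto_eventually) (use N in \<open>auto simp: eventually_sequentially intro!: exI[of _ N]\<close>)
    qed
  qed (use u in auto)
  then have "\<forall>\<^sub>F c in sequentially. (\<integral>x. ?w c x \<partial>L) < \<rho>"
    using \<open>0 < \<rho>\<close> by (intro order_tendstoD(2)) auto
  then obtain c where "(\<integral>x. ?w c x \<partial>L) < \<rho>" by (auto simp: eventually_sequentially)
  then show ?thesis by (intro that[of "real c"]) auto
qed

text \<open>It will be applied to second derivatives and to the envelope of the third ones, of which
  only integrability is known. Truncation splits \<open>u\<close> into a bounded part, handled by
  Chebyshev, and a part small in mean, handled by Markov.\<close>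

theorem weak_law_of_large_numbers:
  fixes u :: "'b \<Rightarrow> real"
  assumes u: "integrable L u" and \<delta>: "0 < \<delta>"
  shows "vanishing PP (\<lambda>k. {\<omega>. \<delta> \<le> \<bar>(\<Sum>i<k. u (\<omega> i)) / real k - (\<integral>x. u x \<partial>L)\<bar>})"
  unfolding vanishing_def
proof (intro allI impI)
  fix \<eta> :: real assume \<eta>: "\<eta> > 0"
  have u_meas [measurable]: "u \<in> borel_measurable L" using u by simp
  \<comment> \<open>The first entry keeps the change of the mean below \<open>\<delta> / 4\<close>,
    the second makes the Markov bound \<open>\<rho> / (\<delta> / 4)\<close> at most
    \<open>\<eta> / 2\<close>. Three deviations of at most \<open>\<delta> / 4\<close> then stay
    below \<open>\<delta>\<close>.\<close>
  define \<rho> where "\<rho> = min (\<delta> / 4) (\<eta> * \<delta> / 8)"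
  have "\<rho> > 0" using \<delta> \<eta> by (simp add: \<rho>_def)
  then obtain c where c: "0 \<le> c" "(\<integral>x. \<bar>u x - (if \<bar>u x\<bar> \<le> c then u x else 0)\<bar> \<partial>L) < \<rho>"
    using truncation_error_small[OF u] by blast
  define v where "v x = (if \<bar>u x\<bar> \<le> c then u x else 0)" for x
  define w where "w x = u x - v x" for x
  have [measurable]: "v \<in> borel_measurable L" unfolding v_def[abs_def] by measurable
  have v_int: "integrable L v"
    using c(1) by (intro L.integrable_const_bound[of _ c]) (auto simp: v_def)
  have w_int: "integrable L w" unfolding w_def[abs_def] using u v_int by simp
  define m where "m = (\<integral>x. v x \<partial>L)"
  define z where "z x = v x - m" for x
  have z_mean: "(\<integral>x. z x \<partial>L) = 0"
    unfolding z_def using v_int by (simp add: m_def L.prob_space)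
  have z_meas [measurable]: "z \<in> borel_measurable L" unfolding z_def[abs_def] by measurable
  have z_sq: "integrable L (\<lambda>x. (z x)\<^sup>2)"
  proof (rule L.integrable_const_bound[of _ "(c + \<bar>m\<bar>)\<^sup>2"])
    have "\<bar>z x\<bar> \<le> c + \<bar>m\<bar>" for x
      using c(1) by (auto simp: z_def v_def)
    then show "AE x in L. norm ((z x)\<^sup>2) \<le> (c + \<bar>m\<bar>)\<^sup>2"
      using c(1) by (intro AE_I2) (simp add: abs_le_square_iff[symmetric])
  qed measurable
  define Q where "Q = (\<integral>x. (z x)\<^sup>2 \<partial>L)"
  have w_small: "(\<integral>x. \<bar>w x\<bar> \<partial>L) < \<rho>" using c(2) by (simp add: w_def v_def)
  have mean_diff: "\<bar>(\<integral>x. u x \<partial>L) - m\<bar> \<le> \<delta> / 4"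
  proof -
    have "(\<integral>x. u x \<partial>L) - m = (\<integral>x. w x \<partial>L)"
      unfolding w_def m_def using u v_int by simp
    moreover have "\<bar>\<integral>x. w x \<partial>L\<bar> \<le> (\<integral>x. \<bar>w x\<bar> \<partial>L)" by (rule integral_abs_bound)
    moreover have "\<rho> \<le> \<delta> / 4" by (simp add: \<rho>_def)
    ultimately show ?thesis using w_small by linarith
  qed
  have "((\<lambda>k. Q / (real k * (\<delta> / 4)\<^sup>2)) \<longlongrightarrow> 0) sequentially"
    using \<delta> by real_asymp
  then have "\<forall>\<^sub>F k in sequentially. Q / (real k * (\<delta> / 4)\<^sup>2) < \<eta> / 2"
    using \<eta> by (intro order_tendstoD(2)) auto
  with eventually_gt_at_top[of 0]
  show "\<forall>\<^sub>F k in sequentially. \<exists>B'\<in>sets PP. {\<omega>. \<delta> \<le> \<bar>(\<Sum>i<k. u (\<omega> i)) / real k - (\<integral>x. u x \<partial>L)\<bar>} \<inter> space PP \<subseteq> B'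
      \<and> measure PP B' \<le> \<eta>"
  proof eventually_elim
    case (elim k)
    define B1 where "B1 = {\<omega>\<in>space PP. real k * (\<delta> / 4) \<le> \<bar>\<Sum>i<k. z (\<omega> i)\<bar>}"
    define B2 where "B2 = {\<omega>\<in>space PP. \<delta> / 4 \<le> (\<Sum>i<k. \<bar>w (\<omega> i)\<bar>) / real k}"
    have [measurable]: "w \<in> borel_measurable L" using w_int by simp
    have B_meas: "B1 \<in> sets PP" "B2 \<in> sets PP" unfolding B1_def B2_def by measurable
    have "measure PP B1 \<le> real k * Q / (real k * (\<delta> / 4))\<^sup>2"
      unfolding B1_def Q_def using elim(1) \<delta> by (intro chebyshev_sum z_meas z_sq z_mean) auto
    also have "\<dots> = Q / (real k * (\<delta> / 4)\<^sup>2)"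
      using elim(1) by (simp add: power2_eq_square)
    also have "\<dots> \<le> \<eta> / 2" using elim(2) by simp
    finally have 1: "measure PP B1 \<le> \<eta> / 2" .
    have "measure PP B2 \<le> (\<integral>x. \<bar>w x\<bar> \<partial>L) / (\<delta> / 4)"
      unfolding B2_def using elim(1) \<delta> by (intro measure_abs_average_le w_int) auto
    also have "\<dots> \<le> (\<eta> * \<delta> / 8) / (\<delta> / 4)"
      using w_small \<delta> by (intro divide_right_mono) (auto simp: \<rho>_def)
    also have "\<dots> = \<eta> / 2" using \<delta> by simp
    finally have 2: "measure PP B2 \<le> \<eta> / 2" .
    have "measure PP (B1 \<union> B2) \<le> measure PP B1 + measure PP B2"
      using B_meas by (intro measure_Un_le)
    with 1 2 have "measure PP (B1 \<union> B2) \<le> \<eta>" by simp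
    moreover have "{\<omega>. \<delta> \<le> \<bar>(\<Sum>i<k. u (\<omega> i)) / real k - (\<integral>x. u x \<partial>L)\<bar>} \<inter> space PP \<subseteq> B1 \<union> B2"
    proof (rule ccontr)
      assume "\<not> ?thesis"
      then obtain \<omega> where \<omega>: "\<omega> \<in> space PP" "\<delta> \<le> \<bar>(\<Sum>i<k. u (\<omega> i)) / real k - (\<integral>x. u x \<partial>L)\<bar>"
        "\<bar>\<Sum>i<k. z (\<omega> i)\<bar> < real k * (\<delta> / 4)" "(\<Sum>i<k. \<bar>w (\<omega> i)\<bar>) / real k < \<delta> / 4"
        unfolding B1_def B2_def by (force simp: not_le)
      have "(\<Sum>i<k. u (\<omega> i)) = (\<Sum>i<k. z (\<omega> i)) + (\<Sum>i<k. w (\<omega> i)) + real k * m"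
        by (simp add: z_def w_def sum_subtractf)
      then have eq: "(\<Sum>i<k. u (\<omega> i)) / real k = (\<Sum>i<k. z (\<omega> i)) / real k + (\<Sum>i<k. w (\<omega> i)) / real k + m"
        using elim(1) by (simp add: add_divide_distrib)
      have "\<bar>(\<Sum>i<k. z (\<omega> i)) / real k\<bar> < \<delta> / 4"
        using \<omega>(3) elim(1) by (simp add: divide_less_eq mult.commute)
      moreover have "\<bar>(\<Sum>i<k. w (\<omega> i)) / real k\<bar> \<le> (\<Sum>i<k. \<bar>w (\<omega> i)\<bar>) / real k"
        by (simp add: divide_right_mono sum_abs)
      ultimately show False using \<omega>(2,4) mean_diff \<delta> unfolding eq by linarith
    qed
    ultimately show ?case using B_meas by blast
  qed
qed

text \<open>Provides a continuity point of the normal distribution function at which its value is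
  positive, the contradiction sought in the next theorem.\<close>

lemma std_normal_measure:
  "measure std_normal_distribution {x} = 0" "measure std_normal_distribution {..x} > 0"
proof -
  interpret N: prob_space std_normal_distribution by (simp add: prob_space_normal_density)
  have meas: "(\<lambda>x. ennreal (std_normal_density x)) \<in> borel_measurable lborel" by measurable
  have "AE y in lborel. y \<in> {x} \<longrightarrow> ennreal (std_normal_density y) = 0"
    using AE_lborel_singleton[of x] by eventually_elim simp
  then have "{x} \<in> null_sets std_normal_distribution"
    by (simp only: null_sets_density_iff[OF meas]) simp
  then show "measure std_normal_distribution {x} = 0"
    by (simp add: null_sets_def measure_def)
  have "{..x} \<notin> null_sets std_normal_distribution"
  proof
    assume "{..x} \<in> null_sets std_normal_distribution"
    then have "AE y in lborel. y \<in> {..x} \<longrightarrow> ennreal (std_normal_density y) = 0"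
      by (simp add: null_sets_density_iff[OF meas])
    then have "AE y in lborel. y \<notin> {..x}"
    proof eventually_elim
      case (elim y)
      then show ?case using normal_density_pos[of 1 0 y] by (auto simp: ennreal_eq_0_iff)
    qed
    then have "emeasure lborel {..x} = 0"
      using emeasure_eq_0_AE[of "\<lambda>y. y \<in> {..x}" lborel] by (simp add: atMost_def)
    moreover have "emeasure lborel {x-1..x} \<le> emeasure lborel {..x}"
      by (intro emeasure_mono) auto
    ultimately show False by simp
  qed
  then show "measure std_normal_distribution {..x} > 0"
    by (auto simp: null_sets_def N.emeasure_eq_measure zero_less_measure_iff)
qed

text \<open>The law of large numbers forces the mean to be \<open>0\<close>. If the variance were
  positive, the normalized sums would converge in law to a nondegenerate normal variable and could
  not vanish in probability.\<close>

theorem normalized_sum_vanishing_imp_zero: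
  fixes y :: "'b \<Rightarrow> real"
  assumes y_meas: "y \<in> borel_measurable L" and sq: "integrable L (\<lambda>x. (y x)\<^sup>2)"
    and van: "\<And>\<delta>. 0 < \<delta> \<Longrightarrow> vanishing PP (\<lambda>k. {\<omega>. \<delta> \<le> \<bar>\<Sum>i<k. y (\<omega> i)\<bar> / sqrt (real k)})"
  shows "AE x in L. y x = 0"
proof -
  note [measurable] = y_meas
  have y_int: "integrable L y" using square_integrable_integrable[OF y_meas sq] .
  have mean0: "(\<integral>x. y x \<partial>L) = 0"
  proof (rule ccontr)
    define m where "m = (\<integral>x. y x \<partial>L)"
    assume "(\<integral>x. y x \<partial>L) \<noteq> 0"
    then have m: "\<bar>m\<bar> / 2 > 0" by (simp add: m_def)
    have "\<forall>\<^sub>F k in sequentially. \<not> space PP \<subseteq> {\<omega>. \<bar>m\<bar> / 2 \<le> \<bar>(\<Sum>i<k. y (\<omega> i)) / real k - m\<bar>}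
        \<union> {\<omega>. \<bar>m\<bar> / 2 \<le> \<bar>\<Sum>i<k. y (\<omega> i)\<bar> / sqrt (real k)}"
      unfolding m_def using m
      by (intro PP.vanishing_not_covering PP.vanishing_Un weak_law_of_large_numbers y_int van) (auto simp: m_def)
    with eventually_gt_at_top[of 0] have "\<forall>\<^sub>F k :: nat in sequentially. False"
    proof eventually_elim
      case (elim k)
      then obtain \<omega> where \<omega>: "\<bar>(\<Sum>i<k. y (\<omega> i)) / real k - m\<bar> < \<bar>m\<bar> / 2"
          "\<bar>\<Sum>i<k. y (\<omega> i)\<bar> / sqrt (real k) < \<bar>m\<bar> / 2" by (force simp: not_le)
      \<comment> \<open>For \<open>k \<ge> 1\<close> the averages are smaller than the sums divided
        by \<open>sqrt (real k)\<close>, so they are close to \<open>0\<close>, while the law of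
        large numbers keeps them close to \<open>m\<close>.\<close>
      have "sqrt (real k) \<le> real k" using elim(1) by (intro real_le_lsqrt) (auto simp: power2_eq_square)
      then have "\<bar>\<Sum>i<k. y (\<omega> i)\<bar> / real k \<le> \<bar>\<Sum>i<k. y (\<omega> i)\<bar> / sqrt (real k)"
        using elim(1) by (intro divide_left_mono) auto
      then have "\<bar>(\<Sum>i<k. y (\<omega> i)) / real k\<bar> < \<bar>m\<bar> / 2"
        using \<omega>(2) unfolding abs_divide by linarith
      with \<omega>(1) show False by linarith
    qed
    then show False by simp
  qed
  define V where "V = (\<integral>x. (y x)\<^sup>2 \<partial>L)"
  have "V = 0"
  proof (rule ccontr)
    assume "V \<noteq> 0"
    moreover have "V \<ge> 0" by (simp add: V_def)
    ultimately have "V > 0" by simp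
    define \<sigma> where "\<sigma> = sqrt V"
    have \<sigma>: "\<sigma> > 0" "\<sigma>\<^sup>2 = V" using \<open>V > 0\<close> by (auto simp: \<sigma>_def)
    have conv: "weak_conv_m (\<lambda>n. distr PP borel (\<lambda>\<omega>. (\<Sum>i<n. y (\<omega> i)) / sqrt (n * \<sigma>\<^sup>2))) std_normal_distribution"
    proof (rule PP.central_limit_theorem_zero_mean)
      show "PP.indep_vars (\<lambda>i. borel) (\<lambda>i \<omega>. y (\<omega> i)) UNIV"
        by (rule indep_components_compose[OF y_meas])
      show mean: "PP.expectation (\<lambda>\<omega>. y (\<omega> n)) = 0" for n
        using integral_component[OF y_meas] mean0 by simp
      show "0 < \<sigma>" by (rule \<sigma>)
      show "integrable PP (\<lambda>\<omega>. (y (\<omega> n))\<^sup>2)" for n using integrable_component[OF sq] .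
      show "PP.variance (\<lambda>\<omega>. y (\<omega> n)) = \<sigma>\<^sup>2" for n
        unfolding mean \<sigma>(2) V_def using integral_component[of "\<lambda>x. (y x)\<^sup>2" n] by simp
      show "distr PP borel (\<lambda>\<omega>. y (\<omega> n)) = distr L borel y" for n
        using distr_distr[OF y_meas component_meas[of n]] by (simp add: distr_component comp_def)
    qed
    interpret N: real_distribution std_normal_distribution by (rule real_dist_normal_dist)
    let ?T = "\<lambda>(n :: nat) \<omega>. (\<Sum>i<n. y (\<omega> i)) / sqrt (real n * \<sigma>\<^sup>2)"
    \<comment> \<open>The distribution functions converge at \<open>-1\<close>, a continuity point
      of the limit; the hypothesis makes them tend to \<open>0\<close> there, although the limit is
      positive.\<close>
    have "(\<lambda>n. cdf (distr PP borel (?T n)) (- 1)) \<longlonglongrightarrow> cdf std_normal_distribution (- 1)"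
      using conv std_normal_measure(1)[of "-1"] by (auto simp: weak_conv_m_def weak_conv_def N.isCont_cdf)
    moreover have "(\<lambda>n. cdf (distr PP borel (?T n)) (- 1)) \<longlonglongrightarrow> 0"
    proof -
      have eq: "cdf (distr PP borel (?T n)) (- 1) = measure PP {\<omega>\<in>space PP. ?T n \<omega> \<le> - 1}" for n
        unfolding cdf_def by (subst measure_distr) (auto intro!: arg_cong[where f="measure PP"])
      show ?thesis unfolding eq
      proof (rule vanishing_tendsto[OF PP.prob_space_axioms])
        show "vanishing PP (\<lambda>n. {\<omega>\<in>space PP. ?T n \<omega> \<le> - 1})"
        proof (rule vanishing_mono[OF van[OF \<sigma>(1)]])
          show "\<forall>\<^sub>F k in sequentially. {\<omega>\<in>space PP. ?T k \<omega> \<le> - 1} \<inter> space PP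
              \<subseteq> {\<omega>. \<sigma> \<le> \<bar>\<Sum>i<k. y (\<omega> i)\<bar> / sqrt (real k)}"
            using eventually_gt_at_top[of 0]
          proof eventually_elim
            case (elim k)
            show ?case
            proof clarsimp
              fix \<omega> assume "(\<Sum>i<k. y (\<omega> i)) / sqrt (real k * \<sigma>\<^sup>2) \<le> - 1"
              moreover have "sqrt (real k * \<sigma>\<^sup>2) = sqrt (real k) * \<sigma>" "0 < sqrt (real k) * \<sigma>"
                using elim \<sigma>(1) by (auto simp: real_sqrt_mult)
              ultimately have "(\<Sum>i<k. y (\<omega> i)) \<le> - (sqrt (real k) * \<sigma>)"
                by (simp add: pos_divide_le_eq)
              then have "sqrt (real k) * \<sigma> \<le> \<bar>\<Sum>i<k. y (\<omega> i)\<bar>" by linarith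
              then show "\<sigma> \<le> \<bar>\<Sum>i<k. y (\<omega> i)\<bar> / sqrt (real k)"
                using elim by (simp add: le_divide_eq mult.commute)
            qed
          qed
        qed
      qed measurable
    qed
    ultimately have "cdf std_normal_distribution (- 1) = 0" by (rule LIMSEQ_unique)
    then show False using std_normal_measure(2)[of "-1"] by (simp add: cdf_def)
  qed
  then have "AE x in L. (y x)\<^sup>2 = 0"
    using sq unfolding V_def by (subst (asm) integral_nonneg_eq_0_iff_AE) auto
  then show ?thesis by simp
qed

end

section \<open>Regularity of a single observation\<close>

lemma partial_deriv_cong:
  fixes F G :: "real ^ 'd::finite \<Rightarrow> real"
  assumes "open S" "x \<in> S" "\<And>y. y \<in> S \<Longrightarrow> F y = G y"
  shows "partial_deriv i F x = partial_deriv i G x"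
  unfolding partial_deriv_def
proof (rule deriv_cong_ev)
  have "((\<lambda>t :: real. x + t *\<^sub>R axis i 1) \<longlongrightarrow> x + 0 *\<^sub>R axis i 1) (nhds 0)"
    by (intro tendsto_intros) (rule filterlim_ident)
  then have "\<forall>\<^sub>F t in nhds 0. x + t *\<^sub>R axis i 1 \<in> S"
    using assms(1,2) by (intro topological_tendstoD) auto
  then show "\<forall>\<^sub>F t in nhds 0. F (x + t *\<^sub>R axis i 1) = G (x + t *\<^sub>R axis i 1)"
    by eventually_elim (rule assms(3))
qed simp

lemma differentiable_cong_open:
  fixes F G :: "real ^ 'd::finite \<Rightarrow> real"
  assumes "open S" "x \<in> S" "\<And>y. y \<in> S \<Longrightarrow> F y = G y" "F differentiable (at x)"
  shows "G differentiable (at x)"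
proof -
  obtain d where "0 < d" "ball x d \<subseteq> S"
    using assms(1,2) by (auto simp: open_contains_ball)
  then show ?thesis
    using assms(3) by (intro differentiable_transform_within[OF assms(4), of d]) (auto simp: dist_commute subset_iff)
qed

lemma k_times_cont_diff_on_cong:
  fixes F G :: "real ^ 'd::finite \<Rightarrow> real"
  assumes "open S" "\<And>y. y \<in> S \<Longrightarrow> F y = G y" "k_times_cont_diff_on k S F"
  shows "k_times_cont_diff_on k S G"
  using assms(2,3)
proof (induction k arbitrary: F G)
  case 0
  then show ?case using continuous_on_cong[of S S F G] by simp
next
  case (Suc k)
  have "partial_deriv i F y = partial_deriv i G y" if "y \<in> S" for i y
    using partial_deriv_cong[OF assms(1) that] Suc.prems(1) by blast
  then show ?case
    using Suc.prems Suc.IH[of "partial_deriv _ F" "partial_deriv _ G"]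
      differentiable_cong_open[OF assms(1) _ Suc.prems(1)] by auto
qed

lemma partial_deriv_cmult:
  fixes F :: "real ^ 'd::finite \<Rightarrow> real"
  assumes "F differentiable (at x)"
  shows "partial_deriv i (\<lambda>x. c * F x) x = c * partial_deriv i F x"
proof -
  obtain L where L: "(F has_derivative L) (at x)" using assms by (auto simp: differentiable_def)
  show ?thesis
    using partial_deriv_has_derivative[OF has_derivative_mult_right[OF L, of c]]
      partial_deriv_has_derivative[OF L] by simp
qed

lemma partial_deriv_sum:
  fixes F :: "'i \<Rightarrow> real ^ 'd::finite \<Rightarrow> real"
  assumes "\<And>i. i \<in> I \<Longrightarrow> F i differentiable (at x)"
  shows "partial_deriv r (\<lambda>x. \<Sum>i\<in>I. F i x) x = (\<Sum>i\<in>I. partial_deriv r (F i) x)"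
proof -
  have "\<forall>i\<in>I. \<exists>L. (F i has_derivative L) (at x)" using assms by (auto simp: differentiable_def)
  then obtain L where L: "\<And>i. i \<in> I \<Longrightarrow> (F i has_derivative L i) (at x)" by metis
  have "((\<lambda>x. \<Sum>i\<in>I. F i x) has_derivative (\<lambda>v. \<Sum>i\<in>I. L i v)) (at x)"
    by (rule has_derivative_sum[OF L])
  then have "partial_deriv r (\<lambda>x. \<Sum>i\<in>I. F i x) x = (\<Sum>i\<in>I. L i (axis r 1))"
    by (rule partial_deriv_has_derivative)
  also have "\<dots> = (\<Sum>i\<in>I. partial_deriv r (F i) x)"
    using partial_deriv_has_derivative[OF L] by (intro sum.cong) auto
  finally show ?thesis .
qed

lemma k_times_cont_diff_on_cmult:
  fixes F :: "real ^ 'd::finite \<Rightarrow> real"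
  assumes "open S" "k_times_cont_diff_on k S F"
  shows "k_times_cont_diff_on k S (\<lambda>x. c * F x)"
  using assms(2)
proof (induction k arbitrary: F)
  case 0
  then show ?case by (auto intro: continuous_intros)
next
  case (Suc k)
  have diff: "\<forall>x\<in>S. F differentiable (at x)" and IH: "\<And>i. k_times_cont_diff_on k S (\<lambda>x. c * partial_deriv i F x)"
    using Suc by auto
  have "k_times_cont_diff_on k S (partial_deriv i (\<lambda>x. c * F x))" for i
    by (rule k_times_cont_diff_on_cong[OF assms(1) _ IH[of i]]) (use diff in \<open>simp add: partial_deriv_cmult\<close>)
  then show ?case using diff by (auto intro: differentiable_mult)
qed

text \<open>Isolates one observation of a sample: all others are frozen at a generic point.\<close>

lemma (in prob_space) integrable_freeze_other_coordinates:
  fixes \<psi> :: "(nat \<Rightarrow> 'a) \<Rightarrow> real"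
  assumes \<psi>: "integrable (Pi\<^sub>M {..<n} (\<lambda>_. M)) \<psi>" and "n \<ge> 1" and S: "AE x in M. x \<in> S"
  obtains x' where "x' \<in> {1..<n} \<rightarrow>\<^sub>E S" "integrable M (\<lambda>y. \<psi> (x'(0 := y)))"
proof -
  interpret R: prob_space "Pi\<^sub>M {1..<n} (\<lambda>_. M)" by (intro prob_space_PiM prob_space_axioms)
  interpret pair_sigma_finite M "Pi\<^sub>M {1..<n} (\<lambda>_. M)" ..
  have ins: "insert 0 {1..<n} = {..<n}" using \<open>n \<ge> 1\<close> by auto
  let ?T = "\<lambda>(x, X). X(0 := x)"
  have distr: "distr (M \<Otimes>\<^sub>M Pi\<^sub>M {1..<n} (\<lambda>_. M)) (Pi\<^sub>M {..<n} (\<lambda>_. M)) ?T = Pi\<^sub>M {..<n} (\<lambda>_. M)"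
    using distr_pair_PiM_eq_PiM[of "{1..<n}" "\<lambda>_. M" 0] prob_space_axioms unfolding ins by simp
  have T: "?T \<in> measurable (M \<Otimes>\<^sub>M Pi\<^sub>M {1..<n} (\<lambda>_. M)) (Pi\<^sub>M {..<n} (\<lambda>_. M))"
    unfolding ins[symmetric] by measurable
  have "integrable (M \<Otimes>\<^sub>M Pi\<^sub>M {1..<n} (\<lambda>_. M)) (\<lambda>p. \<psi> (?T p))"
    using \<psi> integrable_distr_eq[OF T borel_measurable_integrable[OF \<psi>]] unfolding distr by blast
  \<comment> \<open>Fubini: for almost every choice of the other coordinates the section in
    coordinate \<open>0\<close> is integrable. Almost surely they also lie in \<open>S\<close>, so a
    choice with both properties exists.\<close>
  then have "AE X in Pi\<^sub>M {1..<n} (\<lambda>_. M). integrable M (\<lambda>y. \<psi> (X(0 := y)))"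
    using AE_integrable_snd[of "\<lambda>y X. \<psi> (X(0 := y))"] by (simp add: case_prod_unfold)
  moreover have "AE X in Pi\<^sub>M {1..<n} (\<lambda>_. M). \<forall>i\<in>{1..<n}. X i \<in> S"
    using S by (intro AE_finite_allI AE_PiM_component prob_space_axioms) auto
  ultimately have "AE X in Pi\<^sub>M {1..<n} (\<lambda>_. M). X \<in> {1..<n} \<rightarrow>\<^sub>E S \<and> integrable M (\<lambda>y. \<psi> (X(0 := y)))"
    using AE_space by eventually_elim (auto simp: space_PiM PiE_iff)
  then obtain x' where "x' \<in> {1..<n} \<rightarrow>\<^sub>E S \<and> integrable M (\<lambda>y. \<psi> (x'(0 := y)))"
    using eventually_happens'[OF R.ae_filter_bot] by blast
  then show ?thesis using that by blast
qed

locale mle_model =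
  fixes \<nu> :: "(real ^ 't::finite) measure" and f :: "real ^ 't \<Rightarrow> real ^ 'd::finite \<Rightarrow> real"
    and \<Theta> :: "(real ^ 'd) set" and \<theta>\<^sub>0 :: "real ^ 'd" and n :: nat
  assumes model: "parametric_model \<nu> f \<Theta>" and true_param: "\<theta>\<^sub>0 \<in> \<Theta>" and n_pos: "n \<ge> 1"
    and regular: "regularity_conditions \<nu> f \<Theta> n"
begin

abbreviation L :: "(real ^ 't) measure" where "L \<equiv> law \<nu> f \<theta>\<^sub>0"

definition S :: "(real ^ 't) set" where "S = {x. 0 < f x \<theta>\<^sub>0}"

definition lf :: "real ^ 't \<Rightarrow> real ^ 'd \<Rightarrow> real" where "lf y \<theta> = ln (f y \<theta>)"

lemma open_\<Theta>: "open \<Theta>" and sets_\<nu>: "sets \<nu> = sets borel"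
  and f_meas: "(\<lambda>x. f x \<theta>\<^sub>0) \<in> borel_measurable \<nu>" and f_nonneg: "0 \<le> f x \<theta>\<^sub>0"
  and prob_L: "prob_space L"
  using model true_param by (auto simp: parametric_model_def)

sublocale iid_sequence L
  by (simp add: iid_sequence_def prob_L)

lemma sets_L [simp, measurable_cong]: "sets L = sets borel"
  by (simp add: law_def sets_\<nu>)

lemma space_L [simp]: "space L = UNIV"
  using sets_eq_imp_space_eq[OF sets_L] by simp

lemma sample_law_eq: "sample_law \<nu> f k \<theta>\<^sub>0 = Pi\<^sub>M {..<k} (\<lambda>_. L)"
  by (simp add: sample_law_def)

lemma S_meas [measurable]: "S \<in> sets borel"
proof -
  have "S = {x \<in> space \<nu>. 0 < f x \<theta>\<^sub>0}"
    using sets_eq_imp_space_eq[OF sets_\<nu>] by (auto simp: S_def)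
  also have "\<dots> \<in> sets \<nu>" using f_meas by measurable
  finally show ?thesis by (simp add: sets_\<nu>)
qed

lemma AE_S: "AE x in L. x \<in> S"
  unfolding law_def S_def using f_meas by (subst AE_density) auto

lemma S_eq: "{x. \<forall>\<theta>\<in>\<Theta>. 0 < f x \<theta>} = S"
  using model true_param unfolding parametric_model_def S_def by blast

lemma sample_support_eq: "sample_support f \<Theta> n = ({..<n} \<rightarrow>\<^sub>E S)"
  by (simp add: sample_support_def S_eq)

lemma loglik_eq: "loglik f k x = (\<lambda>\<theta>. \<Sum>i<k. lf (x i) \<theta>)"
  by (auto simp: loglik_def lf_def)

text \<open>Constant samples reduce (R.C.2) to one observation.\<close>

lemma lf_smooth:
  assumes "y \<in> S" shows "k_times_cont_diff_on 3 \<Theta> (lf y)"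
proof -
  have "(\<lambda>i\<in>{..<n}. y) \<in> sample_support f \<Theta> n"
    using assms by (auto simp: sample_support_eq)
  then have "k_times_cont_diff_on 3 \<Theta> (loglik f n (\<lambda>i\<in>{..<n}. y))"
    using regular by (auto simp: regularity_conditions_def RC2_def)
  then have "k_times_cont_diff_on 3 \<Theta> (\<lambda>\<theta>. (1 / real n) * loglik f n (\<lambda>i\<in>{..<n}. y) \<theta>)"
    by (rule k_times_cont_diff_on_cmult[OF open_\<Theta>])
  moreover have "(1 / real n) * loglik f n (\<lambda>i\<in>{..<n}. y) \<theta> = lf y \<theta>" for \<theta>
    using n_pos by (simp add: loglik_eq)
  ultimately show ?thesis by simp
qed

abbreviation d1 :: "'d \<Rightarrow> real ^ 't \<Rightarrow> real ^ 'd \<Rightarrow> real" where "d1 u y \<equiv> partial_deriv u (lf y)"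
abbreviation d2 :: "'d \<Rightarrow> 'd \<Rightarrow> real ^ 't \<Rightarrow> real ^ 'd \<Rightarrow> real" where "d2 s u y \<equiv> partial_deriv s (d1 u y)"
abbreviation d3 :: "'d \<Rightarrow> 'd \<Rightarrow> 'd \<Rightarrow> real ^ 't \<Rightarrow> real ^ 'd \<Rightarrow> real" where "d3 r s u y \<equiv> partial_deriv r (d2 s u y)"

lemma lf_diff: "y \<in> S \<Longrightarrow> \<theta> \<in> \<Theta> \<Longrightarrow> lf y differentiable (at \<theta>)"
  and d1_diff: "y \<in> S \<Longrightarrow> \<theta> \<in> \<Theta> \<Longrightarrow> d1 u y differentiable (at \<theta>)"
  and d2_diff: "y \<in> S \<Longrightarrow> \<theta> \<in> \<Theta> \<Longrightarrow> d2 s u y differentiable (at \<theta>)"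
  and d3_cont: "y \<in> S \<Longrightarrow> continuous_on \<Theta> (d3 r s u y)"
  using lf_smooth[of y] by (auto simp: numeral_3_eq_3)

text \<open>Each identity is proved on all of the open set \<open>\<Theta>\<close>, as a derivative
  depends on values nearby. The size \<open>k\<close> is arbitrary, since smoothness is known for
  single observations.\<close>

lemma loglik_partials:
  assumes x: "\<And>i. i < k \<Longrightarrow> x i \<in> S" and \<theta>: "\<theta> \<in> \<Theta>"
  shows "partial_deriv u (loglik f k x) \<theta> = (\<Sum>i<k. d1 u (x i) \<theta>)"
    and "partial_deriv s (partial_deriv u (loglik f k x)) \<theta> = (\<Sum>i<k. d2 s u (x i) \<theta>)"
    and "partial_deriv r (partial_deriv s (partial_deriv u (loglik f k x))) \<theta> = (\<Sum>i<k. d3 r s u (x i) \<theta>)"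
proof -
  have 1: "partial_deriv u (loglik f k x) \<theta> = (\<Sum>i<k. d1 u (x i) \<theta>)" if "\<theta> \<in> \<Theta>" for \<theta>
    unfolding loglik_eq using x that by (intro partial_deriv_sum lf_diff) auto
  have 2: "partial_deriv s (partial_deriv u (loglik f k x)) \<theta> = (\<Sum>i<k. d2 s u (x i) \<theta>)" if "\<theta> \<in> \<Theta>" for \<theta>
  proof -
    have "partial_deriv s (partial_deriv u (loglik f k x)) \<theta> = partial_deriv s (\<lambda>\<theta>. \<Sum>i<k. d1 u (x i) \<theta>) \<theta>"
      using 1 by (intro partial_deriv_cong[OF open_\<Theta> that])
    also have "\<dots> = (\<Sum>i<k. d2 s u (x i) \<theta>)"
      using x that by (intro partial_deriv_sum d1_diff) auto
    finally show ?thesis .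
  qed
  have 3: "partial_deriv r (partial_deriv s (partial_deriv u (loglik f k x))) \<theta> = (\<Sum>i<k. d3 r s u (x i) \<theta>)"
  proof -
    have "partial_deriv r (partial_deriv s (partial_deriv u (loglik f k x))) \<theta> = partial_deriv r (\<lambda>\<theta>. \<Sum>i<k. d2 s u (x i) \<theta>) \<theta>"
      using 2 by (intro partial_deriv_cong[OF open_\<Theta> \<theta>])
    also have "\<dots> = (\<Sum>i<k. d3 r s u (x i) \<theta>)"
      using x \<theta> by (intro partial_deriv_sum d2_diff) auto
    finally show ?thesis .
  qed
  show "partial_deriv u (loglik f k x) \<theta> = (\<Sum>i<k. d1 u (x i) \<theta>)" by (rule 1[OF \<theta>])
  show "partial_deriv s (partial_deriv u (loglik f k x)) \<theta> = (\<Sum>i<k. d2 s u (x i) \<theta>)" by (rule 2[OF \<theta>])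
  show "partial_deriv r (partial_deriv s (partial_deriv u (loglik f k x))) \<theta> = (\<Sum>i<k. d3 r s u (x i) \<theta>)" by (rule 3)
qed

abbreviation score :: "'d \<Rightarrow> real ^ 't \<Rightarrow> real" where "score r y \<equiv> d1 r y \<theta>\<^sub>0"

abbreviation info :: "real ^ 'd ^ 'd" where "info \<equiv> fisher_info \<nu> f \<theta>\<^sub>0"

lemma score_integrable: "integrable L (score r)" and score_mean: "(\<integral>y. score r y \<partial>L) = 0"
  and score_mult_integrable: "integrable L (\<lambda>y. score r y * score s y)"
  and score_cov: "(\<integral>y. score r y * score s y \<partial>L) = info $ r $ s"
  and info_pos_def: "pos_def info"
proof -
  have *: "(\<lambda>\<theta>'. ln (f x \<theta>')) = lf x" for x by (auto simp: lf_def)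
  show "integrable L (score r)" "(\<integral>y. score r y \<partial>L) = 0"
    using regular true_param unfolding regularity_conditions_def RC4_def * by blast+
  show "integrable L (\<lambda>y. score r y * score s y)" "pos_def info"
    using regular true_param unfolding regularity_conditions_def RC5_def * by blast+
  show "(\<integral>y. score r y * score s y \<partial>L) = info $ r $ s"
    unfolding fisher_info_def * by simp
qed

lemma frozen_sample_support:
  assumes "x' \<in> {1..<n} \<rightarrow>\<^sub>E S" "y \<in> S"
  shows "x'(0 := y) \<in> sample_support f \<Theta> n" "i < n \<Longrightarrow> (x'(0 := y)) i \<in> S"
proof -
  have "(x'(0 := y)) i \<in> S" if "i < n" for i
    using assms that by (cases "i = 0") (auto simp: PiE_iff)
  moreover have "(x'(0 := y)) i = undefined" if "i \<notin> {..<n}" for i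
    using assms that n_pos by (auto simp: PiE_iff extensional_def)
  ultimately show "x'(0 := y) \<in> sample_support f \<Theta> n" "i < n \<Longrightarrow> (x'(0 := y)) i \<in> S"
    unfolding sample_support_eq by (blast intro: PiE_I)+
qed

lemma sum_frozen:
  fixes a :: "real ^ 't \<Rightarrow> real"
  shows "(\<Sum>i<n. a ((x'(0 := y)) i)) = a y + (\<Sum>i\<in>{1..<n}. a (x' i))"
proof -
  have "{..<n} = insert 0 {1..<n}" using n_pos by auto
  then have "(\<Sum>i<n. a ((x'(0 := y)) i)) = a y + (\<Sum>i\<in>{1..<n}. a ((x'(0 := y)) i))"
    by simp
  also have "(\<Sum>i\<in>{1..<n}. a ((x'(0 := y)) i)) = (\<Sum>i\<in>{1..<n}. a (x' i))"
    by (intro sum.cong) auto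
  finally show ?thesis .
qed

lemma AE_sample_S:
  fixes k :: nat
  shows "AE x in Pi\<^sub>M {..<k} (\<lambda>_. L). \<forall>i<k. x i \<in> S"
proof -
  have "AE x in Pi\<^sub>M {..<k} (\<lambda>_. L). \<forall>i\<in>{..<k}. x i \<in> S"
    using AE_S by (intro AE_finite_allI AE_PiM_component prob_L) auto
  then show ?thesis by auto
qed

text \<open>The cut-off to the support makes the second derivatives measurable in the observation.\<close>

definition hess :: "'d \<Rightarrow> 'd \<Rightarrow> real ^ 't \<Rightarrow> real" where
  "hess r s y = indicator S y * d2 r s y \<theta>\<^sub>0"

text \<open>With the other observations frozen, the second derivative of the log-likelihood is that
  of one observation plus a constant, which gives integrability. The mean then follows from the
  information identity at size \<open>n\<close>, as all \<open>n\<close> coordinates have law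
  \<open>L\<close>.\<close>

lemma hess_integrable: "integrable L (hess r s)" and hess_mean: "(\<integral>y. hess r s y \<partial>L) = - info $ r $ s"
proof -
  define \<phi> where "\<phi> x = - partial_deriv r (partial_deriv s (loglik f n x)) \<theta>\<^sub>0" for x
  have \<phi>_int: "integrable (Pi\<^sub>M {..<n} (\<lambda>_. L)) \<phi>"
    and \<phi>_mean: "real n * info $ r $ s = (\<integral>x. \<phi> x \<partial>Pi\<^sub>M {..<n} (\<lambda>_. L))"
    using regular true_param unfolding regularity_conditions_def RC5_def sample_law_eq[symmetric] \<phi>_def
    by blast+
  have \<phi>: "\<phi> x = - (\<Sum>i<n. hess r s (x i))" if "\<And>i. i < n \<Longrightarrow> x i \<in> S" for x
    using loglik_partials(2)[of n x \<theta>\<^sub>0, OF that true_param] that by (simp add: \<phi>_def hess_def)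
  obtain x' where x': "x' \<in> {1..<n} \<rightarrow>\<^sub>E S" "integrable L (\<lambda>y. \<phi> (x'(0 := y)))"
    using L.integrable_freeze_other_coordinates[OF \<phi>_int n_pos AE_S] by blast
  define c where "c = (\<Sum>i\<in>{1..<n}. hess r s (x' i))"
  have hess_eq: "hess r s y = indicator S y * (- \<phi> (x'(0 := y)) - c)" for y
  proof (cases "y \<in> S")
    case True
    then show ?thesis
      using \<phi>[of "x'(0 := y)", OF frozen_sample_support(2)[OF x'(1) True]]
      unfolding sum_frozen c_def[symmetric] by simp
  qed (simp add: hess_def)
  have "integrable L (\<lambda>y. indicator S y * (- \<phi> (x'(0 := y)) - c))"
    using x'(2) by (intro integrable_real_mult_indicator[of S L, simplified mult.commute[of _ "indicator S _"]]) auto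
  then show int: "integrable L (hess r s)" unfolding hess_eq[abs_def] .
  then have [measurable]: "hess r s \<in> borel_measurable L" by simp
  have int_i: "integrable (Pi\<^sub>M {..<n} (\<lambda>_. L)) (\<lambda>x. hess r s (x i))"
      "(\<integral>x. hess r s (x i) \<partial>Pi\<^sub>M {..<n} (\<lambda>_. L)) = (\<integral>y. hess r s y \<partial>L)" if "i < n" for i
  proof -
    have d: "distr (Pi\<^sub>M {..<n} (\<lambda>_. L)) L (\<lambda>x. x i) = L"
      using that prob_L by (intro distr_PiM_component) auto
    have m: "(\<lambda>x. x i) \<in> measurable (Pi\<^sub>M {..<n} (\<lambda>_. L)) L"
      using that by (intro measurable_component_singleton) auto
    show "integrable (Pi\<^sub>M {..<n} (\<lambda>_. L)) (\<lambda>x. hess r s (x i))"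
        "(\<integral>x. hess r s (x i) \<partial>Pi\<^sub>M {..<n} (\<lambda>_. L)) = (\<integral>y. hess r s y \<partial>L)"
      using integrable_distr_eq[OF m, of "hess r s"] integral_distr[OF m, of "hess r s"] int by (auto simp: d)
  qed
  have "real n * info $ r $ s = (\<integral>x. - (\<Sum>i<n. hess r s (x i)) \<partial>Pi\<^sub>M {..<n} (\<lambda>_. L))"
    unfolding \<phi>_mean
  proof (rule integral_cong_AE)
    show "AE x in Pi\<^sub>M {..<n} (\<lambda>_. L). \<phi> x = - (\<Sum>i<n. hess r s (x i))"
      using AE_sample_S[of n] by eventually_elim (rule \<phi>, auto)
    show "\<phi> \<in> borel_measurable (Pi\<^sub>M {..<n} (\<lambda>_. L))" using \<phi>_int by simp
    show "(\<lambda>x. - (\<Sum>i<n. hess r s (x i))) \<in> borel_measurable (Pi\<^sub>M {..<n} (\<lambda>_. L))"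
      using int_i(1) by (intro borel_measurable_uminus borel_measurable_sum) auto
  qed
  also have "\<dots> = - (real n * (\<integral>y. hess r s y \<partial>L))"
    using int_i by (simp add: Bochner_Integration.integral_sum)
  finally have "real n * ((\<integral>y. hess r s y \<partial>L) + info $ r $ s) = 0"
    by (simp add: distrib_left)
  then show "(\<integral>y. hess r s y \<partial>L) = - info $ r $ s"
    using n_pos by (simp add: add_eq_0_iff2)
qed

lemma third_derivative_envelope:
  obtains \<rho> b where "\<rho> > 0" "cball \<theta>\<^sub>0 \<rho> \<subseteq> \<Theta>" "integrable L b"
    "\<And>r s u y \<theta>. y \<in> S \<Longrightarrow> \<theta> \<in> cball \<theta>\<^sub>0 \<rho> \<Longrightarrow> \<bar>d3 r s u y \<theta>\<bar> \<le> b y"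
proof -
  obtain \<epsilon> and B :: "'d \<Rightarrow> 'd \<Rightarrow> 'd \<Rightarrow> (nat \<Rightarrow> real ^ 't) \<Rightarrow> real" where \<epsilon>: "\<epsilon> > 0"
    and B_int: "\<And>r s u. integrable (Pi\<^sub>M {..<n} (\<lambda>_. L)) (B r s u)"
    and B: "\<And>r s u x \<theta>. x \<in> sample_support f \<Theta> n \<Longrightarrow> \<theta> \<in> \<Theta> \<Longrightarrow> (\<forall>j. \<bar>\<theta> $ j - \<theta>\<^sub>0 $ j\<bar> < \<epsilon>) \<Longrightarrow>
      \<bar>partial_deriv r (partial_deriv s (partial_deriv u (loglik f n x))) \<theta>\<bar> \<le> B r s u x"
    using regular true_param unfolding regularity_conditions_def RC3_def sample_law_eq[symmetric] by metis
  obtain e where e: "e > 0" "cball \<theta>\<^sub>0 e \<subseteq> \<Theta>"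
    using open_\<Theta> true_param by (auto simp: open_contains_cball)
  \<comment> \<open>Half of \<open>\<epsilon>\<close> because the ball is closed while the cube of
    the envelope condition is open.\<close>
  define \<rho> where "\<rho> = min e (\<epsilon> / 2)"
  have \<rho>: "\<rho> > 0" "cball \<theta>\<^sub>0 \<rho> \<subseteq> \<Theta>" using e \<epsilon> by (auto simp: \<rho>_def)
  have near: "\<bar>\<theta> $ j - \<theta>\<^sub>0 $ j\<bar> < \<epsilon>" if "\<theta> \<in> cball \<theta>\<^sub>0 \<rho>" for \<theta> j
  proof -
    have "\<bar>\<theta> $ j - \<theta>\<^sub>0 $ j\<bar> \<le> norm (\<theta> - \<theta>\<^sub>0)" using component_le_norm_cart[of "\<theta> - \<theta>\<^sub>0" j] by simp
    also have "\<dots> \<le> \<epsilon> / 2" using that by (simp add: \<rho>_def dist_norm norm_minus_commute)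
    finally show ?thesis using \<epsilon> by simp
  qed
  have "\<exists>b. integrable L b \<and> (\<forall>y\<in>S. \<forall>\<theta>\<in>cball \<theta>\<^sub>0 \<rho>. \<bar>d3 r s u y \<theta>\<bar> \<le> b y)" for r s u
  proof -
    obtain x' where x': "x' \<in> {1..<n} \<rightarrow>\<^sub>E S" "integrable L (\<lambda>y. B r s u (x'(0 := y)))"
      using L.integrable_freeze_other_coordinates[OF B_int n_pos AE_S] by blast
    have "continuous_on (cball \<theta>\<^sub>0 \<rho>) (\<lambda>\<theta>. \<Sum>i\<in>{1..<n}. d3 r s u (x' i) \<theta>)"
      using x'(1) \<rho>(2) by (intro continuous_on_sum continuous_on_subset[OF d3_cont]) auto
    then have "bounded ((\<lambda>\<theta>. \<Sum>i\<in>{1..<n}. d3 r s u (x' i) \<theta>) ` cball \<theta>\<^sub>0 \<rho>)"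
      by (intro compact_imp_bounded compact_continuous_image) auto
    then obtain c where "\<And>v. v \<in> (\<lambda>\<theta>. \<Sum>i\<in>{1..<n}. d3 r s u (x' i) \<theta>) ` cball \<theta>\<^sub>0 \<rho> \<Longrightarrow> \<bar>v\<bar> \<le> c"
      unfolding bounded_iff real_norm_def by blast
    then have c: "\<bar>\<Sum>i\<in>{1..<n}. d3 r s u (x' i) \<theta>\<bar> \<le> c" if "\<theta> \<in> cball \<theta>\<^sub>0 \<rho>" for \<theta>
      using that by blast
    have "\<bar>d3 r s u y \<theta>\<bar> \<le> B r s u (x'(0 := y)) + c" if y: "y \<in> S" and \<theta>: "\<theta> \<in> cball \<theta>\<^sub>0 \<rho>" for y \<theta>
    proof -
      have "\<theta> \<in> \<Theta>" using \<theta> \<rho>(2) by blast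
      then have "\<bar>\<Sum>i<n. d3 r s u ((x'(0 := y)) i) \<theta>\<bar> \<le> B r s u (x'(0 := y))"
        using B[OF frozen_sample_support(1)[OF x'(1) y] \<open>\<theta> \<in> \<Theta>\<close>] near[OF \<theta>]
          loglik_partials(3)[OF frozen_sample_support(2)[OF x'(1) y] \<open>\<theta> \<in> \<Theta>\<close>] by simp
      then have "\<bar>d3 r s u y \<theta> + (\<Sum>i\<in>{1..<n}. d3 r s u (x' i) \<theta>)\<bar> \<le> B r s u (x'(0 := y))"
        by (simp only: sum_frozen[of "\<lambda>y. d3 r s u y \<theta>"])
      then show ?thesis using c[OF \<theta>] by linarith
    qed
    then show ?thesis
      using x'(2) by (intro exI[of _ "\<lambda>y. B r s u (x'(0 := y)) + c"]) auto
  qed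
  then obtain b where b: "\<And>r s u. integrable L (b r s u)"
    "\<And>r s u y \<theta>. y \<in> S \<Longrightarrow> \<theta> \<in> cball \<theta>\<^sub>0 \<rho> \<Longrightarrow> \<bar>d3 r s u y \<theta>\<bar> \<le> b r s u y" by metis
  have le: "\<bar>d3 r s u y \<theta>\<bar> \<le> (\<Sum>r\<in>UNIV. \<Sum>s\<in>UNIV. \<Sum>u\<in>UNIV. \<bar>b r s u y\<bar>)"
    if "y \<in> S" "\<theta> \<in> cball \<theta>\<^sub>0 \<rho>" for r s u y \<theta>
  proof -
    have "\<bar>d3 r s u y \<theta>\<bar> \<le> \<bar>b r s u y\<bar>" using b(2)[OF that, of r s u] by linarith
    also have "\<dots> \<le> (\<Sum>u\<in>UNIV. \<bar>b r s u y\<bar>)" by (intro member_le_sum) auto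
    also have "\<dots> \<le> (\<Sum>s\<in>UNIV. \<Sum>u\<in>UNIV. \<bar>b r s u y\<bar>)"
      by (intro member_le_sum[where f="\<lambda>s. \<Sum>u\<in>UNIV. \<bar>b r s u y\<bar>"]) (auto intro: sum_nonneg)
    also have "\<dots> \<le> (\<Sum>r\<in>UNIV. \<Sum>s\<in>UNIV. \<Sum>u\<in>UNIV. \<bar>b r s u y\<bar>)"
      by (intro member_le_sum[where f="\<lambda>r. \<Sum>s\<in>UNIV. \<Sum>u\<in>UNIV. \<bar>b r s u y\<bar>"]) (auto intro!: sum_nonneg)
    finally show ?thesis .
  qed
  have "integrable L (\<lambda>y. \<Sum>r\<in>UNIV. \<Sum>s\<in>UNIV. \<Sum>u\<in>UNIV. \<bar>b r s u y\<bar>)"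
    using b(1) by (intro Bochner_Integration.integrable_sum integrable_abs)
  then show ?thesis using that[OF \<rho>, of "\<lambda>y. \<Sum>r\<in>UNIV. \<Sum>s\<in>UNIV. \<Sum>u\<in>UNIV. \<bar>b r s u y\<bar>"] le by blast
qed

end

section \<open>Asymptotics of the maximum likelihood estimator\<close>

text \<open>Second partial derivatives are merely assumed to exist and to be bounded along the
  segment, so a mean value estimate for \<open>\<psi>'\<close> replaces the integral remainder. The
  lemma serves both the score equation and \<open>q\<close>.\<close>

lemma taylor_second_order_bound:
  fixes F :: "real ^ 'd::finite \<Rightarrow> real"
  assumes seg: "\<And>t. 0 \<le> t \<Longrightarrow> t \<le> 1 \<Longrightarrow> x + t *\<^sub>R v \<in> T"
    and diff: "\<And>y. y \<in> T \<Longrightarrow> F differentiable (at y)"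
    and diff2: "\<And>l y. y \<in> T \<Longrightarrow> partial_deriv l F differentiable (at y)"
    and bound: "\<And>m l t. 0 \<le> t \<Longrightarrow> t \<le> 1 \<Longrightarrow> \<bar>partial_deriv m (partial_deriv l F) (x + t *\<^sub>R v)\<bar> \<le> b m l"
  shows "\<bar>F (x + v) - F x - (\<Sum>l\<in>UNIV. v $ l * partial_deriv l F x)\<bar>
    \<le> (\<Sum>m\<in>UNIV. \<Sum>l\<in>UNIV. \<bar>v $ m\<bar> * \<bar>v $ l\<bar> * b m l) / 2"
proof -
  define B where "B = (\<Sum>m\<in>UNIV. \<Sum>l\<in>UNIV. \<bar>v $ m\<bar> * \<bar>v $ l\<bar> * b m l)"
  define \<psi>' where "\<psi>' t = (\<Sum>l\<in>UNIV. v $ l * partial_deriv l F (x + t *\<^sub>R v))" for t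
  define \<psi>'' where "\<psi>'' t = (\<Sum>l\<in>UNIV. v $ l * (\<Sum>m\<in>UNIV. v $ m * partial_deriv m (partial_deriv l F) (x + t *\<^sub>R v)))" for t
  have "\<bar>F (x + 1 *\<^sub>R v) - F (x + 0 *\<^sub>R v) - \<psi>' 0\<bar> \<le> B / 2"
  proof (rule taylor_remainder_lipschitz_derivative)
    fix t :: real assume t: "0 \<le> t" "t \<le> 1"
    show "((\<lambda>t. F (x + t *\<^sub>R v)) has_real_derivative \<psi>' t) (at t)"
      unfolding \<psi>'_def by (rule has_real_derivative_along_line[OF diff[OF seg[OF t]]])
    have "norm (\<psi>' t - \<psi>' 0) \<le> B * norm (t - 0)"
    proof (rule field_differentiable_bound[where S="{0..t}" and f'=\<psi>''])
      fix s assume "s \<in> {0..t}"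
      then have s: "0 \<le> s" "s \<le> 1" using t by auto
      show "(\<psi>' has_field_derivative \<psi>'' s) (at s within {0..t})"
        unfolding \<psi>'_def[abs_def] \<psi>''_def
        by (intro has_field_derivative_at_within[OF DERIV_sum] DERIV_cmult
            has_real_derivative_along_line diff2 seg s)
      have "\<bar>\<psi>'' s\<bar> \<le> (\<Sum>l\<in>UNIV. \<Sum>m\<in>UNIV. \<bar>v $ m\<bar> * \<bar>v $ l\<bar> * b m l)"
        unfolding \<psi>''_def sum_distrib_left
      proof (intro order_trans[OF sum_abs] sum_mono)
        fix l m
        have "\<bar>v $ m\<bar> * \<bar>v $ l\<bar> * \<bar>partial_deriv m (partial_deriv l F) (x + s *\<^sub>R v)\<bar> \<le> \<bar>v $ m\<bar> * \<bar>v $ l\<bar> * b m l"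
          by (intro mult_left_mono bound s) auto
        then show "\<bar>v $ l * (v $ m * partial_deriv m (partial_deriv l F) (x + s *\<^sub>R v))\<bar> \<le> \<bar>v $ m\<bar> * \<bar>v $ l\<bar> * b m l"
          by (simp add: abs_mult mult_ac)
      qed
      also have "\<dots> = B" unfolding B_def by (rule sum.swap)
      finally show "norm (\<psi>'' s) \<le> B" by simp
    qed (use t in auto)
    then show "\<bar>\<psi>' t - \<psi>' 0\<bar> \<le> B * t" using t by simp
  qed
  then show ?thesis by (simp add: \<psi>'_def B_def)
qed

text \<open>For products of a tight and a vanishing factor: at a given \<open>\<eta>\<close> the
  tight factor exceeds its level on a set \<open>A k\<close> of measure at most
  \<open>\<eta>\<close> that need not shrink as \<open>k\<close> grows, and the rest is
  vanishing.\<close>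

lemma (in prob_space) vanishing_up_to_tight:
  assumes "\<And>\<eta>. 0 < \<eta> \<Longrightarrow> \<exists>A V. vanishing M V \<and> (\<forall>\<^sub>F k in sequentially.
      A k \<in> sets M \<and> measure M (A k) \<le> \<eta> \<and> B k \<inter> space M \<subseteq> A k \<union> V k)"
  shows "vanishing M B"
  unfolding vanishing_def
proof (intro allI impI)
  fix \<eta> :: real assume "\<eta> > 0"
  then have pos: "\<eta> / 2 > 0" by simp
  from assms[OF pos] obtain A V where V: "vanishing M V"
    and A: "\<forall>\<^sub>F k in sequentially. A k \<in> sets M \<and> measure M (A k) \<le> \<eta> / 2 \<and> B k \<inter> space M \<subseteq> A k \<union> V k"
    by blast
  from A vanishingD[OF V pos]
  show "\<forall>\<^sub>F k in sequentially. \<exists>C\<in>sets M. B k \<inter> space M \<subseteq> C \<and> measure M C \<le> \<eta>"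
  proof eventually_elim
    case (elim k)
    then obtain V' where V': "V' \<in> sets M" "V k \<inter> space M \<subseteq> V'" "measure M V' \<le> \<eta> / 2" by blast
    have "measure M (A k \<union> V') \<le> measure M (A k) + measure M V'"
      using elim V' by (intro measure_Un_le) auto
    then show ?case using elim V' by (intro bexI[of _ "A k \<union> V'"]) auto
  qed
qed

lemma norm_matrix_vector_le:
  fixes A :: "real ^ 'd ^ 'e"
  obtains c where "c > 0" "\<And>v. norm (A *v v) \<le> c * norm v"
  using linear_bounded_pos[of "(*v) A"] by auto

text \<open>The error in the second hypothesis is absorbed: it contributes at most half of \<open>\<Delta>\<close>, so \<open>\<Delta>\<close> is
  bounded by a multiple of \<open>U\<close>.\<close>

lemma delta_method_deterministic:
  fixes I J :: "real ^ 'd ^ 'd::finite" and q :: "real ^ 'd \<Rightarrow> real ^ 'd"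
  assumes inv: "invertible I" and q: "(q has_derivative (\<lambda>v. J *v v)) (at \<theta>)" and \<tau>: "\<tau> > 0"
  obtains \<eta> where "\<eta> > 0"
    "\<And>\<Delta> U. norm \<Delta> < \<eta> \<Longrightarrow> (\<And>r. \<bar>(I *v \<Delta>) $ r - U $ r\<bar> \<le> \<eta> * norm \<Delta>) \<Longrightarrow>
       norm (q (\<theta> + \<Delta>) - q \<theta> - J *v (matrix_inv I *v U)) \<le> \<tau> * norm U"
proof -
  obtain c where c: "c > 0" "\<And>v. norm (matrix_inv I *v v) \<le> c * norm v"
    using norm_matrix_vector_le by blast
  obtain a where a: "a > 0" "\<And>v. norm (J *v v) \<le> a * norm v"
    using norm_matrix_vector_le by blast
  define d where "d = real CARD('d)"
  have d: "d > 0" by (simp add: d_def)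
  define e where "e = \<tau> / (4 * c)"
  have e: "e > 0" using \<tau> c by (simp add: e_def)
  obtain \<delta> where \<delta>: "\<delta> > 0" "\<And>y. norm (y - \<theta>) < \<delta> \<Longrightarrow> norm (q y - q \<theta> - J *v (y - \<theta>)) \<le> e * norm (y - \<theta>)"
    using q e unfolding has_derivative_at_alt by blast
  \<comment> \<open>The second entry gives the factor \<open>1 / 2\<close> by which the error in
    \<open>\<Delta>\<close> is absorbed, the third makes this error, after \<open>J\<close>, at most
    \<open>e * norm \<Delta>\<close>. Together with the differentiability error this is
    \<open>2 * e * norm \<Delta>\<close>, and \<open>norm \<Delta> \<le> 2 * c * norm U\<close>
    explains \<open>e = \<tau> / (4 * c)\<close>.\<close>
  define \<eta> where "\<eta> = min \<delta> (min (1 / (2 * c * d)) (e / (a * c * d)))"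
  have \<eta>: "\<eta> > 0" "\<eta> \<le> \<delta>" "c * (d * \<eta>) \<le> 1 / 2" "a * (c * (d * \<eta>)) \<le> e"
  proof -
    show "\<eta> > 0" using \<delta> c d a e by (auto simp: \<eta>_def)
    show "\<eta> \<le> \<delta>" by (simp add: \<eta>_def)
    have "\<eta> \<le> 1 / (2 * c * d)" "\<eta> \<le> e / (a * c * d)" by (auto simp: \<eta>_def)
    then show "c * (d * \<eta>) \<le> 1 / 2" "a * (c * (d * \<eta>)) \<le> e"
      using c a d by (auto simp: field_simps)
  qed
  show ?thesis
  proof (rule that[OF \<eta>(1)])
    fix \<Delta> U :: "real ^ 'd" assume \<Delta>: "norm \<Delta> < \<eta>" and close: "\<And>r. \<bar>(I *v \<Delta>) $ r - U $ r\<bar> \<le> \<eta> * norm \<Delta>"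
    define v where "v = I *v \<Delta> - U"
    have "norm v \<le> (\<Sum>r\<in>UNIV. \<bar>v $ r\<bar>)" by (rule norm_le_l1_cart)
    also have "\<dots> \<le> (\<Sum>r\<in>(UNIV :: 'd set). \<eta> * norm \<Delta>)" using close by (intro sum_mono) (simp add: v_def)
    also have "\<dots> = d * \<eta> * norm \<Delta>" by (simp add: d_def)
    finally have v: "norm v \<le> d * \<eta> * norm \<Delta>" .
    have "matrix_inv I *v (I *v \<Delta>) = \<Delta>"
      using matrix_inv_mult[OF inv] by (simp add: matrix_vector_mul_assoc)
    then have \<Delta>_eq: "\<Delta> = matrix_inv I *v U + matrix_inv I *v v"
      by (simp add: v_def matrix_vector_mult_diff_distrib)
    have cv: "norm (matrix_inv I *v v) \<le> c * (d * \<eta>) * norm \<Delta>"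
      using order_trans[OF c(2) mult_left_mono[OF v]] c(1) by (simp add: mult.assoc)
    have "norm \<Delta> \<le> norm (matrix_inv I *v U) + norm (matrix_inv I *v v)"
      by (subst \<Delta>_eq) (rule norm_triangle_ineq)
    also have "\<dots> \<le> c * norm U + 1 / 2 * norm \<Delta>"
      using c(2)[of U] cv mult_right_mono[OF \<eta>(3) norm_ge_zero[of \<Delta>]] by linarith
    finally have \<Delta>_le: "norm \<Delta> \<le> 2 * c * norm U" by simp
    have "q (\<theta> + \<Delta>) - q \<theta> - J *v (matrix_inv I *v U)
        = (q (\<theta> + \<Delta>) - q \<theta> - J *v \<Delta>) + J *v (matrix_inv I *v v)"
    proof -
      have "J *v \<Delta> = J *v (matrix_inv I *v U) + J *v (matrix_inv I *v v)"
        by (subst \<Delta>_eq) (simp add: matrix_vector_right_distrib)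
      then show ?thesis by simp
    qed
    then have "norm (q (\<theta> + \<Delta>) - q \<theta> - J *v (matrix_inv I *v U))
        \<le> norm (q (\<theta> + \<Delta>) - q \<theta> - J *v \<Delta>) + norm (J *v (matrix_inv I *v v))"
      by (metis norm_triangle_ineq)
    also have "\<dots> \<le> e * norm \<Delta> + a * (c * (d * \<eta>) * norm \<Delta>)"
      using \<delta>(2)[of "\<theta> + \<Delta>"] \<Delta> \<eta>(2) order_trans[OF a(2) mult_left_mono[OF cv]] a(1)
      by (intro add_mono) auto
    also have "\<dots> \<le> e * norm \<Delta> + e * norm \<Delta>"
      using mult_right_mono[OF \<eta>(4) norm_ge_zero[of \<Delta>]] by (simp add: mult.assoc)
    also have "\<dots> \<le> 2 * e * (2 * c * norm U)"
      using mult_left_mono[OF \<Delta>_le, of "2 * e"] e by simp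
    also have "\<dots> = \<tau> * norm U" using c(1) by (simp add: e_def)
    finally show "norm (q (\<theta> + \<Delta>) - q \<theta> - J *v (matrix_inv I *v U)) \<le> \<tau> * norm U" .
  qed
qed

context mle_model
begin

lemma restrict_meas: "(\<lambda>\<omega>. restrict \<omega> {..<k}) \<in> measurable PP (Pi\<^sub>M {..<k} (\<lambda>_. L))"
  unfolding PP_def by measurable

lemma distr_restrict: "distr PP (Pi\<^sub>M {..<k} (\<lambda>_. L)) (\<lambda>\<omega>. restrict \<omega> {..<k}) = sample_law \<nu> f k \<theta>\<^sub>0"
proof -
  interpret product_prob_space "\<lambda>_. L" UNIV
    by unfold_locales
  show ?thesis unfolding PP_def sample_law_eq
    by (rule distr_PiM_restrict_finite) auto
qed

lemma AE_restrict:
  assumes "AE x in sample_law \<nu> f k \<theta>\<^sub>0. Q x"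
  shows "AE \<omega> in PP. Q (restrict \<omega> {..<k})"
proof (rule AE_distrD[OF restrict_meas])
  show "AE x in distr PP (Pi\<^sub>M {..<k} (\<lambda>_. L)) (\<lambda>\<omega>. restrict \<omega> {..<k}). Q x"
    unfolding distr_restrict by (rule assms)
qed

text \<open>\<open>\<Theta>\<close> is open, so the maximizer is interior and the derivative along
  each axis vanishes there.\<close>

lemma score_equation:
  assumes x: "\<And>i. i < k \<Longrightarrow> x i \<in> S" and mle: "is_unique_mle f \<Theta> k x \<theta>'"
  shows "(\<Sum>i<k. d1 r (x i) \<theta>') = 0"
proof -
  have \<theta>': "\<theta>' \<in> \<Theta>" and max: "\<And>\<theta>. \<theta> \<in> \<Theta> \<Longrightarrow> loglik f k x \<theta> \<le> loglik f k x \<theta>'"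
    using mle unfolding is_unique_mle_def by (blast, metis less_imp_le order_refl)
  obtain e where e: "e > 0" "ball \<theta>' e \<subseteq> \<Theta>" using open_\<Theta> \<theta>' by (auto simp: open_contains_ball)
  have "loglik f k x differentiable (at \<theta>')"
    unfolding loglik_eq by (rule differentiable_sum) (use x \<theta>' lf_diff in auto)
  then have der: "((\<lambda>t. loglik f k x (\<theta>' + t *\<^sub>R axis r 1)) has_real_derivative
      (\<Sum>i\<in>UNIV. axis r 1 $ i * partial_deriv i (loglik f k x) (\<theta>' + 0 *\<^sub>R axis r 1))) (at 0)"
    by (intro has_real_derivative_along_line) simp
  have "(\<Sum>i\<in>UNIV. axis r 1 $ i * partial_deriv i (loglik f k x) (\<theta>' + 0 *\<^sub>R axis r 1)) = 0"
  proof (rule DERIV_local_max[OF der e(1)], intro allI impI)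
    fix t :: real assume "\<bar>0 - t\<bar> < e"
    then have "\<theta>' + t *\<^sub>R axis r 1 \<in> \<Theta>"
      using e(2) by (auto simp: dist_norm subset_iff)
    then show "loglik f k x (\<theta>' + t *\<^sub>R axis r 1) \<le> loglik f k x (\<theta>' + 0 *\<^sub>R axis r 1)"
      using max by simp
  qed
  then have "partial_deriv r (loglik f k x) \<theta>' = 0"
    by (subst (asm) sum.remove[of UNIV r]) (auto simp: axis_def)
  then show ?thesis using loglik_partials(1)[of k x \<theta>' r, OF x \<theta>'] by simp
qed

text \<open>Taylor expansion of one component of the score around \<open>\<theta>\<^sub>0\<close>,
  evaluated at the estimator, where the score vanishes. The remainder is controlled by the
  integrable envelope summed over the sample.\<close>

lemma score_expansion:
  assumes x: "\<And>i. i < k \<Longrightarrow> x i \<in> S" and mle: "is_unique_mle f \<Theta> k x (\<theta>\<^sub>0 + v)"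
    and \<rho>: "cball \<theta>\<^sub>0 \<rho> \<subseteq> \<Theta>" "norm v \<le> \<rho>"
    and b: "\<And>r s u y \<theta>. y \<in> S \<Longrightarrow> \<theta> \<in> cball \<theta>\<^sub>0 \<rho> \<Longrightarrow> \<bar>d3 r s u y \<theta>\<bar> \<le> b y"
  shows "\<bar>(\<Sum>i<k. score r (x i)) + (\<Sum>s\<in>UNIV. v $ s * (\<Sum>i<k. hess s r (x i)))\<bar>
    \<le> (\<Sum>s\<in>UNIV. \<bar>v $ s\<bar>)\<^sup>2 * (\<Sum>i<k. b (x i)) / 2"
proof -
  define F where "F = partial_deriv r (loglik f k x)"
  have seg: "\<theta>\<^sub>0 + t *\<^sub>R v \<in> cball \<theta>\<^sub>0 \<rho>" if "0 \<le> t" "t \<le> 1" for t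
  proof -
    have "norm (t *\<^sub>R v) \<le> norm v" using that by (simp add: mult_left_le_one_le)
    then show ?thesis using \<rho>(2) by (simp add: dist_norm)
  qed
  have F_eq: "F y = (\<Sum>i<k. d1 r (x i) y)" if "y \<in> \<Theta>" for y
    unfolding F_def using loglik_partials(1)[of k x, OF x that] by simp
  have F2_eq: "partial_deriv l F y = (\<Sum>i<k. d2 l r (x i) y)" if "y \<in> \<Theta>" for l y
    unfolding F_def using loglik_partials(2)[of k x, OF x that] by simp
  have "\<bar>F (\<theta>\<^sub>0 + v) - F \<theta>\<^sub>0 - (\<Sum>l\<in>UNIV. v $ l * partial_deriv l F \<theta>\<^sub>0)\<bar>
      \<le> (\<Sum>m\<in>UNIV. \<Sum>l\<in>UNIV. \<bar>v $ m\<bar> * \<bar>v $ l\<bar> * (\<Sum>i<k. b (x i))) / 2"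
  proof (rule taylor_second_order_bound[where T=\<Theta>])
    show "\<theta>\<^sub>0 + t *\<^sub>R v \<in> \<Theta>" if "0 \<le> t" "t \<le> 1" for t using seg[OF that] \<rho>(1) by blast
    fix y assume y: "y \<in> \<Theta>"
    have "(\<lambda>y. \<Sum>i<k. d1 r (x i) y) differentiable (at y)"
      by (rule differentiable_sum) (use x y d1_diff in auto)
    then show "F differentiable (at y)"
      by (rule differentiable_cong_open[OF open_\<Theta> y, rotated]) (simp add: F_eq)
    have "(\<lambda>y. \<Sum>i<k. d2 l r (x i) y) differentiable (at y)" for l
      by (rule differentiable_sum) (use x y d2_diff in auto)
    then show "partial_deriv l F differentiable (at y)" for l
      by (rule differentiable_cong_open[OF open_\<Theta> y, rotated]) (simp add: F2_eq)
  next
    fix m l and t :: real assume t: "0 \<le> t" "t \<le> 1"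
    have "\<theta>\<^sub>0 + t *\<^sub>R v \<in> \<Theta>" using seg[OF t] \<rho>(1) by blast
    then have "partial_deriv m (partial_deriv l F) (\<theta>\<^sub>0 + t *\<^sub>R v) = (\<Sum>i<k. d3 m l r (x i) (\<theta>\<^sub>0 + t *\<^sub>R v))"
      unfolding F_def using loglik_partials(3)[of k x, OF x] by simp
    also have "\<bar>\<dots>\<bar> \<le> (\<Sum>i<k. b (x i))"
      using x seg[OF t] by (intro order_trans[OF sum_abs] sum_mono b) auto
    finally show "\<bar>partial_deriv m (partial_deriv l F) (\<theta>\<^sub>0 + t *\<^sub>R v)\<bar> \<le> (\<Sum>i<k. b (x i))" .
  qed
  moreover have "(\<Sum>m\<in>UNIV. \<Sum>l\<in>UNIV. \<bar>v $ m\<bar> * \<bar>v $ l\<bar> * c) = (\<Sum>s\<in>UNIV. \<bar>v $ s\<bar>)\<^sup>2 * c" for c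
    unfolding power2_eq_square sum_product by (simp only: sum_distrib_right)
  moreover have "F (\<theta>\<^sub>0 + v) = 0"
    using score_equation[of k x, OF x mle] F_eq[of "\<theta>\<^sub>0 + v"] mle by (simp add: is_unique_mle_def)
  moreover have "F \<theta>\<^sub>0 = (\<Sum>i<k. score r (x i))" by (rule F_eq[OF true_param])
  moreover have "partial_deriv l F \<theta>\<^sub>0 = (\<Sum>i<k. hess l r (x i))" for l
    unfolding F2_eq[OF true_param] using x by (intro sum.cong) (auto simp: hess_def)
  ultimately have "\<bar>0 - (\<Sum>i<k. score r (x i)) - (\<Sum>s\<in>UNIV. v $ s * (\<Sum>i<k. hess s r (x i)))\<bar>
    \<le> (\<Sum>s\<in>UNIV. \<bar>v $ s\<bar>)\<^sup>2 * (\<Sum>i<k. b (x i)) / 2"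
    by (simp only:)
  then show ?thesis by linarith
qed

end

lemma (in iid_sequence) square_integrable_add:
  fixes u v :: "'b \<Rightarrow> real"
  assumes [measurable]: "u \<in> borel_measurable L" "v \<in> borel_measurable L"
    and "integrable L (\<lambda>x. (u x)\<^sup>2)" "integrable L (\<lambda>x. (v x)\<^sup>2)"
  shows "integrable L (\<lambda>x. (u x + v x)\<^sup>2)"
proof (rule Bochner_Integration.integrable_bound)
  show "integrable L (\<lambda>x. 2 * (u x)\<^sup>2 + 2 * (v x)\<^sup>2)" using assms by auto
  have "(a + b)\<^sup>2 \<le> 2 * a\<^sup>2 + 2 * b\<^sup>2" for a b :: real
    using sum_squares_bound[of a b] by (simp add: power2_sum)
  then show "AE x in L. norm ((u x + v x)\<^sup>2) \<le> norm (2 * (u x)\<^sup>2 + 2 * (v x)\<^sup>2)"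
    by simp
qed measurable

lemma (in iid_sequence) square_integrable_sum:
  fixes u :: "'i \<Rightarrow> 'b \<Rightarrow> real"
  assumes "finite I" "\<And>i. i \<in> I \<Longrightarrow> u i \<in> borel_measurable L" "\<And>i. i \<in> I \<Longrightarrow> integrable L (\<lambda>x. (u i x)\<^sup>2)"
  shows "integrable L (\<lambda>x. (\<Sum>i\<in>I. u i x)\<^sup>2)"
  using assms
proof induction
  case (insert i I)
  then show ?case using square_integrable_add[of "u i" "\<lambda>x. \<Sum>i\<in>I. u i x"] by simp
qed simp

text \<open>The estimator and its identity with the averages of \<open>g\<close> are given at all
  sizes \<open>k \<ge> n\<close>, since the moments of \<open>g\<close> are identified by letting
  \<open>k\<close> grow.\<close>

locale consistent_mle = mle_model \<nu> f \<Theta> \<theta>\<^sub>0 n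
  for \<nu> :: "(real ^ 't::finite) measure" and f :: "real ^ 't \<Rightarrow> real ^ 'd::finite \<Rightarrow> real" and \<Theta> \<theta>\<^sub>0 n +
  fixes mle :: "nat \<Rightarrow> (nat \<Rightarrow> real ^ 't) \<Rightarrow> real ^ 'd" and q :: "real ^ 'd \<Rightarrow> real ^ 'd"
    and J :: "real ^ 'd ^ 'd" and g :: "real ^ 't \<Rightarrow> real ^ 'd"
  assumes mle_meas: "\<And>k. k \<ge> n \<Longrightarrow> mle k \<in> borel_measurable (sample_law \<nu> f k \<theta>\<^sub>0)"
    and mle: "\<And>k. k \<ge> n \<Longrightarrow> AE x in sample_law \<nu> f k \<theta>\<^sub>0. is_unique_mle f \<Theta> k x (mle k x)"
    and consistent: "consistent_at \<nu> f \<theta>\<^sub>0 mle"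
    and q_der: "(q has_derivative (\<lambda>v. J *v v)) (at \<theta>\<^sub>0)"
    and g_meas [measurable]: "g \<in> borel_measurable borel"
    and q_mle: "\<And>k. k \<ge> n \<Longrightarrow>
        AE x in sample_law \<nu> f k \<theta>\<^sub>0. q (mle k x) = (1 / real k) *\<^sub>R (\<Sum>i<k. g (x i))"
    and g_sq: "\<And>l. integrable L (\<lambda>x. (g x $ l)\<^sup>2)"
begin

text \<open>Places the estimation errors of all sample sizes on the space of infinite sequences; the
  restriction makes the first \<open>k\<close> entries an extensional sample.\<close>

definition err :: "nat \<Rightarrow> (nat \<Rightarrow> real ^ 't) \<Rightarrow> real ^ 'd" where
  "err k \<omega> = mle k (restrict \<omega> {..<k}) - \<theta>\<^sub>0"

lemma err_vanishing:
  assumes "0 < \<kappa>" shows "vanishing PP (\<lambda>k. {\<omega>\<in>space PP. \<kappa> \<le> norm (err k \<omega>)})"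
proof (rule vanishing_of_tendsto)
  let ?E = "\<lambda>k. {x \<in> space (sample_law \<nu> f k \<theta>\<^sub>0). \<kappa> \<le> norm (mle k x - \<theta>\<^sub>0)}"
  have E: "?E k \<in> sets (Pi\<^sub>M {..<k} (\<lambda>_. L))" if "k \<ge> n" for k
    using mle_meas[OF that] unfolding sample_law_eq by measurable
  have eq: "{\<omega>\<in>space PP. \<kappa> \<le> norm (err k \<omega>)} = (\<lambda>\<omega>. restrict \<omega> {..<k}) -` ?E k \<inter> space PP" for k
    using measurable_space[OF restrict_meas] by (auto simp: err_def sample_law_eq)
  show "{\<omega>\<in>space PP. \<kappa> \<le> norm (err k \<omega>)} \<in> sets PP" if "n \<le> k" for k
    unfolding eq by (rule measurable_sets[OF restrict_meas E[OF that]])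
  have "measure PP {\<omega>\<in>space PP. \<kappa> \<le> norm (err k \<omega>)} = measure (sample_law \<nu> f k \<theta>\<^sub>0) (?E k)" if "k \<ge> n" for k
    unfolding eq using measure_distr[OF restrict_meas E[OF that]] by (simp add: distr_restrict)
  note eq' = this
  have "\<forall>\<^sub>F k in sequentially. measure (sample_law \<nu> f k \<theta>\<^sub>0) (?E k) = measure PP {\<omega>\<in>space PP. \<kappa> \<le> norm (err k \<omega>)}"
    using eventually_ge_at_top[of n] by eventually_elim (rule eq'[symmetric])
  moreover have "(\<lambda>k. measure (sample_law \<nu> f k \<theta>\<^sub>0) (?E k)) \<longlonglongrightarrow> 0"
    using consistent assms by (auto simp: consistent_at_def)
  ultimately show "(\<lambda>k. measure PP {\<omega>\<in>space PP. \<kappa> \<le> norm (err k \<omega>)}) \<longlonglongrightarrow> 0"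
    by (rule Lim_transform_eventually[rotated])
qed

definition regular_sample :: "nat \<Rightarrow> (nat \<Rightarrow> real ^ 't) \<Rightarrow> bool" where
  "regular_sample k \<omega> \<longleftrightarrow> (\<forall>i<k. \<omega> i \<in> S) \<and> is_unique_mle f \<Theta> k (restrict \<omega> {..<k}) (\<theta>\<^sub>0 + err k \<omega>)
     \<and> q (\<theta>\<^sub>0 + err k \<omega>) = (1 / real k) *\<^sub>R (\<Sum>i<k. g (\<omega> i))"

lemma AE_regular_sample:
  assumes "k \<ge> n" shows "AE \<omega> in PP. regular_sample k \<omega>"
proof -
  have "AE \<omega> in PP. \<forall>i\<in>{..<k}. \<omega> i \<in> S"
    by (intro AE_finite_allI AE_component AE_S) auto
  with AE_restrict[OF mle[OF assms]] AE_restrict[OF q_mle[OF assms]] show ?thesis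
    by eventually_elim (auto simp: regular_sample_def err_def)
qed

text \<open>Asymptotic linearity in exact form. The average of the left-hand side is the
  delta-method error, which is a small multiple of the averaged score, and the latter is of order
  \<open>1 / sqrt k\<close> in probability; hence the sums divided by \<open>sqrt k\<close> vanish
  in probability.\<close>

lemma g_linear_in_score_component:
  "AE x in L. g x $ l - q \<theta>\<^sub>0 $ l - (\<Sum>r\<in>UNIV. (J ** matrix_inv info) $ l $ r * score r x) = 0"
proof -
  define A where "A = J ** matrix_inv info"
  define y where "y x = g x $ l - q \<theta>\<^sub>0 $ l - (\<Sum>r\<in>UNIV. A $ l $ r * score r x)" for x
  have score_meas [measurable]: "score r \<in> borel_measurable L" for r
    using score_integrable[of r] by simp
  have y_meas [measurable]: "y \<in> borel_measurable L" unfolding y_def[abs_def] by measurable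
  have y_sq: "integrable L (\<lambda>x. (y x)\<^sup>2)"
  proof -
    have "integrable L (\<lambda>x. (c * score r x)\<^sup>2)" for c r
    proof -
      have "integrable L (\<lambda>x. c\<^sup>2 * (score r x * score r x))"
        by (intro integrable_mult_right score_mult_integrable)
      then show ?thesis by (simp add: power_mult_distrib power2_eq_square[of "score r _"])
    qed
    then have 1: "integrable L (\<lambda>x. (\<Sum>r\<in>UNIV. - (A $ l $ r) * score r x)\<^sup>2)"
      by (intro square_integrable_sum) auto
    have "integrable L (\<lambda>x. (g x $ l + - (q \<theta>\<^sub>0 $ l))\<^sup>2)"
      using g_sq by (intro square_integrable_add) auto
    from square_integrable_add[OF _ _ this 1] show ?thesis
      by (simp add: y_def[abs_def] sum_negf)
  qed
  have "AE x in L. y x = 0"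
  proof (rule normalized_sum_vanishing_imp_zero[OF y_meas y_sq], rule PP.vanishing_up_to_tight)
    fix \<delta> \<eta> :: real assume \<delta>: "0 < \<delta>" and \<eta>: "0 < \<eta>"
    define d where "d = real CARD('d)"
    have d: "d > 0" by (simp add: d_def)
    define tr where "tr = (\<Sum>r\<in>UNIV. info $ r $ r)"
    have tr_nonneg: "0 \<le> info $ r $ r" for r
      unfolding score_cov[symmetric] by (intro integral_nonneg_AE) auto
    then have tr: "tr \<ge> 0" by (simp add: tr_def sum_nonneg)
    \<comment> \<open>The Chebyshev level: the score sums exceed \<open>C * sqrt (real k)\<close>
      with probability at most \<open>tr / C\<^sup>2 \<le> \<eta>\<close>. Adding \<open>1\<close>
      gives a positive \<open>C\<close> from \<open>tr \<ge> 0\<close> alone.\<close>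
    define C where "C = sqrt ((tr + 1) / \<eta>)"
    have C: "C > 0" "tr / C\<^sup>2 \<le> \<eta>"
      using tr \<eta> by (auto simp: C_def field_simps)
    define Ak where "Ak k = (\<Union>r\<in>UNIV. {\<omega>\<in>space PP. C * sqrt (real k) \<le> \<bar>\<Sum>i<k. score r (\<omega> i)\<bar>})" for k
    have Ak: "Ak k \<in> sets PP" "measure PP (Ak k) \<le> \<eta>" if "k > 0" for k
    proof -
      have m: "{\<omega>\<in>space PP. C * sqrt (real k) \<le> \<bar>\<Sum>i<k. score r (\<omega> i)\<bar>} \<in> sets PP" for r
        by measurable
      show "Ak k \<in> sets PP" unfolding Ak_def using m by (intro sets.finite_UN) auto
      have "measure PP (Ak k) \<le> (\<Sum>r\<in>UNIV. measure PP {\<omega>\<in>space PP. C * sqrt (real k) \<le> \<bar>\<Sum>i<k. score r (\<omega> i)\<bar>})"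
        unfolding Ak_def using m by (intro measure_UNION_le) auto
      also have "\<dots> \<le> (\<Sum>r\<in>UNIV. real k * (\<integral>x. (score r x)\<^sup>2 \<partial>L) / (C * sqrt (real k))\<^sup>2)"
        using C that score_mult_integrable
        by (intro sum_mono chebyshev_sum score_meas score_mean) (auto simp: power2_eq_square)
      also have "\<dots> = (\<Sum>r\<in>UNIV. info $ r $ r / C\<^sup>2)"
        using that score_cov by (intro sum.cong) (auto simp: power_mult_distrib power2_eq_square[of "score _ _"])
      also have "\<dots> = tr / C\<^sup>2" by (simp add: tr_def sum_divide_distrib)
      finally show "measure PP (Ak k) \<le> \<eta>" using C by simp
    qed
    \<comment> \<open>Off \<open>Ak k\<close> the averaged score has norm at most
      \<open>d * C / sqrt (real k)\<close>, so the delta-method error will be at most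
      \<open>\<delta> / 2\<close> divided by \<open>sqrt (real k)\<close>.\<close>
    define \<tau> where "\<tau> = \<delta> / (2 * d * C)"
    have "\<tau> > 0" using \<delta> d C by (simp add: \<tau>_def)
    from delta_method_deterministic[OF pos_def_invertible[OF info_pos_def] q_der this]
    obtain \<eta>0 where \<eta>0: "\<eta>0 > 0" and det: "\<And>\<Delta> U. norm \<Delta> < \<eta>0 \<Longrightarrow>
        (\<And>r. \<bar>(info *v \<Delta>) $ r - U $ r\<bar> \<le> \<eta>0 * norm \<Delta>) \<Longrightarrow>
        norm (q (\<theta>\<^sub>0 + \<Delta>) - q \<theta>\<^sub>0 - J *v (matrix_inv info *v U)) \<le> \<tau> * norm U" by blast
    obtain \<rho> b where \<rho>: "\<rho> > 0" "cball \<theta>\<^sub>0 \<rho> \<subseteq> \<Theta>" and b_int: "integrable L b"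
      and b: "\<And>r s u y \<theta>. y \<in> S \<Longrightarrow> \<theta> \<in> cball \<theta>\<^sub>0 \<rho> \<Longrightarrow> \<bar>d3 r s u y \<theta>\<bar> \<le> b y"
      using third_derivative_envelope by blast
    define m where "m = \<bar>\<integral>x. b x \<partial>L\<bar> + 1"
    have m: "m > 0" by (simp add: m_def)
    \<comment> \<open>The tolerance \<open>\<eta>0\<close> is shared: \<open>d * e\<close> is one
      half, for the fluctuation of the second derivatives, and
      \<open>d * d * \<kappa> * m / 2\<close> is at most the other half, for the third-order
      remainder.\<close>
    define e where "e = \<eta>0 / (2 * d)"
    define \<kappa> where "\<kappa> = min \<rho> (min \<eta>0 (\<eta>0 / (d * d * m)))"
    have \<kappa>: "\<kappa> > 0" using \<rho> \<eta>0 d m by (auto simp: \<kappa>_def)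
    have e: "e > 0" using \<eta>0 d by (simp add: e_def)
    have \<kappa>m: "d * d * \<kappa> * m \<le> \<eta>0"
    proof -
      have "\<kappa> \<le> \<eta>0 / (d * d * m)" by (simp add: \<kappa>_def)
      then show ?thesis using d m by (simp add: field_simps)
    qed
    define H where "H k \<omega> s r = (\<Sum>i<k. hess s r (\<omega> i)) / real k" for k and \<omega> :: "nat \<Rightarrow> real ^ 't" and s r
    \<comment> \<open>Off \<open>V k\<close> the estimator is within \<open>\<kappa>\<close> of
      \<open>\<theta>\<^sub>0\<close>, the averaged second derivatives are within \<open>e\<close>
      of their means, the averaged envelope is at most \<open>m\<close>, and the identities for the
      estimator hold.\<close>
    define V where "V k = {\<omega>\<in>space PP. \<kappa> \<le> norm (err k \<omega>)}
      \<union> ((\<Union>p\<in>UNIV. {\<omega>. e \<le> \<bar>H k \<omega> (fst p) (snd p) - (\<integral>x. hess (fst p) (snd p) x \<partial>L)\<bar>})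
      \<union> ({\<omega>. 1 \<le> \<bar>(\<Sum>i<k. b (\<omega> i)) / real k - (\<integral>x. b x \<partial>L)\<bar>} \<union> {\<omega>. \<not> regular_sample k \<omega>}))" for k
    have "vanishing PP V"
      unfolding V_def[abs_def] H_def
      by (intro PP.vanishing_Un PP.vanishing_UN err_vanishing[OF \<kappa>] weak_law_of_large_numbers
          hess_integrable b_int e zero_less_one PP.vanishing_AE[of n]) (auto intro: AE_regular_sample)
    moreover have "\<forall>\<^sub>F k in sequentially. Ak k \<in> sets PP \<and> measure PP (Ak k) \<le> \<eta> \<and>
        {\<omega>. \<delta> \<le> \<bar>\<Sum>i<k. y (\<omega> i)\<bar> / sqrt (real k)} \<inter> space PP \<subseteq> Ak k \<union> V k"
      using eventually_gt_at_top[of 0]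
    proof eventually_elim
      case (elim k)
      have "\<bar>\<Sum>i<k. y (\<omega> i)\<bar> / sqrt (real k) < \<delta>" if \<omega>: "\<omega> \<in> space PP" "\<omega> \<notin> Ak k" "\<omega> \<notin> V k" for \<omega>
      proof -
        define v where "v = err k \<omega>"
        have v_small: "norm v < \<kappa>" and reg: "regular_sample k \<omega>"
          and H_close: "\<bar>H k \<omega> s r - (\<integral>x. hess s r x \<partial>L)\<bar> < e"
          and b_close: "\<bar>(\<Sum>i<k. b (\<omega> i)) / real k - (\<integral>x. b x \<partial>L)\<bar> < 1" for s r
          using \<omega> unfolding V_def v_def by (auto simp: not_le)
        have sum_small: "\<bar>\<Sum>i<k. score r (\<omega> i)\<bar> < C * sqrt (real k)" for r
          using \<omega> unfolding Ak_def by (auto simp: not_le)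
        have \<omega>_S: "\<And>i. i < k \<Longrightarrow> \<omega> i \<in> S"
          and \<omega>_mle: "is_unique_mle f \<Theta> k (restrict \<omega> {..<k}) (\<theta>\<^sub>0 + v)"
          and \<omega>_q: "q (\<theta>\<^sub>0 + v) = (1 / real k) *\<^sub>R (\<Sum>i<k. g (\<omega> i))"
          using reg by (auto simp: regular_sample_def v_def)
        define U where "U = (\<chi> r. (\<Sum>i<k. score r (\<omega> i)) / real k)"
        define N1 where "N1 = (\<Sum>s\<in>UNIV. \<bar>v $ s\<bar>)"
        have N1: "0 \<le> N1" "N1 \<le> d * norm v"
        proof -
          show "0 \<le> N1" by (simp add: N1_def sum_nonneg)
          have "N1 \<le> (\<Sum>s\<in>(UNIV :: 'd set). norm v)"
            unfolding N1_def by (intro sum_mono component_le_norm_cart)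
          then show "N1 \<le> d * norm v" by (simp add: d_def)
        qed
        have b_le: "(\<Sum>i<k. b (\<omega> i)) / real k \<le> m"
          using b_close by (simp add: m_def)
        have close: "\<bar>(info *v v) $ r - U $ r\<bar> \<le> \<eta>0 * norm v" for r
        proof -
          have sym: "info $ r $ s = info $ s $ r" for s
          proof -
            have "info $ s $ r = transpose info $ r $ s" unfolding transpose_def by simp
            also have "transpose info = info" using info_pos_def by (simp add: pos_def_def)
            finally show ?thesis by simp
          qed
          have "\<bar>(\<Sum>i<k. score r (restrict \<omega> {..<k} i)) + (\<Sum>s\<in>UNIV. v $ s * (\<Sum>i<k. hess s r (restrict \<omega> {..<k} i)))\<bar>
              \<le> (\<Sum>s\<in>UNIV. \<bar>v $ s\<bar>)\<^sup>2 * (\<Sum>i<k. b (restrict \<omega> {..<k} i)) / 2"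
            using \<omega>_S v_small by (intro score_expansion[OF _ \<omega>_mle \<rho>(2) _ b]) (auto simp: \<kappa>_def)
          then have "\<bar>(\<Sum>i<k. score r (\<omega> i)) + (\<Sum>s\<in>UNIV. v $ s * (\<Sum>i<k. hess s r (\<omega> i)))\<bar>
              \<le> N1\<^sup>2 * (\<Sum>i<k. b (\<omega> i)) / 2"
            by (simp add: N1_def)
          then have "\<bar>(\<Sum>i<k. score r (\<omega> i)) + (\<Sum>s\<in>UNIV. v $ s * (\<Sum>i<k. hess s r (\<omega> i)))\<bar> / real k
              \<le> N1\<^sup>2 * (\<Sum>i<k. b (\<omega> i)) / 2 / real k"
            by (rule divide_right_mono) simp
          also have "\<bar>(\<Sum>i<k. score r (\<omega> i)) + (\<Sum>s\<in>UNIV. v $ s * (\<Sum>i<k. hess s r (\<omega> i)))\<bar> / real k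
              = \<bar>((\<Sum>i<k. score r (\<omega> i)) + (\<Sum>s\<in>UNIV. v $ s * (\<Sum>i<k. hess s r (\<omega> i)))) / real k\<bar>"
            unfolding abs_divide by simp
          also have "((\<Sum>i<k. score r (\<omega> i)) + (\<Sum>s\<in>UNIV. v $ s * (\<Sum>i<k. hess s r (\<omega> i)))) / real k
              = U $ r + (\<Sum>s\<in>UNIV. v $ s * H k \<omega> s r)"
          proof -
            have "(\<Sum>s\<in>UNIV. v $ s * T s) / real k = (\<Sum>s\<in>UNIV. v $ s * (T s / real k))" for T
              by (simp add: sum_divide_distrib)
            then show ?thesis by (simp add: U_def H_def add_divide_distrib)
          qed
          also have "N1\<^sup>2 * (\<Sum>i<k. b (\<omega> i)) / 2 / real k = N1\<^sup>2 * ((\<Sum>i<k. b (\<omega> i)) / real k) / 2"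
            by simp
          also have "\<dots> \<le> N1\<^sup>2 * m / 2"
            using b_le by (intro divide_right_mono mult_left_mono) auto
          finally have 1: "\<bar>U $ r + (\<Sum>s\<in>UNIV. v $ s * H k \<omega> s r)\<bar> \<le> N1\<^sup>2 * m / 2" .
          \<comment> \<open>The means of the second derivatives are minus the information, so adding
            \<open>info *v v\<close> leaves their fluctuations only.\<close>
          have "(info *v v) $ r + (\<Sum>s\<in>UNIV. v $ s * H k \<omega> s r) = (\<Sum>s\<in>UNIV. v $ s * (H k \<omega> s r - (\<integral>x. hess s r x \<partial>L)))"
            by (simp add: matrix_vector_mult_def hess_mean sym sum.distrib[symmetric] algebra_simps)
          also have "\<bar>\<dots>\<bar> \<le> (\<Sum>s\<in>UNIV. \<bar>v $ s\<bar> * e)"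
          proof (intro order_trans[OF sum_abs] sum_mono)
            fix s
            show "\<bar>v $ s * (H k \<omega> s r - (\<integral>x. hess s r x \<partial>L))\<bar> \<le> \<bar>v $ s\<bar> * e"
              unfolding abs_mult by (intro mult_left_mono less_imp_le[OF H_close]) simp
          qed
          also have "\<dots> = N1 * e" by (simp add: N1_def sum_distrib_right)
          finally have 2: "\<bar>(info *v v) $ r + (\<Sum>s\<in>UNIV. v $ s * H k \<omega> s r)\<bar> \<le> N1 * e" .
          have "N1 * e \<le> d * norm v * e" using N1 e by (intro mult_right_mono) auto
          also have "\<dots> = \<eta>0 / 2 * norm v" using d by (simp add: e_def)
          finally have 3: "N1 * e \<le> \<eta>0 / 2 * norm v" .
          have "N1\<^sup>2 * m / 2 \<le> (d * norm v)\<^sup>2 * m / 2"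
            using N1 m by (intro divide_right_mono mult_right_mono power_mono) auto
          also have "\<dots> = d * d * norm v * m * norm v / 2"
            by (simp add: power2_eq_square mult_ac)
          also have "\<dots> \<le> d * d * \<kappa> * m * norm v / 2"
            using v_small d m by (intro divide_right_mono mult_right_mono mult_left_mono) auto
          also have "\<dots> \<le> \<eta>0 * norm v / 2"
            using \<kappa>m by (intro divide_right_mono mult_right_mono) auto
          finally have 4: "N1\<^sup>2 * m / 2 \<le> \<eta>0 / 2 * norm v" by simp
          show ?thesis using 1 2 3 4 by linarith
        qed
        have "norm v < \<eta>0" using v_small by (simp add: \<kappa>_def)
        from det[OF this close]
        have "norm (q (\<theta>\<^sub>0 + v) - q \<theta>\<^sub>0 - J *v (matrix_inv info *v U)) \<le> \<tau> * norm U" .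
        then have le: "\<bar>(q (\<theta>\<^sub>0 + v) - q \<theta>\<^sub>0 - J *v (matrix_inv info *v U)) $ l\<bar> \<le> \<tau> * norm U"
          using component_le_norm_cart order_trans by blast
        \<comment> \<open>Because \<open>q\<close> at the estimator equals the average of
          \<open>g\<close>, the delta-method error is exactly the average of
          \<open>y\<close>.\<close>
        have sum_y: "(q (\<theta>\<^sub>0 + v) - q \<theta>\<^sub>0 - J *v (matrix_inv info *v U)) $ l = (\<Sum>i<k. y (\<omega> i)) / real k"
        proof -
          have "(J *v (matrix_inv info *v U)) $ l = (\<Sum>r\<in>UNIV. A $ l $ r * ((\<Sum>i<k. score r (\<omega> i)) / real k))"
            unfolding matrix_vector_mul_assoc A_def[symmetric] by (simp add: matrix_vector_mult_def U_def)
          also have "\<dots> = (\<Sum>i<k. \<Sum>r\<in>UNIV. A $ l $ r * score r (\<omega> i)) / real k"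
            by (subst sum.swap) (simp add: sum_distrib_left sum_divide_distrib)
          finally show ?thesis
            unfolding \<omega>_q y_def using elim
            by (simp add: sum_subtractf diff_divide_distrib sum_component)
        qed
        have "norm U \<le> (\<Sum>r\<in>UNIV. \<bar>U $ r\<bar>)" by (rule norm_le_l1_cart)
        also have "\<dots> \<le> (\<Sum>r\<in>(UNIV :: 'd set). C * sqrt (real k) / real k)"
          using less_imp_le[OF sum_small] unfolding U_def
          by (intro sum_mono) (auto simp: abs_divide intro!: divide_right_mono)
        also have "\<dots> = d * C * (sqrt (real k) / real k)" by (simp add: d_def)
        finally have U_le: "norm U \<le> d * C * (sqrt (real k) / real k)" .
        have "\<bar>\<Sum>i<k. y (\<omega> i)\<bar> / real k \<le> \<tau> * norm U"
          using le unfolding sum_y by (simp add: abs_divide)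
        also have "\<dots> \<le> \<tau> * (d * C * (sqrt (real k) / real k))"
          using U_le \<open>\<tau> > 0\<close> by (intro mult_left_mono) auto
        also have "\<dots> = \<delta> / 2 * (sqrt (real k) / real k)"
          using d C by (simp add: \<tau>_def)
        finally have "\<bar>\<Sum>i<k. y (\<omega> i)\<bar> / real k \<le> (\<delta> / 2 * sqrt (real k)) / real k"
          by (simp only: times_divide_eq_right)
        then have "\<bar>\<Sum>i<k. y (\<omega> i)\<bar> \<le> \<delta> / 2 * sqrt (real k)"
          using elim unfolding divide_le_cancel by auto
        then have "\<bar>\<Sum>i<k. y (\<omega> i)\<bar> / sqrt (real k) \<le> \<delta> / 2"
          using elim by (simp add: divide_le_eq)
        then show ?thesis using \<delta> by linarith
      qed
      then show ?case using Ak[OF elim] by (force simp: not_less)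
    qed
    ultimately show "\<exists>A V. vanishing PP V \<and> (\<forall>\<^sub>F k in sequentially. A k \<in> sets PP \<and> measure PP (A k) \<le> \<eta> \<and>
        {\<omega>. \<delta> \<le> \<bar>\<Sum>i<k. y (\<omega> i)\<bar> / sqrt (real k)} \<inter> space PP \<subseteq> A k \<union> V k)" by blast
  qed
  then show ?thesis by (simp add: y_def A_def)
qed

text \<open>Almost surely \<open>g - q \<theta>\<^sub>0\<close> is
  \<open>J ** matrix_inv info\<close> applied to the score, which is centered with covariance
  \<open>info\<close>; one factor \<open>info\<close> cancels in the covariance.\<close>

theorem g_mean: "(\<integral>x. g x $ l - q \<theta>\<^sub>0 $ l \<partial>L) = 0"
  and g_cov: "(\<integral>x. (g x $ j - q \<theta>\<^sub>0 $ j) * (g x $ k - q \<theta>\<^sub>0 $ k) \<partial>L)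
    = (J ** matrix_inv info ** transpose J) $ j $ k"
proof -
  define A where "A = J ** matrix_inv info"
  have score_meas [measurable]: "score r \<in> borel_measurable L" for r
    using score_integrable[of r] by simp
  have AE: "AE x in L. g x $ l - q \<theta>\<^sub>0 $ l = (\<Sum>r\<in>UNIV. A $ l $ r * score r x)" for l
    using g_linear_in_score_component[of l] by eventually_elim (simp add: A_def)
  have "(\<integral>x. g x $ l - q \<theta>\<^sub>0 $ l \<partial>L) = (\<integral>x. (\<Sum>r\<in>UNIV. A $ l $ r * score r x) \<partial>L)"
    using AE[of l] by (intro integral_cong_AE) auto
  also have "\<dots> = 0"
    using score_integrable score_mean by (simp add: Bochner_Integration.integral_sum)
  finally show "(\<integral>x. g x $ l - q \<theta>\<^sub>0 $ l \<partial>L) = 0" .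
  have "(\<integral>x. (g x $ j - q \<theta>\<^sub>0 $ j) * (g x $ k - q \<theta>\<^sub>0 $ k) \<partial>L)
      = (\<integral>x. (\<Sum>r\<in>UNIV. \<Sum>s\<in>UNIV. (A $ j $ r * A $ k $ s) * (score r x * score s x)) \<partial>L)"
  proof (rule integral_cong_AE)
    show "AE x in L. (g x $ j - q \<theta>\<^sub>0 $ j) * (g x $ k - q \<theta>\<^sub>0 $ k)
        = (\<Sum>r\<in>UNIV. \<Sum>s\<in>UNIV. (A $ j $ r * A $ k $ s) * (score r x * score s x))"
      using AE[of j] AE[of k] by eventually_elim (simp add: sum_product mult_ac)
  qed auto
  also have "\<dots> = (\<Sum>r\<in>UNIV. \<Sum>s\<in>UNIV. (A $ j $ r * A $ k $ s) * info $ r $ s)"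
    using score_mult_integrable score_cov by (simp add: Bochner_Integration.integral_sum)
  also have "\<dots> = (A ** info ** transpose A) $ j $ k"
    by (simp add: matrix_matrix_mult_def transpose_def sum_distrib_left sum_distrib_right mult_ac)
      (rule sum.swap)
  also have "A ** info ** transpose A = J ** matrix_inv info ** transpose J"
  proof -
    have "transpose (matrix_inv info) = matrix_inv info"
      using pos_def_matrix_inv[OF info_pos_def] by (simp add: pos_def_def)
    then show ?thesis
      using matrix_inv_mult(1)[OF pos_def_invertible[OF info_pos_def]]
      by (metis A_def matrix_mul_assoc matrix_mul_rid matrix_transpose_mul)
  qed
  finally show "(\<integral>x. (g x $ j - q \<theta>\<^sub>0 $ j) * (g x $ k - q \<theta>\<^sub>0 $ k) \<partial>L)
    = (J ** matrix_inv info ** transpose J) $ j $ k" .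
qed

end

section \<open>The delta-method step\<close>

text \<open>Conditioning divides by a probability, which is at most \<open>1\<close>, so it can only
  enlarge the restricted integral. On a null event both sides are \<open>0\<close>.\<close>

lemma nn_integral_indicator_le_uniform_measure:
  assumes "prob_space M" and [measurable]: "A \<in> sets M" "F \<in> borel_measurable M"
  shows "(\<integral>\<^sup>+\<omega>. F \<omega> * indicator A \<omega> \<partial>M) \<le> (\<integral>\<^sup>+\<omega>. F \<omega> \<partial>uniform_measure M A)"
proof -
  interpret prob_space M by fact
  have "(1 :: ennreal) \<le> inverse (emeasure M A)"
  proof (cases "emeasure M A = 0")
    case False
    then have "0 < measure M A" by (simp add: emeasure_eq_measure zero_less_measure_iff)
    moreover have "1 \<le> inverse (measure M A)"
      using calculation by (intro one_le_inverse) auto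
    ultimately show ?thesis by (simp add: emeasure_eq_measure inverse_ennreal)
  qed simp
  then have "(\<integral>\<^sup>+\<omega>. F \<omega> * indicator A \<omega> \<partial>M) * 1 \<le> (\<integral>\<^sup>+\<omega>. F \<omega> * indicator A \<omega> \<partial>M) * inverse (emeasure M A)"
    by (rule mult_left_mono) simp
  then show ?thesis
    by (simp add: nn_integral_uniform_measure divide_ennreal_def)
qed

text \<open>Writing \<open>w = J *v v + rem\<close> and applying \<open>G\<close>, for which
  \<open>G ** J = B\<close>, gives \<open>B *v v = G *v w - G *v rem\<close>. Subtracting
  \<open>R *v w\<close> leaves \<open>(G - R) *v w\<close>, which is \<open>a1\<close>, and the
  Taylor remainder of \<open>q\<close>, which is bounded by \<open>a2\<close>.\<close>

lemma delta_step_pointwise: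
  fixes q :: "real ^ 'd::finite \<Rightarrow> real ^ 'd" and B R :: "real ^ 'd ^ 'd" and D :: "'d \<Rightarrow> 'd \<Rightarrow> 'd \<Rightarrow> real"
  assumes n: "n \<ge> (1::nat)"
    and seg: "closed_segment \<theta>\<^sub>0 \<theta> \<subseteq> \<Theta>"
    and q_diff: "\<And>\<theta>. \<theta> \<in> \<Theta> \<Longrightarrow> q differentiable (at \<theta>)"
    and q_diff2: "\<And>k l \<theta>. \<theta> \<in> \<Theta> \<Longrightarrow> partial_deriv l (\<lambda>\<theta>. q \<theta> $ k) differentiable (at \<theta>)"
    and q_inv: "invertible (jacobian q (at \<theta>\<^sub>0))"
    and D: "\<And>k l m \<theta>'. \<theta>' \<in> closed_segment \<theta>\<^sub>0 \<theta> \<Longrightarrow> \<bar>partial_deriv m (partial_deriv l (\<lambda>\<theta>. q \<theta> $ k)) \<theta>'\<bar> \<le> D k l m"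
  defines "G \<equiv> B ** matrix_inv (jacobian q (at \<theta>\<^sub>0))"
  defines "a1 \<equiv> \<lambda>j. real n * (\<Sum>k\<in>UNIV. (G - R) $ j $ k * (q \<theta> $ k - q \<theta>\<^sub>0 $ k))"
    and "a2 \<equiv> \<lambda>j. real n / 2 * (\<Sum>k\<in>UNIV. \<bar>G $ j $ k\<bar> * (\<Sum>m\<in>UNIV. \<Sum>l\<in>UNIV. \<bar>\<theta> $ m - \<theta>\<^sub>0 $ m\<bar> * \<bar>\<theta> $ l - \<theta>\<^sub>0 $ l\<bar> * D k l m))"
  shows "\<bar>(sqrt (real n) *\<^sub>R (B *v (\<theta> - \<theta>\<^sub>0))) $ j - (sqrt (real n) *\<^sub>R (R *v (q \<theta> - q \<theta>\<^sub>0))) $ j\<bar>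
    \<le> (\<bar>a1 j\<bar> + \<bar>a2 j\<bar>) / sqrt (real n)"
proof -
  define J where "J = jacobian q (at \<theta>\<^sub>0)"
  define v where "v = \<theta> - \<theta>\<^sub>0"
  define w where "w = q \<theta> - q \<theta>\<^sub>0"
  define rem where "rem = w - J *v v"
  have \<theta>0: "\<theta>\<^sub>0 \<in> \<Theta>" using seg by auto
  have on_seg: "\<theta>\<^sub>0 + t *\<^sub>R v \<in> closed_segment \<theta>\<^sub>0 \<theta>" if "0 \<le> t" "t \<le> 1" for t
    using that by (auto simp: in_segment v_def algebra_simps intro!: exI[of _ t])
  have comp_diff: "(\<lambda>\<theta>. q \<theta> $ k) differentiable (at \<theta>)" if "\<theta> \<in> \<Theta>" for k \<theta>
    using q_diff[OF that] bounded_linear.has_derivative[OF bounded_linear_vec_nth]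
    unfolding differentiable_def by blast
  have J_entry: "partial_deriv l (\<lambda>\<theta>. q \<theta> $ k) \<theta>\<^sub>0 = J $ k $ l" for k l
  proof -
    have "(q has_derivative (\<lambda>v. J *v v)) (at \<theta>\<^sub>0)"
      using q_diff[OF \<theta>0] unfolding J_def by (simp add: jacobian_works)
    then have "((\<lambda>\<theta>. q \<theta> $ k) has_derivative (\<lambda>v. (J *v v) $ k)) (at \<theta>\<^sub>0)"
      by (rule bounded_linear.has_derivative[OF bounded_linear_vec_nth])
    from partial_deriv_has_derivative[OF this] show ?thesis
      by (simp add: matrix_vector_mul_component inner_axis)
  qed
  have rem_bd: "\<bar>rem $ k\<bar> \<le> (\<Sum>m\<in>UNIV. \<Sum>l\<in>UNIV. \<bar>v $ m\<bar> * \<bar>v $ l\<bar> * D k l m) / 2" for k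
  proof -
    have "\<bar>q (\<theta>\<^sub>0 + v) $ k - q \<theta>\<^sub>0 $ k - (\<Sum>l\<in>UNIV. v $ l * partial_deriv l (\<lambda>\<theta>. q \<theta> $ k) \<theta>\<^sub>0)\<bar>
        \<le> (\<Sum>m\<in>UNIV. \<Sum>l\<in>UNIV. \<bar>v $ m\<bar> * \<bar>v $ l\<bar> * D k l m) / 2"
      using on_seg seg D q_diff2 comp_diff
      by (intro taylor_second_order_bound[where T=\<Theta> and F="\<lambda>\<theta>. q \<theta> $ k"]) blast+
    moreover have "q (\<theta>\<^sub>0 + v) $ k - q \<theta>\<^sub>0 $ k - (\<Sum>l\<in>UNIV. v $ l * partial_deriv l (\<lambda>\<theta>. q \<theta> $ k) \<theta>\<^sub>0) = rem $ k"
      by (simp add: J_entry rem_def w_def v_def matrix_vector_mult_def mult.commute)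
    ultimately show ?thesis by simp
  qed
  have "B *v v = G *v w - G *v rem"
  proof -
    have "G *v rem = G *v w - (B ** (matrix_inv J ** J)) *v v"
      by (simp add: rem_def G_def J_def matrix_vector_mult_diff_distrib matrix_vector_mul_assoc matrix_mul_assoc)
    also have "\<dots> = G *v w - B *v v"
      using matrix_inv_mult(1)[OF q_inv] by (simp add: J_def)
    finally show ?thesis by simp
  qed
  note Bv = this
  have "(sqrt (real n) *\<^sub>R (B *v v)) $ j - (sqrt (real n) *\<^sub>R (R *v w)) $ j
      = sqrt (real n) * ((G - R) *v w) $ j - sqrt (real n) * (G *v rem) $ j"
    unfolding Bv by (simp add: matrix_vector_mult_diff_rdistrib right_diff_distrib)
  moreover have "sqrt (real n) * ((G - R) *v w) $ j = a1 j / sqrt (real n)"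
  proof -
    have "a1 j = real n * ((G - R) *v w) $ j"
      by (simp add: a1_def matrix_vector_mult_def w_def)
    then have "a1 j / sqrt (real n) = real n / sqrt (real n) * ((G - R) *v w) $ j" by simp
    then show ?thesis by (simp only: real_div_sqrt of_nat_0_le_iff)
  qed
  moreover have "\<bar>sqrt (real n) * (G *v rem) $ j\<bar> \<le> \<bar>a2 j\<bar> / sqrt (real n)"
  proof -
    have "\<bar>(G *v rem) $ j\<bar> \<le> (\<Sum>k\<in>UNIV. \<bar>G $ j $ k\<bar> * ((\<Sum>m\<in>UNIV. \<Sum>l\<in>UNIV. \<bar>v $ m\<bar> * \<bar>v $ l\<bar> * D k l m) / 2))"
      unfolding matrix_vector_mult_def vec_lambda_beta
    proof (intro order_trans[OF sum_abs] sum_mono)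
      fix k
      show "\<bar>G $ j $ k * rem $ k\<bar> \<le> \<bar>G $ j $ k\<bar> * ((\<Sum>m\<in>UNIV. \<Sum>l\<in>UNIV. \<bar>v $ m\<bar> * \<bar>v $ l\<bar> * D k l m) / 2)"
        unfolding abs_mult by (rule mult_left_mono[OF rem_bd]) simp
    qed
    also have "\<dots> = a2 j / real n"
      using n by (simp add: a2_def v_def sum_divide_distrib sum_distrib_left)
    finally have "sqrt (real n) * \<bar>(G *v rem) $ j\<bar> \<le> sqrt (real n) * (a2 j / real n)"
      by (rule mult_left_mono) simp
    also have "\<dots> = a2 j / sqrt (real n)"
      using n by (simp add: field_simps)
    also have "\<dots> \<le> \<bar>a2 j\<bar> / sqrt (real n)" by (intro divide_right_mono) auto
    finally show ?thesis by (simp add: abs_mult)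
  qed
  moreover have "\<bar>a1 j / sqrt (real n)\<bar> = \<bar>a1 j\<bar> / sqrt (real n)" by simp
  ultimately show ?thesis
    unfolding v_def[symmetric] w_def[symmetric] add_divide_distrib
    by linarith
qed

text \<open>Moments on the right are \<open>ennreal\<close> integrals, so the inequality keeps its
  meaning when one of them is infinite. Conditioning on
  \<open>\<bar>Q \<omega>\<bar> < \<epsilon>\<close> is integration against
  \<open>uniform_measure\<close>; if this event is null, that is the zero measure, and the squared
  error alone covers the comparison of the estimator with the sum.\<close>

theorem theorem2p2:
  fixes \<nu> :: "(real ^ 't::finite) measure"
    and f :: "real ^ 't \<Rightarrow> real ^ 'd::finite \<Rightarrow> real"
    and \<Theta> :: "(real ^ 'd) set" and \<theta>\<^sub>0 :: "real ^ 'd"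
    and n :: nat
    and M :: "'w measure" and X :: "nat \<Rightarrow> 'w \<Rightarrow> real ^ 't"
    and N :: "'v measure" and Z :: "'v \<Rightarrow> real ^ 'd"
    and mle :: "nat \<Rightarrow> (nat \<Rightarrow> real ^ 't) \<Rightarrow> real ^ 'd"
    and q :: "real ^ 'd \<Rightarrow> real ^ 'd" and g :: "real ^ 't \<Rightarrow> real ^ 'd"
    and I K :: "real ^ 'd ^ 'd"
    and \<xi> :: "nat \<Rightarrow> 'd \<Rightarrow> 'w \<Rightarrow> real"
    and data :: "'w \<Rightarrow> nat \<Rightarrow> real ^ 't" and est :: "'w \<Rightarrow> real ^ 'd"
    and imax :: "'w \<Rightarrow> 'd" and Q :: "'w \<Rightarrow> real"
    and \<epsilon> :: real and D :: "'d \<Rightarrow> 'd \<Rightarrow> 'd \<Rightarrow> (nat \<Rightarrow> real ^ 't) \<Rightarrow> real"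
    and A1 A2 :: "'d \<Rightarrow> 'w \<Rightarrow> real"
    and h :: "real ^ 'd \<Rightarrow> real"
  assumes model: "parametric_model \<nu> f \<Theta>" and true_param: "\<theta>\<^sub>0 \<in> \<Theta>"
    and n_pos: "n \<ge> 1"
    and regular: "regularity_conditions \<nu> f \<Theta> n"
    \<comment> \<open>the i.i.d. data and the standard normal vector\<close>
    and prob_M: "prob_space M"
    and indep: "prob_space.indep_vars M (\<lambda>_. borel) X {..<n}"
    and ident: "\<And>i. i < n \<Longrightarrow> distributed M \<nu> (X i) (\<lambda>x. ennreal (f x \<theta>\<^sub>0))"
    and prob_N: "prob_space N"
    and normal_Z: "distributed N lborel Z (\<lambda>z. ennreal (\<Prod>j\<in>UNIV. std_normal_density (z $ j)))"
    \<comment> \<open>the MLE\<close>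
    and mle_meas: "\<And>k. k \<ge> n \<Longrightarrow> mle k \<in> borel_measurable (sample_law \<nu> f k \<theta>\<^sub>0)"
    and mle: "\<And>k. k \<ge> n \<Longrightarrow> AE x in sample_law \<nu> f k \<theta>\<^sub>0. is_unique_mle f \<Theta> k x (mle k x)"
    and consistent: "consistent_at \<nu> f \<theta>\<^sub>0 mle"
    \<comment> \<open>the functions \<open>q\<close> and \<open>g\<close>\<close>
    and q_diff: "\<And>\<theta>. \<theta> \<in> \<Theta> \<Longrightarrow> q differentiable (at \<theta>)"
    and q_diff2: "\<And>k l \<theta>. \<theta> \<in> \<Theta> \<Longrightarrow> partial_deriv l (\<lambda>\<theta>. q \<theta> $ k) differentiable (at \<theta>)"
    and q_cont: "\<And>k l. continuous_on \<Theta> (partial_deriv l (\<lambda>\<theta>. q \<theta> $ k))"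
    and q_inv: "invertible (jacobian q (at \<theta>\<^sub>0))"
    and g_meas: "g \<in> borel_measurable borel"
    and q_mle: "\<And>k. k \<ge> n \<Longrightarrow>
        AE x in sample_law \<nu> f k \<theta>\<^sub>0. q (mle k x) = (1 / real k) *\<^sub>R (\<Sum>i<k. g (x i))"
    \<comment> \<open>the derived quantities\<close>
    and I: "I = fisher_info \<nu> f \<theta>\<^sub>0"
    and K: "K = jacobian q (at \<theta>\<^sub>0) ** matrix_inv I ** transpose (jacobian q (at \<theta>\<^sub>0))"
    and \<xi>: "\<And>i j \<omega>. \<xi> i j \<omega> =
        (\<Sum>l\<in>UNIV. matrix_inv (principal_sqrt K) $ j $ l * (g (X i \<omega>) $ l - q \<theta>\<^sub>0 $ l))"
    and data: "\<And>\<omega>. data \<omega> = (\<lambda>i\<in>{..<n}. X i \<omega>)"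
    and est: "\<And>\<omega>. est \<omega> = mle n (data \<omega>)"
    and imax: "\<And>\<omega> j. \<bar>est \<omega> $ j - \<theta>\<^sub>0 $ j\<bar> \<le> \<bar>est \<omega> $ imax \<omega> - \<theta>\<^sub>0 $ imax \<omega>\<bar>"
    and Q: "\<And>\<omega>. Q \<omega> = est \<omega> $ imax \<omega> - \<theta>\<^sub>0 $ imax \<omega>"
    and eps_pos: "\<epsilon> > 0"
    \<comment> \<open>makes the Taylor expansion of \<open>q\<close> at \<open>\<theta>\<^sub>0\<close> available; automatic if \<open>\<Theta>\<close> is convex or contains the cube\<close>
    and eps_star: "\<And>\<theta>. \<theta> \<in> \<Theta> \<Longrightarrow> (\<forall>j. \<bar>\<theta> $ j - \<theta>\<^sub>0 $ j\<bar> < \<epsilon>) \<Longrightarrow> closed_segment \<theta>\<^sub>0 \<theta> \<subseteq> \<Theta>"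
    and D_meas: "\<And>k l m. D k l m \<in> borel_measurable (sample_law \<nu> f n \<theta>\<^sub>0)"
    and D: "AE x in sample_law \<nu> f n \<theta>\<^sub>0. \<forall>k l m. \<forall>\<theta>\<in>\<Theta>. (\<forall>j. \<bar>\<theta> $ j - \<theta>\<^sub>0 $ j\<bar> < \<epsilon>) \<longrightarrow>
        \<bar>partial_deriv m (partial_deriv l (\<lambda>\<theta>. q \<theta> $ k)) \<theta>\<bar> \<le> D k l m x"
    and A1: "\<And>j \<omega>. A1 j \<omega> = real n * (\<Sum>k\<in>UNIV.
        (principal_sqrt I ** matrix_inv (jacobian q (at \<theta>\<^sub>0)) - matrix_inv (principal_sqrt K)) $ j $ k
        * (q (est \<omega>) $ k - q \<theta>\<^sub>0 $ k))"
    \<comment> \<open>absolute values are taken termwise: the \<open>D k l m\<close> bound second derivatives in absolute value only\<close>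
    and A2: "\<And>j \<omega>. A2 j \<omega> = real n / 2 * (\<Sum>k\<in>UNIV.
        \<bar>(principal_sqrt I ** matrix_inv (jacobian q (at \<theta>\<^sub>0))) $ j $ k\<bar>
        * (\<Sum>m\<in>UNIV. \<Sum>l\<in>UNIV. \<bar>est \<omega> $ m - \<theta>\<^sub>0 $ m\<bar> * \<bar>est \<omega> $ l - \<theta>\<^sub>0 $ l\<bar> * D k l m (data \<omega>)))"
    and h: "h \<in> Cb2"
  shows "ennreal \<bar>(\<integral>\<omega>. h (sqrt (real n) *\<^sub>R (principal_sqrt I *v (est \<omega> - \<theta>\<^sub>0))) \<partial>M)
                   - (\<integral>\<omega>. h (Z \<omega>) \<partial>N)\<bar>
    \<le> ennreal (sqrt pi * seminorm2 h / (4 * sqrt 2 * real n powr (3/2)))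
        * (\<Sum>i<n. \<Sum>j\<in>UNIV. \<Sum>k\<in>UNIV. \<Sum>l\<in>UNIV.
             (\<integral>\<^sup>+\<omega>. ennreal \<bar>\<xi> i j \<omega> * \<xi> i k \<omega> * \<xi> i l \<omega>\<bar> \<partial>M)
             + 2 * ennreal \<bar>\<integral>\<omega>. \<xi> i j \<omega> * \<xi> i k \<omega> \<partial>M\<bar> * (\<integral>\<^sup>+\<omega>. ennreal \<bar>\<xi> i l \<omega>\<bar> \<partial>M))
      + ennreal (2 * sup_norm h / \<epsilon>\<^sup>2)
        * (\<integral>\<^sup>+\<omega>. ennreal (\<Sum>j\<in>UNIV. (est \<omega> $ j - \<theta>\<^sub>0 $ j)\<^sup>2) \<partial>M)
      + ennreal (seminorm1 h / sqrt (real n))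
        * (\<Sum>j\<in>UNIV.
             (\<integral>\<^sup>+\<omega>. ennreal \<bar>A1 j \<omega>\<bar> \<partial>uniform_measure M {\<omega>\<in>space M. \<bar>Q \<omega>\<bar> < \<epsilon>})
             + (\<integral>\<^sup>+\<omega>. ennreal \<bar>A2 j \<omega>\<bar> \<partial>uniform_measure M {\<omega>\<in>space M. \<bar>Q \<omega>\<bar> < \<epsilon>}))"
proof -
  interpret prob_space M by fact
  interpret mle_model \<nu> f \<Theta> \<theta>\<^sub>0 n
    by standard (fact model true_param n_pos regular)+
  define J where "J = jacobian q (at \<theta>\<^sub>0)"
  define R where "R = matrix_inv (principal_sqrt K)"
  define G where "G = principal_sqrt I ** matrix_inv J"
  have q_der: "(q has_derivative (\<lambda>v. J *v v)) (at \<theta>\<^sub>0)"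
    using q_diff[OF true_param] unfolding J_def by (simp add: jacobian_works)
  have K_pos: "pos_def K"
    unfolding K I using info_pos_def q_inv by (intro pos_def_congruence pos_def_matrix_inv)
  note whitening = whitening_principal_sqrt[OF K_pos, folded R_def]
  have "real n > 0" using n_pos by simp

  \<comment> \<open>Laws of the data and measurability of the estimator\<close>
  have X_meas [measurable]: "X i \<in> borel_measurable M" if "i < n" for i
    using indep that by (auto simp: indep_vars_def)
  have distr_X: "distr M borel (X i) = L" if "i < n" for i
  proof -
    have "distr M borel (X i) = distr M \<nu> (X i)"
      by (rule distr_cong) (auto simp: sets_\<nu>)
    also have "\<dots> = L" using ident[OF that] by (simp add: distributed_def law_def)
    finally show ?thesis .
  qed
  have sets_PiM: "sets (Pi\<^sub>M {..<n} (\<lambda>_. borel)) = sets (Pi\<^sub>M {..<n} (\<lambda>_. L))"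
    by (rule sets_PiM_cong) auto
  have data_meas [measurable]: "data \<in> measurable M (Pi\<^sub>M {..<n} (\<lambda>_. L))"
    unfolding data[abs_def] by (rule measurable_restrict) (use X_meas in \<open>auto simp: measurable_cong_sets[OF refl sets_L]\<close>)
  have distr_data: "distr M (Pi\<^sub>M {..<n} (\<lambda>_. L)) data = sample_law \<nu> f n \<theta>\<^sub>0"
  proof -
    have "distr M (Pi\<^sub>M {..<n} (\<lambda>_. borel)) (\<lambda>\<omega>. \<lambda>i\<in>{..<n}. X i \<omega>) = (\<Pi>\<^sub>M i\<in>{..<n}. distr M borel (X i))"
      using n_pos by (subst indep_vars_iff_distr_eq_PiM'[symmetric]) (auto simp: indep lessThan_empty_iff)
    also have "\<dots> = Pi\<^sub>M {..<n} (\<lambda>_. L)"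
      by (rule PiM_cong) (auto simp: distr_X)
    also have "distr M (Pi\<^sub>M {..<n} (\<lambda>_. borel)) (\<lambda>\<omega>. \<lambda>i\<in>{..<n}. X i \<omega>) = distr M (Pi\<^sub>M {..<n} (\<lambda>_. L)) data"
      by (rule distr_cong) (auto simp: sets_PiM data)
    finally show ?thesis by (simp add: sample_law_eq)
  qed
  have AE_data: "AE \<omega> in M. P (data \<omega>)" if "AE x in sample_law \<nu> f n \<theta>\<^sub>0. P x" for P
    by (rule AE_distrD[OF data_meas]) (use that in \<open>simp only: distr_data\<close>)
  have est_meas [measurable]: "est \<in> borel_measurable M"
    unfolding est[abs_def] using mle_meas[OF order_refl] unfolding sample_law_eq
    by (rule measurable_compose[OF data_meas])
  have D_data_meas [measurable]: "(\<lambda>\<omega>. D k l m (data \<omega>)) \<in> borel_measurable M" for k l m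
    using D_meas[of k l m] unfolding sample_law_eq by (rule measurable_compose[OF data_meas])
  have AE_mle: "AE \<omega> in M. est \<omega> \<in> \<Theta>"
    using AE_data[OF mle[OF order_refl]] by eventually_elim (auto simp: is_unique_mle_def est)
  have AE_q: "AE \<omega> in M. q (est \<omega>) = (1 / real n) *\<^sub>R (\<Sum>i<n. g (X i \<omega>))"
    using AE_data[OF q_mle[OF order_refl]] by eventually_elim (simp add: est data)
  have gX_meas [measurable]: "(\<lambda>\<omega>. g (X i \<omega>)) \<in> borel_measurable M" if "i < n" for i
    using measurable_compose[OF X_meas[OF that] g_meas] .

  \<comment> \<open>The whitened observations and their standardized sum\<close>
  define \<zeta> where "\<zeta> x = R *v (g x - q \<theta>\<^sub>0)" for x
  have \<zeta>_meas [measurable]: "\<zeta> \<in> borel_measurable borel"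
    unfolding \<zeta>_def[abs_def]
    by (rule borel_measurable_continuous_on[OF _ borel_measurable_diff[OF g_meas borel_measurable_const]])
      (intro linear_continuous_on matrix_vector_mul_bounded_linear)
  have \<xi>_eq: "\<xi> i j \<omega> = \<zeta> (X i \<omega>) $ j" for i j \<omega>
    by (simp add: \<xi> \<zeta>_def R_def matrix_vector_mult_def)
  define Wn where "Wn \<omega> = (1 / sqrt (real n)) *\<^sub>R (\<Sum>i<n. \<zeta> (X i \<omega>))" for \<omega>
  define T where "T \<omega> = sqrt (real n) *\<^sub>R (principal_sqrt I *v (est \<omega> - \<theta>\<^sub>0))" for \<omega>
  have Wn_meas [measurable]: "Wn \<in> borel_measurable M"
    unfolding Wn_def[abs_def] by measurable
  have T_meas [measurable]: "T \<in> borel_measurable M"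
    unfolding T_def[abs_def]
    by (rule borel_measurable_scaleR[OF borel_measurable_const
          borel_measurable_continuous_on[OF _ borel_measurable_diff[OF est_meas borel_measurable_const]]])
      (intro linear_continuous_on matrix_vector_mul_bounded_linear)
  note [measurable] = Cb2_measurable(1)[OF h]
  have h_int: "integrable M (\<lambda>\<omega>. h (V \<omega>))" if [measurable]: "V \<in> borel_measurable M" for V
    using Cb2_bound[OF h] by (intro integrable_const_bound[of _ "sup_norm h"]) auto

  \<comment> \<open>Normal approximation of the standardized sum\<close>
  define coef where "coef = sqrt pi * seminorm2 h / (4 * sqrt 2 * real n powr (3/2))"
  define rhs1 where "rhs1 = (\<Sum>i<n. \<Sum>j\<in>UNIV. \<Sum>k\<in>UNIV. \<Sum>l\<in>UNIV.
             (\<integral>\<^sup>+\<omega>. ennreal \<bar>\<xi> i j \<omega> * \<xi> i k \<omega> * \<xi> i l \<omega>\<bar> \<partial>M)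
             + 2 * ennreal \<bar>\<integral>\<omega>. \<xi> i j \<omega> * \<xi> i k \<omega> \<partial>M\<bar> * (\<integral>\<^sup>+\<omega>. ennreal \<bar>\<xi> i l \<omega>\<bar> \<partial>M))"
  have Z_eq: "(\<integral>\<omega>. h (Z \<omega>) \<partial>N) = (\<integral>z. h z \<partial>std_gaussian)"
  proof -
    have "distr N lborel Z = std_gaussian" "Z \<in> measurable N lborel"
      using normal_Z by (auto simp: distributed_def std_gaussian_def)
    then show ?thesis using integral_distr[of Z N lborel h] by simp
  qed

  have stein: "ennreal \<bar>(\<integral>\<omega>. h (Wn \<omega>) \<partial>M) - (\<integral>z. h z \<partial>std_gaussian)\<bar> \<le> ennreal coef * rhs1"
  proof (cases "seminorm2 h = 0")
    case True
    interpret N: prob_space "std_gaussian :: (real ^ 'd) measure" by (rule prob_space_std_gaussian)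
    have const: "h x = h 0" for x by (rule Cb2_seminorm2_eq_0_imp_constant[OF h True])
    have "(\<integral>\<omega>. h (Wn \<omega>) \<partial>M) = (\<integral>\<omega>. h 0 \<partial>M)" "(\<integral>z. h z \<partial>std_gaussian) = (\<integral>z. h 0 \<partial>(std_gaussian :: (real ^ 'd) measure))"
      by (rule Bochner_Integration.integral_cong[OF refl const])+
    then have "(\<integral>\<omega>. h (Wn \<omega>) \<partial>M) = h 0" "(\<integral>z. h z \<partial>std_gaussian) = h 0"
      by (simp_all add: prob_space N.prob_space[simplified])
    then show ?thesis by simp
  next
    case False
    then have "coef > 0"
      using seminorm2_nonneg[OF h] \<open>real n > 0\<close> by (simp add: coef_def)
    show ?thesis
    \<comment> \<open>Only the third absolute moments of single components decide: if all of them
      are finite, so are the mixed moments.\<close>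
    proof (cases "\<exists>i<n. \<exists>j. (\<integral>\<^sup>+\<omega>. ennreal \<bar>\<xi> i j \<omega> * \<xi> i j \<omega> * \<xi> i j \<omega>\<bar> \<partial>M) = \<top>")
      case True
      then obtain i j where ij: "i < n" "(\<integral>\<^sup>+\<omega>. ennreal \<bar>\<xi> i j \<omega> * \<xi> i j \<omega> * \<xi> i j \<omega>\<bar> \<partial>M) = \<top>" by blast
      have "rhs1 = \<top>"
        unfolding rhs1_def using ij by (auto simp: ennreal_sum_eq_top)
      then show ?thesis using \<open>coef > 0\<close> by (simp add: ennreal_mult_top)
    next
      case False
      have cubes: "integrable M (\<lambda>\<omega>. \<bar>\<zeta> (X i \<omega>) $ j\<bar> ^ 3)" if i: "i < n" for i j
      proof (rule integrableI_nonneg)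
        show "(\<lambda>\<omega>. \<bar>\<zeta> (X i \<omega>) $ j\<bar> ^ 3) \<in> borel_measurable M" using i by measurable
        have "\<bar>\<zeta> (X i \<omega>) $ j\<bar> ^ 3 = \<bar>\<xi> i j \<omega> * \<xi> i j \<omega> * \<xi> i j \<omega>\<bar>" for \<omega>
          by (simp add: \<xi>_eq abs_mult power3_eq_cube)
        then show "(\<integral>\<^sup>+\<omega>. ennreal (\<bar>\<zeta> (X i \<omega>) $ j\<bar> ^ 3) \<partial>M) < \<infinity>"
          using False i by (simp add: top.not_eq_extremum)
      qed auto
      have transfer: "integrable L u \<longleftrightarrow> integrable M (\<lambda>\<omega>. u (X i \<omega>))"
          "(\<integral>x. u x \<partial>L) = (\<integral>\<omega>. u (X i \<omega>) \<partial>M)"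
        if "i < n" and [measurable]: "u \<in> borel_measurable borel" for i and u :: "real ^ 't \<Rightarrow> real"
        unfolding distr_X[OF that(1), symmetric] using X_meas[OF that(1)]
        by (auto simp: integrable_distr_eq integral_distr)
      have \<zeta>_cubes: "integrable L (\<lambda>x. \<bar>\<zeta> x $ j\<bar> ^ 3)" for j
        using cubes[of 0 j] transfer(1)[of 0 "\<lambda>x. \<bar>\<zeta> x $ j\<bar> ^ 3"] n_pos by simp
      have \<zeta>_sq: "integrable L (\<lambda>x. \<zeta> x $ j * \<zeta> x $ k)" for j k
        by (rule L.integrable_mult2_of_cubes[OF _ _ \<zeta>_cubes \<zeta>_cubes]) measurable
      \<comment> \<open>Undoing the whitening writes \<open>g\<close> as a linear function of
        \<open>\<zeta>\<close> plus a constant, so square integrability passes from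
        \<open>\<zeta>\<close> to \<open>g\<close> and the asymptotic results become
        available.\<close>
      have g_eq: "g x $ l = (\<Sum>j\<in>UNIV. principal_sqrt K $ l $ j * \<zeta> x $ j) + q \<theta>\<^sub>0 $ l" for x l
      proof -
        have "principal_sqrt K *v \<zeta> x = g x - q \<theta>\<^sub>0"
          using matrix_inv_mult(2)[OF whitening(1)] by (simp add: \<zeta>_def R_def matrix_vector_mul_assoc)
        then have "(principal_sqrt K *v \<zeta> x) $ l = g x $ l - q \<theta>\<^sub>0 $ l" by simp
        then show ?thesis by (simp add: matrix_vector_mult_def)
      qed
      have g_sq: "integrable L (\<lambda>x. (g x $ l)\<^sup>2)" for l
      proof -
        have "integrable L (\<lambda>x. (c * \<zeta> x $ j)\<^sup>2)" for c j
          using integrable_mult_right[OF \<zeta>_sq[of j j], of "c\<^sup>2"]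
          by (simp add: power_mult_distrib power2_eq_square[of "\<zeta> _ $ _"])
        then have "integrable L (\<lambda>x. (\<Sum>j\<in>UNIV. principal_sqrt K $ l $ j * \<zeta> x $ j)\<^sup>2)"
          by (intro square_integrable_sum) auto
        then show ?thesis unfolding g_eq by (intro square_integrable_add) auto
      qed
      interpret consistent_mle \<nu> f \<Theta> \<theta>\<^sub>0 n mle q J g
        by standard (fact mle_meas mle consistent q_der g_meas q_mle g_sq)+
      have g_int: "integrable L (\<lambda>x. g x $ l - q \<theta>\<^sub>0 $ l)" for l
        using square_integrable_integrable[OF _ g_sq[of l]] by simp
      have g_prod_int: "integrable L (\<lambda>x. (g x $ l - q \<theta>\<^sub>0 $ l) * (g x $ m - q \<theta>\<^sub>0 $ m))" for l m
      proof -
        have eq: "(g x $ l - q \<theta>\<^sub>0 $ l) * (g x $ m - q \<theta>\<^sub>0 $ m) = (\<Sum>i\<in>UNIV. \<Sum>j\<in>UNIV.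
            (principal_sqrt K $ l $ i * principal_sqrt K $ m $ j) * (\<zeta> x $ i * \<zeta> x $ j))" for x
          by (simp add: g_eq sum_product mult_ac)
        show ?thesis unfolding eq
          by (intro Bochner_Integration.integrable_sum integrable_mult_right \<zeta>_sq)
      qed
      have \<zeta>_nth: "\<zeta> x $ j = (\<Sum>l\<in>UNIV. R $ j $ l * (g x $ l - q \<theta>\<^sub>0 $ l))" for x j
        by (simp add: \<zeta>_def matrix_vector_mult_def)
      have \<zeta>_mean: "(\<integral>x. \<zeta> x $ j \<partial>L) = 0" for j
        unfolding \<zeta>_nth using g_int g_mean by (simp add: Bochner_Integration.integral_sum)
      have \<zeta>_cov: "(\<integral>x. \<zeta> x $ j * \<zeta> x $ k \<partial>L) = (if j = k then 1 else 0)" for j k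
      proof -
        have "(\<integral>x. \<zeta> x $ j * \<zeta> x $ k \<partial>L) = (\<integral>x. (\<Sum>l\<in>UNIV. \<Sum>m\<in>UNIV. (R $ j $ l * R $ k $ m)
            * ((g x $ l - q \<theta>\<^sub>0 $ l) * (g x $ m - q \<theta>\<^sub>0 $ m))) \<partial>L)"
          unfolding \<zeta>_nth sum_product by (simp add: mult_ac)
        also have "\<dots> = (\<Sum>l\<in>UNIV. \<Sum>m\<in>UNIV. (R $ j $ l * R $ k $ m) * K $ l $ m)"
          using g_prod_int by (simp add: Bochner_Integration.integral_sum g_cov K I J_def)
        also have "\<dots> = (R ** K ** transpose R) $ j $ k"
          unfolding matrix_matrix_mult_def transpose_def
          by (simp add: sum_distrib_left sum_distrib_right mult_ac) (rule sum.swap)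
        also have "\<dots> = (if j = k then 1 else 0)"
          unfolding whitening(2) by (simp add: mat_def)
        finally show ?thesis .
      qed
      interpret clt_setup M "\<lambda>i \<omega>. \<zeta> (X i \<omega>)" n h
      proof
        show "indep_vars (\<lambda>_. borel) (\<lambda>i \<omega>. \<zeta> (X i \<omega>)) {..<n}"
          by (rule indep_vars_compose2[OF indep]) measurable
        show "expectation (\<lambda>\<omega>. \<zeta> (X i \<omega>) $ j) = 0" if "i < n" for i j
          using transfer(2)[OF that, of "\<lambda>x. \<zeta> x $ j"] \<zeta>_mean by simp
        have "expectation (\<lambda>\<omega>. \<zeta> (X i \<omega>) $ j * \<zeta> (X i \<omega>) $ k) = (if j = k then 1 else 0)" if "i < n" for i j k
          using transfer(2)[OF that, of "\<lambda>x. \<zeta> x $ j * \<zeta> x $ k"] \<zeta>_cov by simp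
        then show "(\<Sum>i<n. expectation (\<lambda>\<omega>. \<zeta> (X i \<omega>) $ j * \<zeta> (X i \<omega>) $ k)) = (if j = k then real n else 0)" for j k
          by simp
      qed (use n_pos cubes h in auto)
      have rhs1_eq: "rhs1 = ennreal third_moments"
      proof -
        have 1: "(\<integral>\<^sup>+\<omega>. ennreal \<bar>\<xi> i j \<omega> * \<xi> i k \<omega> * \<xi> i l \<omega>\<bar> \<partial>M)
            = ennreal (expectation (\<lambda>\<omega>. \<bar>\<zeta> (X i \<omega>) $ j * \<zeta> (X i \<omega>) $ k * \<zeta> (X i \<omega>) $ l\<bar>))" if "i < n" for i j k l
          unfolding \<xi>_eq using Y_int(3)[OF that] by (intro nn_integral_eq_integral integrable_abs) auto
        have 2: "(\<integral>\<^sup>+\<omega>. ennreal \<bar>\<xi> i l \<omega>\<bar> \<partial>M) = ennreal (expectation (\<lambda>\<omega>. \<bar>\<zeta> (X i \<omega>) $ l\<bar>))" if "i < n" for i l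
          unfolding \<xi>_eq using Y_int(1)[OF that] by (intro nn_integral_eq_integral integrable_abs) auto
        have aux: "ennreal x + 2 * ennreal y * ennreal z = ennreal (x + 2 * y * z)"
          if "0 \<le> x" "0 \<le> y" "0 \<le> z" for x y z
          using that by (simp add: ennreal_mult)
        have "(\<integral>\<^sup>+\<omega>. ennreal \<bar>\<xi> i j \<omega> * \<xi> i k \<omega> * \<xi> i l \<omega>\<bar> \<partial>M)
             + 2 * ennreal \<bar>\<integral>\<omega>. \<xi> i j \<omega> * \<xi> i k \<omega> \<partial>M\<bar> * (\<integral>\<^sup>+\<omega>. ennreal \<bar>\<xi> i l \<omega>\<bar> \<partial>M)
            = ennreal (expectation (\<lambda>\<omega>. \<bar>\<zeta> (X i \<omega>) $ j * \<zeta> (X i \<omega>) $ k * \<zeta> (X i \<omega>) $ l\<bar>)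
              + 2 * \<bar>expectation (\<lambda>\<omega>. \<zeta> (X i \<omega>) $ j * \<zeta> (X i \<omega>) $ k)\<bar> * expectation (\<lambda>\<omega>. \<bar>\<zeta> (X i \<omega>) $ l\<bar>))"
          if "i < n" for i j k l
          unfolding 1[OF that] 2[OF that] unfolding \<xi>_eq
          by (rule aux) simp_all
        note term_eq = this
        define t where "t i j k l = expectation (\<lambda>\<omega>. \<bar>\<zeta> (X i \<omega>) $ j * \<zeta> (X i \<omega>) $ k * \<zeta> (X i \<omega>) $ l\<bar>)
          + 2 * \<bar>expectation (\<lambda>\<omega>. \<zeta> (X i \<omega>) $ j * \<zeta> (X i \<omega>) $ k)\<bar> * expectation (\<lambda>\<omega>. \<bar>\<zeta> (X i \<omega>) $ l\<bar>)" for i j k l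
        have t: "0 \<le> t i j k l" for i j k l unfolding t_def by simp
        have "rhs1 = (\<Sum>i<n. \<Sum>j\<in>UNIV. \<Sum>k\<in>UNIV. \<Sum>l\<in>UNIV. ennreal (t i j k l))"
          unfolding rhs1_def t_def by (intro sum.cong refl term_eq) simp
        also have "\<dots> = ennreal (\<Sum>i<n. \<Sum>j\<in>UNIV. \<Sum>k\<in>UNIV. \<Sum>l\<in>UNIV. t i j k l)"
          using t by (simp add: sum_nonneg)
        finally show ?thesis by (simp only: third_moments_def t_def)
      qed
      have "third_moments \<ge> 0" unfolding third_moments_def by (intro sum_nonneg) auto
      moreover have "\<bar>(\<integral>\<omega>. h (Wn \<omega>) \<partial>M) - (\<integral>z. h z \<partial>std_gaussian)\<bar> \<le> coef * third_moments"
        using normal_approximation unfolding clt_setup.W_def[OF clt_setup_axioms] clt_setup.a_def[OF clt_setup_axioms]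
        by (simp add: Wn_def coef_def)
      ultimately show ?thesis
        using \<open>coef > 0\<close> by (simp add: rhs1_eq ennreal_mult[symmetric] ennreal_leI)
    qed
  qed

  \<comment> \<open>Comparison of the estimator with the standardized sum\<close>
  have \<xi>_sum: "AE \<omega> in M. Wn \<omega> = sqrt (real n) *\<^sub>R (R *v (q (est \<omega>) - q \<theta>\<^sub>0))"
    using AE_q
  proof eventually_elim
    case (elim \<omega>)
    have "(\<Sum>i<n. \<zeta> (X i \<omega>)) = R *v (\<Sum>i<n. g (X i \<omega>) - q \<theta>\<^sub>0)"
      unfolding \<zeta>_def by (simp add: linear_sum[OF matrix_vector_mul_linear])
    also have "(\<Sum>i<n. g (X i \<omega>) - q \<theta>\<^sub>0) = real n *\<^sub>R (q (est \<omega>) - q \<theta>\<^sub>0)"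
      using \<open>real n > 0\<close> unfolding elim by (simp add: sum_subtractf scaleR_diff_right sum_constant_scaleR del: sum_constant)
    finally show ?case
      using \<open>real n > 0\<close> by (simp add: Wn_def matrix_vector_mult_scaleR real_div_sqrt)
  qed

  define E where "E = {\<omega>\<in>space M. \<bar>Q \<omega>\<bar> < \<epsilon>}"
  \<comment> \<open>\<open>Q\<close> is a coordinate error of largest absolute value, so bounding it
    bounds them all. This form of the event is visibly measurable, whereas \<open>imax\<close> is an
    arbitrary selection.\<close>
  have E_eq: "E = {\<omega>\<in>space M. \<forall>j. \<bar>est \<omega> $ j - \<theta>\<^sub>0 $ j\<bar> < \<epsilon>}"
    unfolding E_def Q using imax by (auto intro: le_less_trans)
  have E_meas [measurable]: "E \<in> sets M" unfolding E_eq by measurable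
  \<comment> \<open>A measurable version of \<open>A1\<close>: measurability of \<open>q\<close> is
    not given, but \<open>q\<close> at the estimator is almost surely the average of
    \<open>g\<close>.\<close>
  define a1 where "a1 j \<omega> = real n * (\<Sum>k\<in>UNIV. (G - R) $ j $ k * (((1 / real n) *\<^sub>R (\<Sum>i<n. g (X i \<omega>))) $ k - q \<theta>\<^sub>0 $ k))" for j \<omega>
  have a1_meas [measurable]: "a1 j \<in> borel_measurable M" for j
    unfolding a1_def[abs_def] by measurable
  have a1_AE: "AE \<omega> in M. \<forall>j. a1 j \<omega> = A1 j \<omega>"
    using AE_q by eventually_elim (simp add: a1_def A1 G_def R_def J_def)
  have A2_meas [measurable]: "A2 j \<in> borel_measurable M" for j
    unfolding A2[abs_def] by measurable

  have pointwise: "AE \<omega> in M. ennreal \<bar>h (T \<omega>) - h (Wn \<omega>)\<bar>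
      \<le> ennreal (2 * sup_norm h / \<epsilon>\<^sup>2) * ennreal (\<Sum>j\<in>UNIV. (est \<omega> $ j - \<theta>\<^sub>0 $ j)\<^sup>2)
        + ennreal (seminorm1 h / sqrt (real n)) * (\<Sum>j\<in>UNIV. ennreal \<bar>a1 j \<omega>\<bar> * indicator E \<omega> + ennreal \<bar>A2 j \<omega>\<bar> * indicator E \<omega>)"
    using AE_mle AE_data[OF D] \<xi>_sum a1_AE AE_space
  proof eventually_elim
    case (elim \<omega>)
    show ?case
    proof (cases "\<omega> \<in> E")
      case False
      \<comment> \<open>Chebyshev in pointwise form: off \<open>E\<close> the squared error is at
        least \<open>\<epsilon>\<^sup>2\<close>, and two values of \<open>h\<close> differ by at
        most \<open>2 * sup_norm h\<close>.\<close>
      then have far: "\<epsilon> \<le> \<bar>Q \<omega>\<bar>" using elim by (auto simp: E_def)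
      have "\<epsilon>\<^sup>2 \<le> (Q \<omega>)\<^sup>2" using far eps_pos by (simp add: abs_le_square_iff[symmetric])
      also have "\<dots> \<le> (\<Sum>j\<in>UNIV. (est \<omega> $ j - \<theta>\<^sub>0 $ j)\<^sup>2)"
        unfolding Q by (intro member_le_sum[where f="\<lambda>j. (est \<omega> $ j - \<theta>\<^sub>0 $ j)\<^sup>2"]) auto
      finally have "1 \<le> (\<Sum>j\<in>UNIV. (est \<omega> $ j - \<theta>\<^sub>0 $ j)\<^sup>2) / \<epsilon>\<^sup>2" using eps_pos by simp
      then have "2 * sup_norm h * 1 \<le> 2 * sup_norm h * ((\<Sum>j\<in>UNIV. (est \<omega> $ j - \<theta>\<^sub>0 $ j)\<^sup>2) / \<epsilon>\<^sup>2)"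
        using sup_norm_nonneg[OF h] by (intro mult_left_mono) auto
      moreover have "\<bar>h (T \<omega>) - h (Wn \<omega>)\<bar> \<le> 2 * sup_norm h"
        using Cb2_bound[OF h, of "T \<omega>"] Cb2_bound[OF h, of "Wn \<omega>"] by linarith
      ultimately have "\<bar>h (T \<omega>) - h (Wn \<omega>)\<bar> \<le> 2 * sup_norm h / \<epsilon>\<^sup>2 * (\<Sum>j\<in>UNIV. (est \<omega> $ j - \<theta>\<^sub>0 $ j)\<^sup>2)"
        by simp
      then have "ennreal \<bar>h (T \<omega>) - h (Wn \<omega>)\<bar> \<le> ennreal (2 * sup_norm h / \<epsilon>\<^sup>2) * ennreal (\<Sum>j\<in>UNIV. (est \<omega> $ j - \<theta>\<^sub>0 $ j)\<^sup>2)"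
        using sup_norm_nonneg[OF h] by (subst ennreal_mult[symmetric]) (auto intro!: ennreal_leI sum_nonneg)
      then show ?thesis by (rule order_trans) simp
    next
      case True
      then have near: "\<bar>est \<omega> $ j - \<theta>\<^sub>0 $ j\<bar> < \<epsilon>" for j by (auto simp: E_eq)
      have seg: "closed_segment \<theta>\<^sub>0 (est \<omega>) \<subseteq> \<Theta>" using eps_star elim(1) near by blast
      \<comment> \<open>Together with \<open>seg\<close> this puts the whole segment in the region
        where \<open>D\<close> bounds the second derivatives of \<open>q\<close>.\<close>
      have seg_near: "\<bar>\<theta>' $ j - \<theta>\<^sub>0 $ j\<bar> < \<epsilon>" if "\<theta>' \<in> closed_segment \<theta>\<^sub>0 (est \<omega>)" for \<theta>' j
      proof -
        obtain t where t: "0 \<le> t" "t \<le> 1" "\<theta>' = (1 - t) *\<^sub>R \<theta>\<^sub>0 + t *\<^sub>R est \<omega>"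
          using \<open>\<theta>' \<in> _\<close> by (auto simp: in_segment)
        have "\<theta>' $ j - \<theta>\<^sub>0 $ j = t * (est \<omega> $ j - \<theta>\<^sub>0 $ j)" by (simp add: t algebra_simps)
        then have "\<bar>\<theta>' $ j - \<theta>\<^sub>0 $ j\<bar> = \<bar>t\<bar> * \<bar>est \<omega> $ j - \<theta>\<^sub>0 $ j\<bar>"
          by (simp only: abs_mult)
        also have "\<dots> \<le> \<bar>est \<omega> $ j - \<theta>\<^sub>0 $ j\<bar>"
          using t by (intro mult_left_le_one_le) auto
        finally have "\<bar>\<theta>' $ j - \<theta>\<^sub>0 $ j\<bar> \<le> \<bar>est \<omega> $ j - \<theta>\<^sub>0 $ j\<bar>" .
        then show ?thesis using near[of j] by simp
      qed
      have comp: "\<bar>T \<omega> $ j - Wn \<omega> $ j\<bar> \<le> (\<bar>a1 j \<omega>\<bar> + \<bar>A2 j \<omega>\<bar>) / sqrt (real n)" for j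
        unfolding elim(3) T_def elim(4)[rule_format] A1 A2 R_def
        by (rule delta_step_pointwise[OF n_pos seg q_diff q_diff2 q_inv])
          (use elim(2) seg seg_near in blast)+
      have "\<bar>h (T \<omega>) - h (Wn \<omega>)\<bar> \<le> seminorm1 h * (\<Sum>j\<in>UNIV. \<bar>T \<omega> $ j - Wn \<omega> $ j\<bar>)"
        by (rule Cb2_lipschitz[OF h])
      also have "\<dots> \<le> seminorm1 h * (\<Sum>j\<in>UNIV. (\<bar>a1 j \<omega>\<bar> + \<bar>A2 j \<omega>\<bar>) / sqrt (real n))"
        using seminorm1_nonneg[OF h] comp by (intro mult_left_mono sum_mono)
      also have "\<dots> = seminorm1 h / sqrt (real n) * (\<Sum>j\<in>UNIV. \<bar>a1 j \<omega>\<bar> + \<bar>A2 j \<omega>\<bar>)"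
        by (simp add: sum_divide_distrib[symmetric])
      finally have "ennreal \<bar>h (T \<omega>) - h (Wn \<omega>)\<bar>
          \<le> ennreal (seminorm1 h / sqrt (real n)) * ennreal (\<Sum>j\<in>UNIV. \<bar>a1 j \<omega>\<bar> + \<bar>A2 j \<omega>\<bar>)"
        using seminorm1_nonneg[OF h] by (subst ennreal_mult[symmetric]) (auto intro!: ennreal_leI sum_nonneg)
      also have "ennreal (\<Sum>j\<in>UNIV. \<bar>a1 j \<omega>\<bar> + \<bar>A2 j \<omega>\<bar>)
          = (\<Sum>j\<in>UNIV. ennreal \<bar>a1 j \<omega>\<bar> * indicator E \<omega> + ennreal \<bar>A2 j \<omega>\<bar> * indicator E \<omega>)"
        using True by (simp add: sum_ennreal[symmetric])
      finally show ?thesis by (rule order_trans) simp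
    qed
  qed

  have delta: "ennreal \<bar>(\<integral>\<omega>. h (T \<omega>) \<partial>M) - (\<integral>\<omega>. h (Wn \<omega>) \<partial>M)\<bar>
      \<le> ennreal (2 * sup_norm h / \<epsilon>\<^sup>2) * (\<integral>\<^sup>+\<omega>. ennreal (\<Sum>j\<in>UNIV. (est \<omega> $ j - \<theta>\<^sub>0 $ j)\<^sup>2) \<partial>M)
        + ennreal (seminorm1 h / sqrt (real n)) * (\<Sum>j\<in>UNIV.
             (\<integral>\<^sup>+\<omega>. ennreal \<bar>A1 j \<omega>\<bar> \<partial>uniform_measure M E) + (\<integral>\<^sup>+\<omega>. ennreal \<bar>A2 j \<omega>\<bar> \<partial>uniform_measure M E))"
  proof -
    have a1_int: "(\<integral>\<^sup>+\<omega>. ennreal \<bar>a1 j \<omega>\<bar> \<partial>uniform_measure M E) = (\<integral>\<^sup>+\<omega>. ennreal \<bar>A1 j \<omega>\<bar> \<partial>uniform_measure M E)" for j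
    proof (rule nn_integral_cong_AE, rule AE_uniform_measureI[OF E_meas])
      show "AE \<omega> in M. \<omega> \<in> E \<longrightarrow> ennreal \<bar>a1 j \<omega>\<bar> = ennreal \<bar>A1 j \<omega>\<bar>"
        using a1_AE by eventually_elim simp
    qed
    have "\<bar>(\<integral>\<omega>. h (T \<omega>) \<partial>M) - (\<integral>\<omega>. h (Wn \<omega>) \<partial>M)\<bar> = \<bar>\<integral>\<omega>. h (T \<omega>) - h (Wn \<omega>) \<partial>M\<bar>"
      using h_int[OF T_meas] h_int[OF Wn_meas] by simp
    also have "\<dots> \<le> (\<integral>\<omega>. \<bar>h (T \<omega>) - h (Wn \<omega>)\<bar> \<partial>M)" by (rule integral_abs_bound)
    finally have "ennreal \<bar>(\<integral>\<omega>. h (T \<omega>) \<partial>M) - (\<integral>\<omega>. h (Wn \<omega>) \<partial>M)\<bar> \<le> ennreal (\<integral>\<omega>. \<bar>h (T \<omega>) - h (Wn \<omega>)\<bar> \<partial>M)"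
      by (rule ennreal_leI)
    also have "\<dots> = (\<integral>\<^sup>+\<omega>. ennreal \<bar>h (T \<omega>) - h (Wn \<omega>)\<bar> \<partial>M)"
      using h_int[OF T_meas] h_int[OF Wn_meas] by (subst nn_integral_eq_integral) auto
    also have "\<dots> \<le> (\<integral>\<^sup>+\<omega>. ennreal (2 * sup_norm h / \<epsilon>\<^sup>2) * ennreal (\<Sum>j\<in>UNIV. (est \<omega> $ j - \<theta>\<^sub>0 $ j)\<^sup>2)
        + ennreal (seminorm1 h / sqrt (real n)) * (\<Sum>j\<in>UNIV. ennreal \<bar>a1 j \<omega>\<bar> * indicator E \<omega> + ennreal \<bar>A2 j \<omega>\<bar> * indicator E \<omega>) \<partial>M)"
      by (rule nn_integral_mono_AE[OF pointwise])
    also have "\<dots> = ennreal (2 * sup_norm h / \<epsilon>\<^sup>2) * (\<integral>\<^sup>+\<omega>. ennreal (\<Sum>j\<in>UNIV. (est \<omega> $ j - \<theta>\<^sub>0 $ j)\<^sup>2) \<partial>M)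
        + ennreal (seminorm1 h / sqrt (real n)) * (\<Sum>j\<in>UNIV.
             (\<integral>\<^sup>+\<omega>. ennreal \<bar>a1 j \<omega>\<bar> * indicator E \<omega> \<partial>M) + (\<integral>\<^sup>+\<omega>. ennreal \<bar>A2 j \<omega>\<bar> * indicator E \<omega> \<partial>M))"
      by (simp add: nn_integral_add nn_integral_cmult nn_integral_sum)
    also have "\<dots> \<le> ennreal (2 * sup_norm h / \<epsilon>\<^sup>2) * (\<integral>\<^sup>+\<omega>. ennreal (\<Sum>j\<in>UNIV. (est \<omega> $ j - \<theta>\<^sub>0 $ j)\<^sup>2) \<partial>M)
        + ennreal (seminorm1 h / sqrt (real n)) * (\<Sum>j\<in>UNIV.
             (\<integral>\<^sup>+\<omega>. ennreal \<bar>a1 j \<omega>\<bar> \<partial>uniform_measure M E) + (\<integral>\<^sup>+\<omega>. ennreal \<bar>A2 j \<omega>\<bar> \<partial>uniform_measure M E))"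
      by (intro add_left_mono mult_left_mono sum_mono add_mono nn_integral_indicator_le_uniform_measure prob_M) auto
    finally show ?thesis by (simp only: a1_int)
  qed

  \<comment> \<open>Combination of the two comparisons by the triangle inequality\<close>
  have "ennreal \<bar>(\<integral>\<omega>. h (T \<omega>) \<partial>M) - (\<integral>\<omega>. h (Z \<omega>) \<partial>N)\<bar>
      \<le> ennreal \<bar>(\<integral>\<omega>. h (Wn \<omega>) \<partial>M) - (\<integral>z. h z \<partial>std_gaussian)\<bar>
        + ennreal \<bar>(\<integral>\<omega>. h (T \<omega>) \<partial>M) - (\<integral>\<omega>. h (Wn \<omega>) \<partial>M)\<bar>"
    unfolding Z_eq ennreal_plus[OF abs_ge_zero abs_ge_zero, symmetric] by (intro ennreal_leI) linarith
  also have "\<dots> \<le> ennreal coef * rhs1 + (ennreal (2 * sup_norm h / \<epsilon>\<^sup>2) * (\<integral>\<^sup>+\<omega>. ennreal (\<Sum>j\<in>UNIV. (est \<omega> $ j - \<theta>\<^sub>0 $ j)\<^sup>2) \<partial>M)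
        + ennreal (seminorm1 h / sqrt (real n)) * (\<Sum>j\<in>UNIV.
             (\<integral>\<^sup>+\<omega>. ennreal \<bar>A1 j \<omega>\<bar> \<partial>uniform_measure M E) + (\<integral>\<^sup>+\<omega>. ennreal \<bar>A2 j \<omega>\<bar> \<partial>uniform_measure M E)))"
    by (rule add_mono[OF stein delta])
  finally show ?thesis
    unfolding T_def coef_def rhs1_def E_def by (simp only: add.assoc)
qed

end
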